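(* Let $P\subset A$ be an inclusion of separable unital $C^*$-algebras of index-finite type, with conditional expectation $E:A\to P$ of index-finite type. If $A$ is simple and $E$ has the weak tracial Rokhlin property, then $P$ is simple.
   Context: Fix a free ultrafilter $\omega$ on $\mathbb N$. $A_\omega=\ell^\infty(\mathbb N,A)/\{(a_n)_n:\lim_{n\to\omega}\|a_n\|=0\}$, with $A\subset A_\omega$ as constant sequences; $E$ induces $E_\omega:A_\omega\to P_\omega$ coordinatewise. For positive $a,b$ in a $C^*$-algebra $C$, $a\lesssim b$ (in $C$) means that there is a sequence $(x_n)$ in $C$ with $x_nbx_n^*\to a$. Inclusions share the same unit. $E:A\to P$ is of index-finite type if there is a finite family $\{(u_j,v_j)\}_j\subset A\times A$ with $x=\sum_j u_jE(v_jx)=\sum_jE(xu_j)v_j$ for all $x\in A$; then $\operatorname{Index}E:=\sum_ju_jv_j\in Z(A)$, a positive scalar when $A$ is simple; such an $E$ is automatically faithful. Let $\mathcal E_E$ be the Hilbert $P$-module completion of $A$ for $\langle x,y\rangle_P=E(x^*y)$, with $A$ acting by left multiplication; the Jones projection $e_P$ is the adjointable operator on $\mathcal E_E$ extending $x\mapsto E(x)$, and $C^*\langle A,e_P\rangle=\operatorname{span}\{xe_Py:x,y\in A\}$ is the basic construction. For $A$ simple, $E$ has the weak tracial Rokhlin property if for every nonzero positive $a\in A_\omega$ there is a nonzero positive contraction $e\in A_\omega\cap A'$ such that $(\operatorname{Index}E)\,e^{1/2}e_Pe^{1/2}=e$ (in the ultrapower of $C^*\langle A,e_P\rangle$) and $1-(\operatorname{Index}E)E_\omega(e)\lesssim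 a$ in $A_\omega$. *)

theory Defs
  imports "HOL-Analysis.Analysis" "HOL-Algebra.Module" "HOL-Algebra.QuotRing" "HOL-Algebra.Subrings"
begin

section \<open>C*-algebras with explicit carriers\<close>

text \<open>
  Ultrapowers and the basic construction depend on terms (the ultrafilter, the conditional
  expectation), so C*-algebras are records with a carrier in the style of HOL-Algebra.
  The field \<open>smult\<close> inherited from \<open>module\<close> is the scalar multiplication over the complex
  numbers.
\<close>

definition complex_ring :: "complex ring" where
  "complex_ring = \<lparr>carrier = UNIV, mult = (*), one = 1, zero = 0, add = (+)\<rparr>"

record 'a cstar = "(complex, 'a) module" +
  star :: "'a \<Rightarrow> 'a"
  nrm :: "'a \<Rightarrow> real"

text \<open>The guard makes this nonnegative and symmetric outside the carrier as well, as the locale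
  \<open>Metric_space\<close> demands.\<close>

definition cdist :: "'a cstar \<Rightarrow> 'a \<Rightarrow> 'a \<Rightarrow> real" where
  "cdist C x y = (if x \<in> carrier C \<and> y \<in> carrier C then nrm C (x \<ominus>\<^bsub>C\<^esub> y) else 0)"

definition norm_topology :: "'a cstar \<Rightarrow> 'a topology" where
  "norm_topology C = Metric_space.mtopology (carrier C) (cdist C)"

locale cstar_algebra = ring C + scalars: module complex_ring C
  for C :: "'a cstar" (structure) +
  assumes smult_mult_left:
      "\<lbrakk>x \<in> carrier C; y \<in> carrier C\<rbrakk> \<Longrightarrow> (c \<odot> x) \<otimes> y = c \<odot> (x \<otimes> y)"
    and smult_mult_right:
      "\<lbrakk>x \<in> carrier C; y \<in> carrier C\<rbrakk> \<Longrightarrow> x \<otimes> (c \<odot> y) = c \<odot> (x \<otimes> y)"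
    and star_closed: "x \<in> carrier C \<Longrightarrow> star C x \<in> carrier C"
    and star_star: "x \<in> carrier C \<Longrightarrow> star C (star C x) = x"
    and star_add:
      "\<lbrakk>x \<in> carrier C; y \<in> carrier C\<rbrakk> \<Longrightarrow> star C (x \<oplus> y) = star C x \<oplus> star C y"
    and star_smult: "x \<in> carrier C \<Longrightarrow> star C (c \<odot> x) = cnj c \<odot> star C x"
    and star_mult:
      "\<lbrakk>x \<in> carrier C; y \<in> carrier C\<rbrakk> \<Longrightarrow> star C (x \<otimes> y) = star C y \<otimes> star C x"
    and nrm_nonneg: "x \<in> carrier C \<Longrightarrow> 0 \<le> nrm C x"
    and nrm_eq_0_iff: "x \<in> carrier C \<Longrightarrow> nrm C x = 0 \<longleftrightarrow> x = \<zero>"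
    and nrm_triangle:
      "\<lbrakk>x \<in> carrier C; y \<in> carrier C\<rbrakk> \<Longrightarrow> nrm C (x \<oplus> y) \<le> nrm C x + nrm C y"
    and nrm_smult: "x \<in> carrier C \<Longrightarrow> nrm C (c \<odot> x) = cmod c * nrm C x"
    and nrm_mult:
      "\<lbrakk>x \<in> carrier C; y \<in> carrier C\<rbrakk> \<Longrightarrow> nrm C (x \<otimes> y) \<le> nrm C x * nrm C y"
    and cstar_identity: "x \<in> carrier C \<Longrightarrow> nrm C (star C x \<otimes> x) = (nrm C x)\<^sup>2"
    and complete: "Metric_space.mcomplete (carrier C) (cdist C)"

text \<open>A unital C*-subalgebra \<open>P\<close> of \<open>A\<close> with the same unit; as a C*-algebra in its own right it
  is \<open>A\<lparr>carrier := P\<rparr>\<close>.\<close>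

definition unital_cstar_subalgebra :: "'a set \<Rightarrow> 'a cstar \<Rightarrow> bool" where
  "unital_cstar_subalgebra P A \<longleftrightarrow>
     subring P A \<and> (\<forall>c. \<forall>x\<in>P. c \<odot>\<^bsub>A\<^esub> x \<in> P) \<and> (\<forall>x\<in>P. star A x \<in> P) \<and>
     closedin (norm_topology A) P"

text \<open>No separate condition on scalars is needed: ideals of a unital algebra are subspaces.\<close>

definition simple_cstar :: "'a cstar \<Rightarrow> bool" where
  "simple_cstar C \<longleftrightarrow> carrier C \<noteq> {\<zero>\<^bsub>C\<^esub>} \<and>
     (\<forall>I. ideal I C \<and> closedin (norm_topology C) I \<longrightarrow> I = {\<zero>\<^bsub>C\<^esub>} \<or> I = carrier C)"

definition positives :: "'a cstar \<Rightarrow> 'a set" where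
  "positives C = {star C x \<otimes>\<^bsub>C\<^esub> x | x. x \<in> carrier C}"

definition pos_sqrt :: "'a cstar \<Rightarrow> 'a \<Rightarrow> 'a" where
  "pos_sqrt C a = (THE b. b \<in> positives C \<and> b \<otimes>\<^bsub>C\<^esub> b = a)"

definition cuntz_below :: "'a cstar \<Rightarrow> 'a \<Rightarrow> 'a \<Rightarrow> bool" where
  "cuntz_below C a b \<longleftrightarrow>
     (\<exists>x :: nat \<Rightarrow> 'a. range x \<subseteq> carrier C \<and>
        limitin (norm_topology C) (\<lambda>n. x n \<otimes>\<^bsub>C\<^esub> b \<otimes>\<^bsub>C\<^esub> star C (x n)) a sequentially)"

section \<open>Ultrapowers\<close>

definition free_ultrafilter :: "nat filter \<Rightarrow> bool" where
  "free_ultrafilter \<omega> \<longleftrightarrow> \<omega> \<noteq> bot \<and>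
     (\<forall>Q. eventually Q \<omega> \<or> eventually (\<lambda>n. \<not> Q n) \<omega>) \<and>
     (\<forall>k. eventually (\<lambda>n. n \<noteq> k) \<omega>)"

definition ell_infty :: "'a cstar \<Rightarrow> (nat \<Rightarrow> 'a) cstar" where
  "ell_infty C =
     \<lparr>carrier = {f. range f \<subseteq> carrier C \<and> bdd_above (range (\<lambda>n. nrm C (f n)))},
      mult = (\<lambda>f g n. f n \<otimes>\<^bsub>C\<^esub> g n), one = (\<lambda>n. \<one>\<^bsub>C\<^esub>),
      zero = (\<lambda>n. \<zero>\<^bsub>C\<^esub>), add = (\<lambda>f g n. f n \<oplus>\<^bsub>C\<^esub> g n),
      smult = (\<lambda>c f n. c \<odot>\<^bsub>C\<^esub> f n),
      star = (\<lambda>f n. star C (f n)), nrm = (\<lambda>f. SUP n. nrm C (f n))\<rparr>"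

definition omega_null :: "nat filter \<Rightarrow> 'a cstar \<Rightarrow> (nat \<Rightarrow> 'a) set" where
  "omega_null \<omega> C = {f \<in> carrier (ell_infty C). ((\<lambda>n. nrm C (f n)) \<longlongrightarrow> 0) \<omega>}"

definition cstar_quotient :: "'a cstar \<Rightarrow> 'a set \<Rightarrow> 'a set cstar" where
  "cstar_quotient C I =
     \<lparr>carrier = carrier (C Quot I), mult = mult (C Quot I), one = one (C Quot I),
      zero = zero (C Quot I), add = add (C Quot I),
      smult = (\<lambda>c X. \<Union>x\<in>X. I +>\<^bsub>C\<^esub> (c \<odot>\<^bsub>C\<^esub> x)),
      star = (\<lambda>X. \<Union>x\<in>X. I +>\<^bsub>C\<^esub> star C x), nrm = (\<lambda>X. INF x\<in>X. nrm C x)\<rparr>"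

definition ultrapower :: "nat filter \<Rightarrow> 'a cstar \<Rightarrow> (nat \<Rightarrow> 'a) set cstar" where
  "ultrapower \<omega> C = cstar_quotient (ell_infty C) (omega_null \<omega> C)"

definition ultra_const :: "nat filter \<Rightarrow> 'a cstar \<Rightarrow> 'a \<Rightarrow> (nat \<Rightarrow> 'a) set" where
  "ultra_const \<omega> C a = omega_null \<omega> C +>\<^bsub>ell_infty C\<^esub> (\<lambda>n. a)"

text \<open>The map induced coordinatewise by a bounded linear map \<open>\<phi>\<close> into \<open>D\<close>: all representatives
  of the argument yield the same coset.\<close>

definition ultra_map ::
    "nat filter \<Rightarrow> 'b cstar \<Rightarrow> ('a \<Rightarrow> 'b) \<Rightarrow> (nat \<Rightarrow> 'a) set \<Rightarrow> (nat \<Rightarrow> 'b) set" where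
  "ultra_map \<omega> D \<phi> X = (\<Union>x\<in>X. omega_null \<omega> D +>\<^bsub>ell_infty D\<^esub> (\<lambda>n. \<phi> (x n)))"

section \<open>Conditional expectations of index-finite type\<close>

definition conditional_expectation :: "'a cstar \<Rightarrow> 'a set \<Rightarrow> ('a \<Rightarrow> 'a) \<Rightarrow> bool" where
  "conditional_expectation A P E \<longleftrightarrow>
     E \<in> carrier A \<rightarrow> P \<and>
     (\<forall>x\<in>carrier A. \<forall>y\<in>carrier A. E (x \<oplus>\<^bsub>A\<^esub> y) = E x \<oplus>\<^bsub>A\<^esub> E y) \<and>
     (\<forall>c. \<forall>x\<in>carrier A. E (c \<odot>\<^bsub>A\<^esub> x) = c \<odot>\<^bsub>A\<^esub> E x) \<and>
     (\<forall>x\<in>positives A. E x \<in> positives (A\<lparr>carrier := P\<rparr>)) \<and>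
     (\<forall>p\<in>P. E p = p) \<and>
     (\<forall>p\<in>P. \<forall>x\<in>carrier A. \<forall>q\<in>P. E (p \<otimes>\<^bsub>A\<^esub> x \<otimes>\<^bsub>A\<^esub> q) = p \<otimes>\<^bsub>A\<^esub> E x \<otimes>\<^bsub>A\<^esub> q)"

definition quasi_basis ::
    "'a cstar \<Rightarrow> ('a \<Rightarrow> 'a) \<Rightarrow> nat \<Rightarrow> (nat \<Rightarrow> 'a) \<Rightarrow> (nat \<Rightarrow> 'a) \<Rightarrow> bool" where
  "quasi_basis A E n u v \<longleftrightarrow>
     u \<in> {..<n} \<rightarrow> carrier A \<and> v \<in> {..<n} \<rightarrow> carrier A \<and>
     (\<forall>x\<in>carrier A.
        x = (\<Oplus>\<^bsub>A\<^esub>j\<in>{..<n}. u j \<otimes>\<^bsub>A\<^esub> E (v j \<otimes>\<^bsub>A\<^esub> x)) \<and>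
        x = (\<Oplus>\<^bsub>A\<^esub>j\<in>{..<n}. E (x \<otimes>\<^bsub>A\<^esub> u j) \<otimes>\<^bsub>A\<^esub> v j))"

definition index_finite :: "'a cstar \<Rightarrow> ('a \<Rightarrow> 'a) \<Rightarrow> bool" where
  "index_finite A E \<longleftrightarrow> (\<exists>n u v. quasi_basis A E n u v)"

text \<open>Independent of the choice of the family \<open>(u\<^sub>j, v\<^sub>j)\<close>.  This is an element of \<open>A\<close>; when it
  is a scalar \<open>c\<close>, multiplying by it amounts to multiplying by \<open>c\<close>.\<close>

definition index_elt :: "'a cstar \<Rightarrow> ('a \<Rightarrow> 'a) \<Rightarrow> 'a" where
  "index_elt A E =
     (THE z. \<exists>n u v. quasi_basis A E n u v \<and> z = (\<Oplus>\<^bsub>A\<^esub>j\<in>{..<n}. u j \<otimes>\<^bsub>A\<^esub> v j))"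

section \<open>The Hilbert module of a conditional expectation\<close>

definition edist :: "'a cstar \<Rightarrow> ('a \<Rightarrow> 'a) \<Rightarrow> 'a \<Rightarrow> 'a \<Rightarrow> real" where
  "edist A E x y =
     (if x \<in> carrier A \<and> y \<in> carrier A
      then sqrt (nrm A (E (star A (x \<ominus>\<^bsub>A\<^esub> y) \<otimes>\<^bsub>A\<^esub> (x \<ominus>\<^bsub>A\<^esub> y)))) else 0)"

definition ecauchy :: "'a cstar \<Rightarrow> ('a \<Rightarrow> 'a) \<Rightarrow> (nat \<Rightarrow> 'a) set" where
  "ecauchy A E = {x. Metric_space.MCauchy (carrier A) (edist A E) x}"

definition erel :: "'a cstar \<Rightarrow> ('a \<Rightarrow> 'a) \<Rightarrow> ((nat \<Rightarrow> 'a) \<times> (nat \<Rightarrow> 'a)) set" where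
  "erel A E = {(x, y). x \<in> ecauchy A E \<and> y \<in> ecauchy A E \<and>
                       (\<lambda>n. edist A E (x n) (y n)) \<longlonglongrightarrow> 0}"

text \<open>Inner products are conjugate linear in the first variable.  The fields \<open>mult\<close> and \<open>one\<close>
  inherited from \<open>ring\<close> carry no meaning.\<close>

record ('p, 'h) hilbert_module = "(complex, 'h) module" +
  ract :: "'h \<Rightarrow> 'p \<Rightarrow> 'h"
  inner_prod :: "'h \<Rightarrow> 'h \<Rightarrow> 'p"

text \<open>The completion of \<open>A\<close> for \<open>\<langle>x, y\<rangle> = E (x\<^sup>* y)\<close>: Cauchy sequences modulo null
  sequences.\<close>

definition expectation_module ::
    "'a cstar \<Rightarrow> 'a set \<Rightarrow> ('a \<Rightarrow> 'a) \<Rightarrow> ('a, (nat \<Rightarrow> 'a) set) hilbert_module" where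
  "expectation_module A P E =
     \<lparr>carrier = ecauchy A E // erel A E, mult = undefined, one = undefined,
      zero = erel A E `` {\<lambda>n. \<zero>\<^bsub>A\<^esub>},
      add = (\<lambda>X Y. \<Union>x\<in>X. \<Union>y\<in>Y. erel A E `` {\<lambda>n. x n \<oplus>\<^bsub>A\<^esub> y n}),
      smult = (\<lambda>c X. \<Union>x\<in>X. erel A E `` {\<lambda>n. c \<odot>\<^bsub>A\<^esub> x n}),
      ract = (\<lambda>X p. \<Union>x\<in>X. erel A E `` {\<lambda>n. x n \<otimes>\<^bsub>A\<^esub> p}),
      inner_prod = (\<lambda>X Y. THE l. l \<in> P \<and> (\<forall>x\<in>X. \<forall>y\<in>Y.
        limitin (norm_topology A) (\<lambda>n. E (star A (x n) \<otimes>\<^bsub>A\<^esub> y n)) l sequentially))\<rparr>"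

text \<open>The extension to the completion of a linear map on \<open>A\<close> that is bounded for the module
  norm.\<close>

definition module_extension ::
    "'a cstar \<Rightarrow> 'a set \<Rightarrow> ('a \<Rightarrow> 'a) \<Rightarrow> ('a \<Rightarrow> 'a) \<Rightarrow> (nat \<Rightarrow> 'a) set \<Rightarrow> (nat \<Rightarrow> 'a) set" where
  "module_extension A P E f =
     restrict (\<lambda>X. \<Union>x\<in>X. erel A E `` {\<lambda>n. f (x n)}) (carrier (expectation_module A P E))"

definition left_mult ::
    "'a cstar \<Rightarrow> 'a set \<Rightarrow> ('a \<Rightarrow> 'a) \<Rightarrow> 'a \<Rightarrow> (nat \<Rightarrow> 'a) set \<Rightarrow> (nat \<Rightarrow> 'a) set" where
  "left_mult A P E a = module_extension A P E (\<lambda>x. a \<otimes>\<^bsub>A\<^esub> x)"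

definition jones_projection ::
    "'a cstar \<Rightarrow> 'a set \<Rightarrow> ('a \<Rightarrow> 'a) \<Rightarrow> (nat \<Rightarrow> 'a) set \<Rightarrow> (nat \<Rightarrow> 'a) set" where
  "jones_projection A P E = module_extension A P E E"

section \<open>Adjointable operators and the basic construction\<close>

definition is_adjoint :: "('p, 'h) hilbert_module \<Rightarrow> ('h \<Rightarrow> 'h) \<Rightarrow> ('h \<Rightarrow> 'h) \<Rightarrow> bool" where
  "is_adjoint H T S \<longleftrightarrow>
     T \<in> carrier H \<rightarrow>\<^sub>E carrier H \<and> S \<in> carrier H \<rightarrow>\<^sub>E carrier H \<and>
     (\<forall>x\<in>carrier H. \<forall>y\<in>carrier H. inner_prod H (T x) y = inner_prod H x (S y))"

definition module_norm :: "'p cstar \<Rightarrow> ('p, 'h) hilbert_module \<Rightarrow> 'h \<Rightarrow> real" where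
  "module_norm B H x = sqrt (nrm B (inner_prod H x x))"

text \<open>Adjointable operators on a Hilbert \<open>B\<close>-module; linearity and boundedness follow from the
  existence of an adjoint.\<close>

definition adjointable_operators ::
    "'p cstar \<Rightarrow> ('p, 'h) hilbert_module \<Rightarrow> ('h \<Rightarrow> 'h) cstar" where
  "adjointable_operators B H =
     \<lparr>carrier = {T. \<exists>S. is_adjoint H T S},
      mult = compose (carrier H), one = (\<lambda>x\<in>carrier H. x), zero = (\<lambda>x\<in>carrier H. \<zero>\<^bsub>H\<^esub>),
      add = (\<lambda>T S. \<lambda>x\<in>carrier H. T x \<oplus>\<^bsub>H\<^esub> S x),
      smult = (\<lambda>c T. \<lambda>x\<in>carrier H. c \<odot>\<^bsub>H\<^esub> T x),
      star = (\<lambda>T. THE S. is_adjoint H T S),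
      nrm = (\<lambda>T. SUP x\<in>{x \<in> carrier H. module_norm B H x \<le> 1}. module_norm B H (T x))\<rparr>"

text \<open>The linear span of the operators \<open>x e\<^sub>P y\<close> consists of their finite sums, scalars being
  absorbed by \<open>x\<close>.\<close>

definition basic_construction ::
    "'a cstar \<Rightarrow> 'a set \<Rightarrow> ('a \<Rightarrow> 'a) \<Rightarrow> ((nat \<Rightarrow> 'a) set \<Rightarrow> (nat \<Rightarrow> 'a) set) cstar" where
  "basic_construction A P E =
     (let L = adjointable_operators (A\<lparr>carrier := P\<rparr>) (expectation_module A P E)
      in L\<lparr>carrier :=
           {\<Oplus>\<^bsub>L\<^esub>j\<in>{..<n}. left_mult A P E (x j) \<otimes>\<^bsub>L\<^esub> jones_projection A P E \<otimes>\<^bsub>L\<^esub> left_mult A P E (y j)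
            | (n :: nat) x y. x \<in> {..<n} \<rightarrow> carrier A \<and> y \<in> {..<n} \<rightarrow> carrier A}\<rparr>)"

section \<open>The weak tracial Rokhlin property\<close>

text \<open>\<open>A\<close> sits in its ultrapower \<open>A\<^sub>\<omega>\<close> as constant sequences, and \<open>A\<^sub>\<omega>\<close> acts in the
  ultrapower of the basic construction through \<open>ultra_map\<close> applied to the left action.\<close>

definition weak_tracial_Rokhlin ::
    "nat filter \<Rightarrow> 'a cstar \<Rightarrow> 'a set \<Rightarrow> ('a \<Rightarrow> 'a) \<Rightarrow> bool" where
  "weak_tracial_Rokhlin \<omega> A P E \<longleftrightarrow>
     (let Aw = ultrapower \<omega> A;
          B = basic_construction A P E;
          Bw = ultrapower \<omega> B;
          lam = ultra_map \<omega> B (left_mult A P E)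
      in \<forall>a\<in>positives Aw. a \<noteq> \<zero>\<^bsub>Aw\<^esub> \<longrightarrow>
           (\<exists>e\<in>positives Aw. e \<noteq> \<zero>\<^bsub>Aw\<^esub> \<and> nrm Aw e \<le> 1 \<and>
              (\<forall>x\<in>carrier A. e \<otimes>\<^bsub>Aw\<^esub> ultra_const \<omega> A x = ultra_const \<omega> A x \<otimes>\<^bsub>Aw\<^esub> e) \<and>
              lam (ultra_const \<omega> A (index_elt A E)) \<otimes>\<^bsub>Bw\<^esub>
                (lam (pos_sqrt Aw e) \<otimes>\<^bsub>Bw\<^esub> ultra_const \<omega> B (jones_projection A P E)
                   \<otimes>\<^bsub>Bw\<^esub> lam (pos_sqrt Aw e)) = lam e \<and>
              cuntz_below Aw
                (\<one>\<^bsub>Aw\<^esub> \<ominus>\<^bsub>Aw\<^esub> ultra_const \<omega> A (index_elt A E) \<otimes>\<^bsub>Aw\<^esub> ultra_map \<omega> A E e) a))"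

end

theory Submission
  imports Defs "HOL-Complex_Analysis.Cauchy_Integral_Formula"
begin

text \<open>
  Write \<open>z = Index E\<close>. Along \<open>\<omega>\<close> the element \<open>e\<close> of the Rokhlin property and
  \<open>f = e\<^sup>1\<^sup>/\<^sup>2\<close> satisfy \<open>z f E(f x) = e x\<close> for all bounded sequences \<open>x\<close> in \<open>A\<close>, whence
  \<open>z e E(e b) = e\<^sup>2 b\<close> for \<open>b \<in> A\<close>.

  Let \<open>I\<close> be a nonzero ideal of \<open>P\<close>. For \<open>p \<in> I\<close> one gets
  \<open>E(e\<^sup>2 a p b) = E(e a z) p E(e b) \<in> I\<close> asymptotically; the \<open>x\<close> with \<open>E(e\<^sup>2 a x b)\<close> asymptotically
  in \<open>I\<close> for all \<open>a, b \<in> A\<close> form a closed ideal of the simple algebra \<open>A\<close>, so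
  \<open>E(e\<^sup>2 z)\<close> is asymptotically in \<open>I\<close>. Then \<open>e\<^sup>3 y = z f E(e\<^sup>2 z) E(f y)\<close> lies asymptotically in the left
  ideal \<open>A I\<close>, uniformly for \<open>y\<close> in the unit ball: \<open>e\<^sup>3\<close> acts on \<open>A / A I\<close> with norm tending to
  \<open>0\<close>. If \<open>I \<noteq> P\<close>, this action of the simple algebra \<open>A\<close> is injective, and an injective
  contractive representation by bounded operators on a normed space is isometric on selfadjoint
  elements; hence \<open>e = 0\<close>, a contradiction.
\<close>

section \<open>Norm, involution and asymptotic equality\<close>

text \<open>The sequence \<open>e\<close> commutes asymptotically with constants only, and the
  elements of \<open>I\<close> close to E(e^2 z) vary with n. So no single limit is placed in an
  ideal; what can be controlled is, for each n, a distance to \<open>I\<close> and the norm of left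
  multiplication on a quotient of \<open>A\<close> by a left ideal. That quotient is a mere normed
  space, not a C*-algebra, so smallness there says nothing about norms in \<open>A\<close> by
  itself; this is why norms on a simple C*-algebra have to be compared. The C*-theory is built
  without spectra or characters. Norms of polynomials in a selfadjoint element are bounded through
  Cauchy's inequality on the circle, and a statement on the spectrum becomes a statement on the
  interval on which a continuous function is evaluated. The Rokhlin relation is an identity of
  operators on a completed module. Finite index makes the module norm equivalent to the C*-norm, so
  the completion has no new points and the relation can be evaluated on elements of
  \<open>A\<close>, with an error proportional to the norm of the argument.\<close>

context cstar_algebra
begin

lemma smult_closed' [simp, intro]: "x \<in> carrier C \<Longrightarrow> c \<odot> x \<in> carrier C"
  using scalars.smult_closed by (simp add: complex_ring_def)

lemma smult_add_left: "x \<in> carrier C \<Longrightarrow> (c + d) \<odot> x = c \<odot> x \<oplus> d \<odot> x"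
  using scalars.smult_l_distr[of c d x] by (simp add: complex_ring_def)

lemma smult_add_right: "x \<in> carrier C \<Longrightarrow> y \<in> carrier C \<Longrightarrow> c \<odot> (x \<oplus> y) = c \<odot> x \<oplus> c \<odot> y"
  using scalars.smult_r_distr[of c x y] by (simp add: complex_ring_def)

lemma smult_smult [simp]: "x \<in> carrier C \<Longrightarrow> c \<odot> (d \<odot> x) = (c * d) \<odot> x"
  using scalars.smult_assoc1[of c d x] by (simp add: complex_ring_def)

lemma smult_one' [simp]: "x \<in> carrier C \<Longrightarrow> 1 \<odot> x = x"
  using scalars.smult_one[of x] by (simp add: complex_ring_def)

lemma smult_zero_left [simp]: "x \<in> carrier C \<Longrightarrow> 0 \<odot> x = \<zero>"
  using nrm_smult[of x 0] nrm_eq_0_iff by simp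

lemma smult_zero_right [simp]: "c \<odot> \<zero> = \<zero>"
  using smult_smult[of "\<zero>" c 0] by simp

lemma minus_smult: "x \<in> carrier C \<Longrightarrow> \<ominus> x = (-1) \<odot> x"
proof -
  assume x: "x \<in> carrier C"
  have "(-1) \<odot> x \<oplus> x = (-1 + 1) \<odot> x"
    using x by (simp only: smult_add_left smult_one')
  then have "(-1) \<odot> x \<oplus> x = \<zero>"
    using x by simp
  then show ?thesis
    using minus_equality x by auto
qed

lemma diff_smult: "x \<in> carrier C \<Longrightarrow> y \<in> carrier C \<Longrightarrow> x \<ominus> y = x \<oplus> (-1) \<odot> y"
  by (simp add: a_minus_def minus_smult)

lemmas star_closed' [simp, intro] = star_closed
lemmas star_star' [simp] = star_star
lemmas to_smult = diff_smult minus_smult smult_add_right smult_mult_left smult_mult_right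

lemma star_zero [simp]: "star C \<zero> = \<zero>"
  using star_smult[of "\<zero>" 0] by simp

lemma star_one [simp]: "star C \<one> = \<one>"
proof -
  have "\<one> = star C (star C \<one>)"
    by simp
  also have "\<dots> = star C (star C \<one> \<otimes> \<one>)"
    by simp
  also have "\<dots> = star C \<one> \<otimes> star C (star C \<one>)"
    by (rule star_mult) auto
  also have "\<dots> = star C \<one>"
    by simp
  finally show ?thesis by simp
qed

lemma star_diff: "x \<in> carrier C \<Longrightarrow> y \<in> carrier C \<Longrightarrow> star C (x \<ominus> y) = star C x \<ominus> star C y"
  by (simp add: to_smult star_add star_smult)

lemma nrm_zero [simp]: "nrm C \<zero> = 0"
  by (simp add: nrm_eq_0_iff)

lemma nrm_minus [simp]: "x \<in> carrier C \<Longrightarrow> nrm C (\<ominus> x) = nrm C x"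
  by (simp add: minus_smult nrm_smult)

text \<open>The C*-identity and submultiplicativity give one inequality after cancelling
  \<open>nrm C y\<close>; applied to \<open>x\<close> and to \<open>star C x\<close> it gives
  both.\<close>

lemma nrm_star [simp]: assumes x: "x \<in> carrier C" shows "nrm C (star C x) = nrm C x"
proof -
  have *: "nrm C y \<le> nrm C (star C y)" if y: "y \<in> carrier C" for y
  proof (cases "nrm C y = 0")
    case False
    have "(nrm C y)\<^sup>2 \<le> nrm C (star C y) * nrm C y"
      using nrm_mult[of "star C y" y] y by (simp add: cstar_identity)
    with False show ?thesis
      using nrm_nonneg[OF y] by (simp add: power2_eq_square)
  qed (use y nrm_nonneg in auto)
  show ?thesis
    using *[of x] *[of "star C x"] x by auto
qed

lemma nrm_diff_triangle: "\<lbrakk>x \<in> carrier C; y \<in> carrier C\<rbrakk> \<Longrightarrow> nrm C (x \<ominus> y) \<le> nrm C x + nrm C y"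
  using nrm_triangle[of x "\<ominus> y"] by (simp add: a_minus_def)

lemma nrm_diff_commute: "\<lbrakk>x \<in> carrier C; y \<in> carrier C\<rbrakk> \<Longrightarrow> nrm C (x \<ominus> y) = nrm C (y \<ominus> x)"
  using nrm_minus[of "x \<ominus> y"] by (simp add: minus_add a_minus_def a_comm)

lemma diff_add_diff:
  "\<lbrakk>x \<in> carrier C; y \<in> carrier C; w \<in> carrier C\<rbrakk> \<Longrightarrow> (x \<ominus> y) \<oplus> (y \<ominus> w) = x \<ominus> w"
  by (metis a_assoc a_closed a_inv_closed l_neg l_zero a_minus_def)

lemma nrm_diff_trans:
  assumes "x \<in> carrier C" "y \<in> carrier C" "w \<in> carrier C"
  shows "nrm C (x \<ominus> w) \<le> nrm C (x \<ominus> y) + nrm C (y \<ominus> w)"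
  using nrm_triangle[of "x \<ominus> y" "y \<ominus> w"] assms by (simp add: diff_add_diff)

lemma nrm_le_diff:
  assumes "x \<in> carrier C" "y \<in> carrier C"
  shows "nrm C x \<le> nrm C (x \<ominus> y) + nrm C y"
proof -
  have "x \<ominus> \<zero> = x" "y \<ominus> \<zero> = y" using assms by (auto simp: a_minus_def)
  then show ?thesis using nrm_diff_trans[of x y "\<zero>"] assms by simp
qed

text \<open>By the C*-identity \<open>nrm C \<one>\<close> equals its own square. The value 0 occurs
  in the zero algebra, hence an inequality.\<close>

lemma nrm_one_le: "nrm C \<one> \<le> 1"
proof -
  have "(nrm C \<one>)\<^sup>2 = nrm C \<one>"
    using cstar_identity[of "\<one>"] by simp
  then show ?thesis
    by (metis power2_eq_square mult_cancel_right1 le_numeral_extra(4) zero_le_one mult_cancel_left2)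
qed

lemma nrm_diff_eq_0 [simp]: "\<lbrakk>x \<in> carrier C; y \<in> carrier C\<rbrakk> \<Longrightarrow> nrm C (x \<ominus> y) = 0 \<longleftrightarrow> x = y"
  using nrm_eq_0_iff by (metis minus_closed r_right_minus_eq)

section \<open>Convergence and closed sets in the norm topology\<close>

lemma Metric_space_cdist: "Metric_space (carrier C) (cdist C)"
proof
  show "0 \<le> cdist C x y" for x y
    by (simp add: cdist_def nrm_nonneg)
  show "cdist C x y = cdist C y x" for x y
    by (auto simp: cdist_def nrm_diff_commute)
  show "cdist C x y = 0 \<longleftrightarrow> x = y" if "x \<in> carrier C" "y \<in> carrier C" for x y
    using that by (simp add: cdist_def)
  show "cdist C x z \<le> cdist C x y + cdist C y z"
    if "x \<in> carrier C" "y \<in> carrier C" "z \<in> carrier C" for x y z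
    using that by (simp add: cdist_def nrm_diff_trans)
qed

lemma limitin_iff:
  "limitin (norm_topology C) f l F \<longleftrightarrow>
    l \<in> carrier C \<and> eventually (\<lambda>n. f n \<in> carrier C) F \<and> ((\<lambda>n. nrm C (f n \<ominus> l)) \<longlongrightarrow> 0) F"
proof -
  interpret Metric_space "carrier C" "cdist C" by (rule Metric_space_cdist)
  have "((\<lambda>n. nrm C (f n \<ominus> l)) \<longlongrightarrow> 0) F \<longleftrightarrow> ((\<lambda>n. cdist C (f n) l) \<longlongrightarrow> 0) F"
    if "l \<in> carrier C" "eventually (\<lambda>n. f n \<in> carrier C) F"
  proof (rule tendsto_cong)
    show "\<forall>\<^sub>F n in F. nrm C (f n \<ominus> l) = cdist C (f n) l"
      using that(2) by eventually_elim (use that in \<open>auto simp: cdist_def\<close>)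
  qed
  then show ?thesis
    unfolding norm_topology_def limitin_metric_dist_null by blast
qed

lemma Cauchy_converges:
  assumes x: "\<And>n. x n \<in> carrier C"
    and c: "\<And>e. e > 0 \<Longrightarrow> \<exists>N. \<forall>m\<ge>N. \<forall>n\<ge>N. nrm C (x m \<ominus> x n) < e"
  obtains l where "l \<in> carrier C" "(\<lambda>n. nrm C (x n \<ominus> l)) \<longlonglongrightarrow> 0"
proof -
  interpret Metric_space "carrier C" "cdist C" by (rule Metric_space_cdist)
  have "MCauchy x"
    unfolding MCauchy_def using x c by (auto simp: cdist_def)
  then obtain l where "limitin (norm_topology C) x l sequentially"
    using complete by (auto simp: mcomplete_def norm_topology_def)
  then show ?thesis
    using that by (auto simp: limitin_iff)
qed

lemma closedin_norm_topology_iff: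
  "closedin (norm_topology C) S \<longleftrightarrow> S \<subseteq> carrier C \<and>
    (\<forall>x l. (\<forall>n. x n \<in> S) \<and> l \<in> carrier C \<and> (\<lambda>n. nrm C (x n \<ominus> l)) \<longlonglongrightarrow> 0 \<longrightarrow> l \<in> S)"
proof -
  interpret Metric_space "carrier C" "cdist C" by (rule Metric_space_cdist)
  have "limitin (norm_topology C) f l sequentially \<longleftrightarrow>
     l \<in> carrier C \<and> (\<lambda>n. nrm C (f n \<ominus> l)) \<longlonglongrightarrow> 0" if "range f \<subseteq> S" "S \<subseteq> carrier C" for f l
    using that by (auto simp: limitin_iff intro!: always_eventually)
  then show ?thesis
    unfolding norm_topology_def[symmetric] metric_closedin_iff_sequentially_closed[folded norm_topology_def]
    by (metis (no_types, lifting) image_subset_iff UNIV_I)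
qed

text \<open>Boundedness is part of the relation, so that it is a congruence for multiplication.\<close>

definition bseq :: "(nat \<Rightarrow> 'a) \<Rightarrow> bool" where
  "bseq x \<longleftrightarrow> (\<forall>n. x n \<in> carrier C) \<and> (\<exists>K. \<forall>n. nrm C (x n) \<le> K)"

definition approx :: "nat filter \<Rightarrow> (nat \<Rightarrow> 'a) \<Rightarrow> (nat \<Rightarrow> 'a) \<Rightarrow> bool" where
  "approx F x y \<longleftrightarrow> bseq x \<and> bseq y \<and> ((\<lambda>n. nrm C (x n \<ominus> y n)) \<longlongrightarrow> 0) F"

lemma bseq_carrier [simp]: "bseq x \<Longrightarrow> x n \<in> carrier C"
  by (simp add: bseq_def)

lemma bseqI: "(\<And>n. x n \<in> carrier C) \<Longrightarrow> (\<And>n. nrm C (x n) \<le> K) \<Longrightarrow> bseq x"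
  by (auto simp: bseq_def)

lemma bseqE: assumes "bseq x" obtains K where "K > 0" "\<And>n. nrm C (x n) \<le> K"
  using assms unfolding bseq_def by (metis gt_ex less_le_trans linorder_le_cases order.trans less_eq_real_def)

lemma bseq_const [simp, intro]: "x \<in> carrier C \<Longrightarrow> bseq (\<lambda>n. x)"
  by (rule bseqI[of _ "nrm C x"]) auto

lemma bseq_add [intro]: assumes "bseq x" "bseq y" shows "bseq (\<lambda>n. x n \<oplus> y n)"
proof -
  obtain K where K: "\<And>n. nrm C (x n) \<le> K" using assms(1) by (rule bseqE) blast
  obtain L where L: "\<And>n. nrm C (y n) \<le> L" using assms(2) by (rule bseqE) blast
  show ?thesis
    using assms by (intro bseqI[of _ "K + L"]) (auto intro!: order.trans[OF nrm_triangle] add_mono K L)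
qed

lemma bseq_smult [intro]: assumes "bseq x" shows "bseq (\<lambda>n. c \<odot> x n)"
proof -
  obtain K where K: "\<And>n. nrm C (x n) \<le> K" using assms(1) by (rule bseqE) blast
  show ?thesis
    using K assms by (intro bseqI[of _ "cmod c * K"]) (auto simp: nrm_smult intro: mult_left_mono)
qed

lemma bseq_diff [intro]: assumes "bseq x" "bseq y" shows "bseq (\<lambda>n. x n \<ominus> y n)"
  using bseq_add[OF assms(1) bseq_smult[OF assms(2), of "-1"]] assms by (simp add: to_smult)

lemma bseq_mult [intro]: assumes "bseq x" "bseq y" shows "bseq (\<lambda>n. x n \<otimes> y n)"
proof -
  obtain K where K: "K > 0" "\<And>n. nrm C (x n) \<le> K" using assms(1) by (rule bseqE) blast
  obtain L where L: "\<And>n. nrm C (y n) \<le> L" using assms(2) by (rule bseqE) blast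
  have "nrm C (x n \<otimes> y n) \<le> K * L" for n
    using nrm_mult[of "x n" "y n"] mult_mono[OF K(2)[of n] L[of n]] K(1) assms nrm_nonneg[of "y n"]
    by (meson bseq_carrier less_imp_le order.trans)
  then show ?thesis
    using assms by (intro bseqI[of _ "K * L"]) auto
qed

lemma bseq_star [intro]: "bseq x \<Longrightarrow> bseq (\<lambda>n. star C (x n))"
  by (auto simp: bseq_def)

lemma approxD: "approx F x y \<Longrightarrow> bseq x" "approx F x y \<Longrightarrow> bseq y"
  "approx F x y \<Longrightarrow> ((\<lambda>n. nrm C (x n \<ominus> y n)) \<longlongrightarrow> 0) F"
  by (auto simp: approx_def)

lemma approxI_bound:
  assumes "bseq x" "bseq y" "(g \<longlongrightarrow> 0) F" "eventually (\<lambda>n. nrm C (x n \<ominus> y n) \<le> g n) F"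
  shows "approx F x y"
  unfolding approx_def
  using assms by (auto intro!: tendsto_sandwich[OF _ assms(4) tendsto_const assms(3)] simp: nrm_nonneg)

lemma approx_refl [intro]: "bseq x \<Longrightarrow> approx F x x"
proof -
  assume x: "bseq x"
  then have "(\<lambda>n. nrm C (x n \<ominus> x n)) = (\<lambda>n. 0)" by auto
  with x show ?thesis by (simp add: approx_def)
qed

lemma approx_sym: "approx F x y \<Longrightarrow> approx F y x"
  by (auto simp: approx_def nrm_diff_commute)

lemma approx_trans [trans]: assumes "approx F x y" "approx F y w" shows "approx F x w"
  using assms
  by (intro approxI_bound[OF _ _ tendsto_add_zero[OF assms[THEN approxD(3)]]])
     (auto simp: approx_def intro!: always_eventually nrm_diff_trans)

lemma approx_add: assumes "approx F x x'" "approx F y y'"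
  shows "approx F (\<lambda>n. x n \<oplus> y n) (\<lambda>n. x' n \<oplus> y' n)"
proof (rule approxI_bound[OF _ _ tendsto_add_zero[OF assms[THEN approxD(3)]]])
  show "\<forall>\<^sub>F n in F. nrm C (x n \<oplus> y n \<ominus> (x' n \<oplus> y' n)) \<le> nrm C (x n \<ominus> x' n) + nrm C (y n \<ominus> y' n)"
  proof (rule always_eventually, rule allI)
    fix n
    have c: "x n \<in> carrier C" "x' n \<in> carrier C" "y n \<in> carrier C" "y' n \<in> carrier C"
      using assms by (auto simp: approx_def)
    then have "x n \<oplus> y n \<ominus> (x' n \<oplus> y' n) = (x n \<ominus> x' n) \<oplus> (y n \<ominus> y' n)"
      by (simp add: to_smult a_ac)
    then show "nrm C (x n \<oplus> y n \<ominus> (x' n \<oplus> y' n)) \<le> nrm C (x n \<ominus> x' n) + nrm C (y n \<ominus> y' n)"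
      using nrm_triangle c by simp
  qed
qed (use assms in \<open>auto simp: approx_def\<close>)

lemma approx_smult: assumes "approx F x x'"
  shows "approx F (\<lambda>n. c \<odot> x n) (\<lambda>n. c \<odot> x' n)"
proof (rule approxI_bound[OF _ _ tendsto_mult_right_zero[OF assms[THEN approxD(3)]]])
  show "\<forall>\<^sub>F n in F. nrm C (c \<odot> x n \<ominus> c \<odot> x' n) \<le> cmod c * nrm C (x n \<ominus> x' n)"
  proof (rule always_eventually, rule allI)
    fix n
    have c: "x n \<in> carrier C" "x' n \<in> carrier C"
      using assms by (auto simp: approx_def)
    then have "c \<odot> x n \<ominus> c \<odot> x' n = c \<odot> (x n \<ominus> x' n)"
      by (simp add: to_smult)
    then show "nrm C (c \<odot> x n \<ominus> c \<odot> x' n) \<le> cmod c * nrm C (x n \<ominus> x' n)"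
      using nrm_smult c by simp
  qed
qed (use assms in \<open>auto simp: approx_def\<close>)

lemma approx_diff: assumes "approx F x x'" "approx F y y'"
  shows "approx F (\<lambda>n. x n \<ominus> y n) (\<lambda>n. x' n \<ominus> y' n)"
  using approx_add[OF assms(1) approx_smult[OF assms(2), of "-1"]] assms by (simp add: to_smult approx_def)

lemma approx_star: assumes "approx F x x'"
  shows "approx F (\<lambda>n. star C (x n)) (\<lambda>n. star C (x' n))"
  using assms by (auto simp: approx_def star_diff[symmetric])

lemma diff_mult_diff:
  assumes "x \<in> carrier C" "x' \<in> carrier C" "y \<in> carrier C" "y' \<in> carrier C"
  shows "x \<otimes> y \<ominus> x' \<otimes> y' = (x \<ominus> x') \<otimes> y \<oplus> x' \<otimes> (y \<ominus> y')"
proof -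
  have "(x \<ominus> x') \<otimes> y = x \<otimes> y \<ominus> x' \<otimes> y" "x' \<otimes> (y \<ominus> y') = x' \<otimes> y \<ominus> x' \<otimes> y'"
    using assms by (auto simp: to_smult l_distr r_distr)
  then show ?thesis using assms by (simp add: diff_add_diff)
qed

lemma nrm_mult_le: "\<lbrakk>x \<in> carrier C; y \<in> carrier C; nrm C x \<le> a; nrm C y \<le> b\<rbrakk> \<Longrightarrow> nrm C (x \<otimes> y) \<le> a * b"
  by (meson mult_mono nrm_mult nrm_nonneg order.trans)

lemma approx_mult: assumes x: "approx F x x'" and y: "approx F y y'"
  shows "approx F (\<lambda>n. x n \<otimes> y n) (\<lambda>n. x' n \<otimes> y' n)"
proof -
  obtain K where K: "K > 0" "\<And>n. nrm C (y n) \<le> K" using approxD(1)[OF y] by (rule bseqE) blast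
  obtain L where L: "L > 0" "\<And>n. nrm C (x' n) \<le> L" using approxD(2)[OF x] by (rule bseqE) blast
  have *: "nrm C (x n \<otimes> y n \<ominus> x' n \<otimes> y' n) \<le> nrm C (x n \<ominus> x' n) * K + L * nrm C (y n \<ominus> y' n)" for n
  proof -
    have c: "x n \<in> carrier C" "x' n \<in> carrier C" "y n \<in> carrier C" "y' n \<in> carrier C"
      using assms by (auto simp: approx_def)
    have "nrm C ((x n \<ominus> x' n) \<otimes> y n) \<le> nrm C (x n \<ominus> x' n) * K"
      using c K by (intro nrm_mult_le) auto
    moreover have "nrm C (x' n \<otimes> (y n \<ominus> y' n)) \<le> L * nrm C (y n \<ominus> y' n)"
      using c L by (intro nrm_mult_le) auto
    ultimately show ?thesis
      using nrm_triangle[of "(x n \<ominus> x' n) \<otimes> y n" "x' n \<otimes> (y n \<ominus> y' n)"] c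
      by (simp add: diff_mult_diff)
  qed
  show ?thesis
  proof (rule approxI_bound)
    show "((\<lambda>n. nrm C (x n \<ominus> x' n) * K + L * nrm C (y n \<ominus> y' n)) \<longlongrightarrow> 0) F"
      using x y by (auto simp: approx_def intro!: tendsto_add_zero tendsto_mult_left_zero tendsto_mult_right_zero)
  qed (use * x y in \<open>auto simp: approx_def\<close>)
qed

lemma approx_const_eq:
  assumes "approx F (\<lambda>_. x) (\<lambda>_. y)" "F \<noteq> bot" shows "x = y"
proof -
  have c: "x \<in> carrier C" "y \<in> carrier C" using assms by (auto simp: approx_def bseq_def)
  have "nrm C (x \<ominus> y) = 0"
    using approxD(3)[OF assms(1)] assms(2) by (simp add: tendsto_const_iff)
  with c show ?thesis by simp
qed

lemma approx_nrm_le: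
  assumes "approx F x y" "F \<noteq> bot" "eventually (\<lambda>n. nrm C (x n) \<le> B) F" "y = (\<lambda>_. l)"
  shows "nrm C l \<le> B"
proof -
  have c: "x n \<in> carrier C" "l \<in> carrier C" for n using assms by (auto simp: approx_def bseq_def)
  have "((\<lambda>n. nrm C (x n \<ominus> l) + B) \<longlongrightarrow> 0 + B) F"
    using assms by (intro tendsto_intros) (auto simp: approx_def)
  moreover have "\<forall>\<^sub>F n in F. nrm C l \<le> nrm C (x n \<ominus> l) + B"
    using assms(3) by eventually_elim (metis nrm_le_diff nrm_diff_commute c add_left_mono order.trans)
  ultimately show ?thesis
    using tendsto_lowerbound[of _ "0+B" F "nrm C l"] assms(2) by simp
qed

end

section \<open>Polynomials in a selfadjoint element\<close>

text \<open>Cauchy's inequality on the unit circle bounds the n-th derivative at 0, which is n!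
  times the coefficient.\<close>

lemma norm_coeff_le_circle:
  fixes q :: "complex poly"
  assumes "\<And>z. cmod z = 1 \<Longrightarrow> cmod (poly q z) \<le> B"
  shows "cmod (poly.coeff q n) \<le> B"
proof -
  have d: "(deriv ^^ n) (poly q) = poly ((pderiv ^^ n) q)"
  proof (induction n)
    case (Suc n)
    have "deriv (poly p) = poly (pderiv p)" for p :: "complex poly"
      by (rule ext) (simp add: DERIV_imp_deriv)
    then show ?case by (simp add: Suc)
  qed simp
  have "cmod ((deriv ^^ n) (poly q) 0) \<le> fact n * B / 1 ^ n"
    by (rule Cauchy_inequality) (use assms in \<open>auto intro!: holomorphic_intros continuous_intros\<close>)
  also have "(deriv ^^ n) (poly q) 0 = fact n * poly.coeff q n"
    unfolding d by (simp add: poly_0_coeff_0 coeff_higher_pderiv pochhammer_fact[symmetric])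
  finally show ?thesis
    by (simp add: norm_mult)
qed

text \<open>If \<open>M < x\<close>, the powers of \<open>x / M\<close> outgrow every linear
  function. Only exponents 2^k are assumed, because the norm of a selfadjoint element is
  multiplicative on exactly such powers in \<open>nrm_power_two_power\<close>.\<close>

lemma le_of_power_le_linear:
  fixes x M :: real
  assumes "\<And>k. x ^ (2 ^ k) \<le> (2 ^ k * D + 1) * M ^ (2 ^ k)" and "0 \<le> M"
  shows "x \<le> M"
proof (rule ccontr)
  assume "\<not> x \<le> M"
  then have xM: "M < x" by simp
  \<comment> \<open>For \<open>M = 0\<close> the assumption at exponent 2^0 would give
    \<open>x \<le> 0\<close>.\<close>
  have M: "M > 0"
    using assms(1)[of 0] assms(2) xM by (cases "M = 0") auto
  define r where "r = x / M"
  have r: "r > 1" using xM M by (simp add: r_def)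
  have "(\<lambda>n. D * (of_nat n / r ^ n) + 1 / r ^ n) \<longlonglongrightarrow> D * 0 + 0"
    using r by (intro tendsto_intros lim_n_over_pown) (auto simp: LIMSEQ_divide_realpow_zero)
  then have "\<forall>\<^sub>F n in sequentially. D * (of_nat n / r ^ n) + 1 / r ^ n < 1"
    by (rule order_tendstoD) simp
  then obtain N where N: "\<And>n. n \<ge> N \<Longrightarrow> D * (of_nat n / r ^ n) + 1 / r ^ n < 1"
    by (auto simp: eventually_sequentially)
  have "D * (of_nat (2 ^ N) / r ^ (2 ^ N)) + 1 / r ^ (2 ^ N) < 1"
    by (rule N) (simp add: less_imp_le less_exp)
  then have "(2 ^ N * D + 1) / r ^ (2 ^ N) < 1"
    by (simp add: add_divide_distrib algebra_simps)
  then have "2 ^ N * D + 1 < r ^ (2 ^ N)"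
    using r by (simp add: divide_simps)
  then have "(2 ^ N * D + 1) * M ^ (2 ^ N) < r ^ (2 ^ N) * M ^ (2 ^ N)"
    using M by simp
  also have "\<dots> = x ^ (2 ^ N)"
    using M by (simp add: r_def power_divide)
  finally show False
    using assms(1)[of N] by simp
qed

text \<open>Banach's fixed point theorem on an explicit carrier. It produces the square root of
  \<open>\<one> \<ominus> b \<otimes> b\<close> and right inverses of elements near
  \<open>\<one>\<close>.\<close>

lemma (in Metric_space) contraction_fixed_point:
  assumes "mcomplete" "M \<noteq> {}" "f \<in> M \<rightarrow> M" "0 \<le> r" "r < 1"
    and contr: "\<And>x y. x \<in> M \<Longrightarrow> y \<in> M \<Longrightarrow> d (f x) (f y) \<le> r * d x y"
  shows "\<exists>x\<in>M. f x = x"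
proof -
  obtain x0 where x0: "x0 \<in> M" using assms by blast
  define x where "x n = (f ^^ n) x0" for n
  have xM: "x n \<in> M" for n using x0 assms(3) by (induction n) (auto simp: x_def)
  define D where "D = d x0 (f x0)"
  have step: "d (x n) (x (Suc n)) \<le> r ^ n * D" for n
  proof (induction n)
    case (Suc n)
    have "d (x (Suc n)) (x (Suc (Suc n))) \<le> r * d (x n) (x (Suc n))"
      using contr[OF xM[of n] xM[of "Suc n"]] by (simp add: x_def)
    also have "\<dots> \<le> r * (r ^ n * D)" using Suc assms(4) by (rule mult_left_mono)
    finally show ?case by simp
  qed (simp add: x_def D_def)
  \<comment> \<open>The partial geometric sum, multiplied by \<open>1 - r\<close> so that the
    induction needs no division.\<close>
  have far: "d (x n) (x (n + k)) * (1 - r) \<le> r ^ n * D * (1 - r ^ k)" for n k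
  proof (induction k)
    case (Suc k)
    have "d (x n) (x (n + Suc k)) \<le> d (x n) (x (n + k)) + r ^ (n + k) * D"
      using triangle[OF xM[of n] xM[of "n+k"] xM[of "Suc (n+k)"]] step[of "n+k"] by simp
    then have "d (x n) (x (n + Suc k)) * (1 - r) \<le> (d (x n) (x (n + k)) + r ^ (n + k) * D) * (1 - r)"
      using assms(5) by (intro mult_right_mono) auto
    then show ?case
      using Suc by (simp add: algebra_simps power_add)
  qed (simp add: xM)
  have D0: "D \<ge> 0" by (simp add: D_def)
  have far': "d (x n) (x (n + k)) \<le> r ^ n * (D / (1 - r))" for n k
  proof -
    have "r ^ n * D * (1 - r ^ k) \<le> r ^ n * D * 1"
      using assms D0 by (intro mult_left_mono) auto
    with far[of n k] have "d (x n) (x (n + k)) * (1 - r) \<le> r ^ n * D" by simp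
    then show ?thesis using assms(5) by (simp add: field_simps)
  qed
  have lim0: "(\<lambda>n. r ^ n * (D / (1 - r))) \<longlonglongrightarrow> 0"
    using assms by (intro tendsto_mult_left_zero LIMSEQ_power_zero) auto
  have "MCauchy x"
    unfolding MCauchy_def
  proof (intro conjI allI impI)
    fix e :: real assume "e > 0"
    then have "\<forall>\<^sub>F n in sequentially. r ^ n * (D / (1 - r)) < e"
      using lim0 by (intro order_tendstoD) auto
    then obtain N where N: "\<And>n. n \<ge> N \<Longrightarrow> r ^ n * (D / (1 - r)) < e"
      by (auto simp: eventually_sequentially)
    have "d (x m) (x n) < e" if "N \<le> m" "m \<le> n" for m n
      using far'[of m "n - m"] N[of m] that by simp
    then have "d (x m) (x n) < e" if "N \<le> m" "N \<le> n" for m n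
      using that commute by (metis nle_le)
    then show "\<exists>N. \<forall>n n'. N \<le> n \<longrightarrow> N \<le> n' \<longrightarrow> d (x n) (x n') < e" by blast
  qed (use xM in auto)
  then obtain l where l: "l \<in> M" "(\<lambda>n. d (x n) l) \<longlonglongrightarrow> 0"
    using assms(1) by (auto simp: mcomplete_def limitin_metric_dist_null)
  have fl: "f l \<in> M" using l assms(3) by blast
  have "(\<lambda>n. r * d (x n) l + d (x (Suc n)) l) \<longlonglongrightarrow> 0"
    using l(2) by (intro tendsto_add_zero tendsto_mult_right_zero LIMSEQ_Suc)
  moreover have "d (f l) l \<le> r * d (x n) l + d (x (Suc n)) l" for n
    using triangle[OF fl xM[of "Suc n"] l(1)] contr[OF l(1) xM[of n]] commute by (simp add: x_def)
  ultimately have "d (f l) l \<le> 0"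
    by (intro LIMSEQ_le_const) auto
  then show ?thesis using l fl zero by (metis nonneg order.antisym)
qed

context cstar_algebra
begin

section \<open>Evaluation of complex polynomials at an element, by Horner's scheme\<close>

definition pev :: "'a \<Rightarrow> complex poly \<Rightarrow> 'a" where
  "pev a p = fold_coeffs (\<lambda>c x. c \<odot> \<one> \<oplus> a \<otimes> x) p \<zero>"

lemma pev_0 [simp]: "pev a 0 = \<zero>"
  by (simp add: pev_def)

lemma pev_pCons [simp]: "a \<in> carrier C \<Longrightarrow> pev a (pCons c p) = c \<odot> \<one> \<oplus> a \<otimes> pev a p"
  by (cases "p = 0 \<and> c = 0") (auto simp: pev_def)

lemma pev_closed [simp, intro]: "a \<in> carrier C \<Longrightarrow> pev a p \<in> carrier C"
  by (induction p) auto

lemma pev_add: "a \<in> carrier C \<Longrightarrow> pev a (p + q) = pev a p \<oplus> pev a q"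
  by (induction p q rule: poly_induct2) (simp_all add: smult_add_left r_distr a_ac)

lemma pev_smult: "a \<in> carrier C \<Longrightarrow> pev a (Polynomial.smult c p) = c \<odot> pev a p"
  by (induction p) (simp_all add: smult_add_right smult_mult_right)

lemma pev_diff: "a \<in> carrier C \<Longrightarrow> pev a (p - q) = pev a p \<ominus> pev a q"
  using pev_add[of a p "Polynomial.smult (-1) q"] pev_smult[of a "-1" q] by (simp add: to_smult)

lemma pev_mult: "a \<in> carrier C \<Longrightarrow> pev a (p * q) = pev a p \<otimes> pev a q"
  by (induction p) (simp_all add: pev_add pev_smult l_distr smult_mult_left m_assoc)

lemma pev_1 [simp]: "a \<in> carrier C \<Longrightarrow> pev a 1 = \<one>"
  by (simp add: one_pCons)

lemma pev_power: "a \<in> carrier C \<Longrightarrow> pev a (p ^ n) = pev a p [^] n"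
  by (induction n) (simp_all add: pev_mult power_Suc2 del: power_Suc)

lemma pev_monom: "a \<in> carrier C \<Longrightarrow> pev a (Polynomial.monom c n) = c \<odot> a [^] n"
  by (induction n) (simp_all add: monom_0 monom_Suc smult_mult_right nat_pow_Suc2[symmetric])

lemma pev_pcompose: "a \<in> carrier C \<Longrightarrow> pev a (pcompose p q) = pev (pev a q) p"
  by (induction p) (simp_all add: pcompose_pCons pev_add pev_mult)

lemma pev_star: "a \<in> carrier C \<Longrightarrow> star C (pev a p) = pev (star C a) (map_poly cnj p)"
proof (induction p)
  case (pCons c p)
  \<comment> \<open>The involution reverses the factors of the Horner step; they are put back in
    order by commutativity of the polynomial ring.\<close>
  have "pev (star C a) (map_poly cnj p) \<otimes> star C a = star C a \<otimes> pev (star C a) (map_poly cnj p)"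
    if "a \<in> carrier C" for p
    using pev_mult[of "star C a" "map_poly cnj p" "[:0,1:]"] pev_mult[of "star C a" "[:0,1:]" "map_poly cnj p"] that
    by (simp add: mult.commute)
  with pCons show ?case
    by (simp add: map_poly_pCons star_add star_smult star_mult)
qed simp

lemma pev_commute:
  assumes "a \<in> carrier C" "y \<in> carrier C" "y \<otimes> a = a \<otimes> y"
  shows "y \<otimes> pev a p = pev a p \<otimes> y"
proof (induction p)
  case (pCons c p)
  have "y \<otimes> (a \<otimes> pev a p) = a \<otimes> (y \<otimes> pev a p)"
    using assms by (simp add: m_assoc[symmetric])
  with pCons assms show ?case
    by (simp add: r_distr l_distr smult_mult_left smult_mult_right m_assoc)
qed (use assms in auto)

text \<open>Powers of a contraction have norm at most 1, so each coefficient contributes at most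
  \<open>B\<close>. The factor is linear in the degree, which \<open>le_of_power_le_linear\<close>
  can absorb.\<close>

lemma nrm_pev_le_coeffs:
  assumes "a \<in> carrier C" "nrm C a \<le> 1" "\<And>n. cmod (poly.coeff p n) \<le> B"
  shows "nrm C (pev a p) \<le> real (length (coeffs p)) * B"
  using assms(3)
proof (induction p)
  case (pCons c p)
  have c: "cmod c \<le> B" using pCons.prems[of 0] by simp
  have p: "cmod (poly.coeff p n) \<le> B" for n using pCons.prems[of "Suc n"] by simp
  have "nrm C (c \<odot> \<one>) \<le> cmod c * 1"
    using nrm_one_le by (simp add: nrm_smult mult_left_le)
  moreover have "nrm C (a \<otimes> pev a p) \<le> 1 * (real (length (coeffs p)) * B)"
    using assms by (intro nrm_mult_le pCons.IH p) auto
  ultimately have "nrm C (pev a (pCons c p)) \<le> B + real (length (coeffs p)) * B"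
    using nrm_triangle[of "c \<odot> \<one>" "a \<otimes> pev a p"] c assms by auto
  then show ?case
    using pCons.hyps by (auto simp: coeffs_pCons_eq_cCons cCons_def algebra_simps)
qed simp

text \<open>Here \<open>s = 1 - y\<close>, where \<open>y\<close> is the fixed point of the contraction \<open>y \<mapsto> (b\<^sup>2 + y\<^sup>2) / 2\<close>.\<close>

lemma exists_sqrt_one_minus:
  assumes b: "b \<in> carrier C" "star C b = b" "nrm C b < 1"
  obtains s where "s \<in> carrier C" "star C s = s" "s \<otimes> b = b \<otimes> s" "b \<otimes> b \<oplus> s \<otimes> s = \<one>"
proof -
  define \<rho> where "\<rho> = (nrm C b)\<^sup>2"
  \<comment> \<open>The smaller root of \<open>(\<rho> + r\<^sup>2) / 2 = r\<close>: the ball of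
    radius \<open>r\<close> is then mapped into itself, and \<open>r\<close> is also the contraction
    constant there.\<close>
  define r where "r = 1 - sqrt (1 - \<rho>)"
  have \<rho>: "0 \<le> \<rho>" "\<rho> < 1"
    using b nrm_nonneg[OF b(1)] power_strict_mono[of "nrm C b" 1 2] by (auto simp: \<rho>_def)
  have r: "0 \<le> r" "r < 1" "(\<rho> + r\<^sup>2) / 2 = r"
    using \<rho> by (auto simp: r_def power2_eq_square algebra_simps) (simp add: field_simps)
  \<comment> \<open>Selfadjointness and commutation with \<open>b\<close> are built into the domain,
    so that the fixed point inherits them.\<close>
  define S where "S = {y \<in> carrier C. star C y = y \<and> y \<otimes> b = b \<otimes> y \<and> nrm C y \<le> r}"
  define f where "f = (\<lambda>y. (1/2) \<odot> (b \<otimes> b \<oplus> y \<otimes> y))"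
  have bb: "nrm C (b \<otimes> b) \<le> \<rho>"
    using nrm_mult[of b b] b by (simp add: \<rho>_def power2_eq_square)
  interpret M: Metric_space "carrier C" "cdist C" by (rule Metric_space_cdist)
  have SC: "S \<subseteq> carrier C" by (auto simp: S_def)
  interpret SM: Submetric "carrier C" "cdist C" S using SC by unfold_locales
  have "closedin M.mtopology S"
    unfolding closedin_norm_topology_iff[unfolded norm_topology_def]
  proof (intro conjI allI impI SC; elim conjE)
    fix x l assume x: "\<forall>n. x n \<in> S" and l: "l \<in> carrier C" "(\<lambda>n. nrm C (x n \<ominus> l)) \<longlonglongrightarrow> 0"
    have bx: "bseq x" using x by (intro bseqI[of _ r]) (auto simp: S_def)
    have xl: "approx sequentially x (\<lambda>_. l)" using l bx by (auto simp: approx_def)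
    have "approx sequentially (\<lambda>_. star C l) (\<lambda>n. star C (x n))"
      by (intro approx_sym[OF approx_star] xl)
    also have "(\<lambda>n. star C (x n)) = x" using x by (auto simp: S_def)
    also note xl
    finally have 1: "star C l = l" by (rule approx_const_eq) simp
    have "approx sequentially (\<lambda>_. l \<otimes> b) (\<lambda>n. x n \<otimes> b)"
      using b by (intro approx_sym[OF approx_mult] xl approx_refl) auto
    also have "(\<lambda>n. x n \<otimes> b) = (\<lambda>n. b \<otimes> x n)" using x by (auto simp: S_def)
    also have "approx sequentially (\<lambda>n. b \<otimes> x n) (\<lambda>n. b \<otimes> l)"
      using b by (intro approx_mult xl approx_refl) auto
    finally have 2: "l \<otimes> b = b \<otimes> l" by (rule approx_const_eq) simp
    have "nrm C l \<le> r"
      using x by (intro approx_nrm_le[OF xl]) (auto simp: S_def)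
    with 1 2 l show "l \<in> S" by (auto simp: S_def)
  qed
  then have complS: "Metric_space.mcomplete S (cdist C)"
    using SM.closedin_mcomplete_imp_mcomplete[OF _ complete] by simp
  have "S \<noteq> {}"
    using r b by (auto simp: S_def intro!: exI[of _ "\<zero>"])
  moreover have "f \<in> S \<rightarrow> S"
  proof
    fix y assume y: "y \<in> S"
    have "nrm C (y \<otimes> y) \<le> r * r" using y by (intro nrm_mult_le) (auto simp: S_def)
    then have "nrm C (b \<otimes> b \<oplus> y \<otimes> y) \<le> \<rho> + r\<^sup>2"
      using nrm_triangle[of "b \<otimes> b" "y \<otimes> y"] bb b y by (auto simp: S_def power2_eq_square)
    then have n: "nrm C (f y) \<le> r"
      using r(3) b y by (auto simp: f_def nrm_smult S_def)
    have "b \<otimes> (b \<otimes> b \<oplus> y \<otimes> y) = (b \<otimes> b \<oplus> y \<otimes> y) \<otimes> b"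
    proof -
      have "b \<otimes> (y \<otimes> y) = y \<otimes> y \<otimes> b"
        using y b unfolding S_def by (metis (mono_tags, lifting) m_assoc mem_Collect_eq)
      then show ?thesis using b y by (simp add: r_distr l_distr S_def m_assoc)
    qed
    with n b y show "f y \<in> S"
      by (auto simp: f_def S_def star_smult star_add star_mult smult_mult_left smult_mult_right)
  qed
  moreover have "cdist C (f x) (f y) \<le> r * cdist C x y" if xy: "x \<in> S" "y \<in> S" for x y
  proof -
    have c: "x \<in> carrier C" "y \<in> carrier C" "nrm C x \<le> r" "nrm C y \<le> r" using xy by (auto simp: S_def)
    have "f x \<ominus> f y = (1/2) \<odot> (x \<otimes> x \<ominus> y \<otimes> y)"
    proof -
      have "(1/2 + (-1/2)) \<odot> (b \<otimes> b) = (1/2) \<odot> (b \<otimes> b) \<oplus> (-1/2) \<odot> (b \<otimes> b)"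
        using b(1) by (intro smult_add_left) auto
      then have "(1/2) \<odot> (b \<otimes> b) \<oplus> (-1/2) \<odot> (b \<otimes> b) = \<zero>"
        using b(1) by simp
      then have "(1/2) \<odot> (b \<otimes> b) \<oplus> ((-1 / 2) \<odot> (b \<otimes> b) \<oplus> w) = w" if "w \<in> carrier C" for w
        using b(1) that by (simp add: a_assoc[symmetric])
      moreover have "(1/2) \<odot> (x \<otimes> x) \<oplus> ((-1 / 2) \<odot> (b \<otimes> b) \<oplus> (-1 / 2) \<odot> (y \<otimes> y))
        = (-1 / 2) \<odot> (b \<otimes> b) \<oplus> ((1/2) \<odot> (x \<otimes> x) \<oplus> (-1 / 2) \<odot> (y \<otimes> y))"
        using b c by (simp add: a_lcomm)
      ultimately show ?thesis
        using b c by (simp add: f_def to_smult a_assoc)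
    qed
    moreover have "nrm C (x \<otimes> x \<ominus> y \<otimes> y) \<le> nrm C (x \<ominus> y) * r + r * nrm C (x \<ominus> y)"
      unfolding diff_mult_diff[OF c(1,2) c(1,2)]
      using c by (intro order.trans[OF nrm_triangle] add_mono nrm_mult_le) auto
    moreover have "f x \<in> carrier C" "f y \<in> carrier C" using b(1) c by (auto simp: f_def)
    ultimately show ?thesis
      using c by (simp add: cdist_def nrm_smult)
  qed
  ultimately obtain y where y: "y \<in> S" "f y = y"
    using SM.sub.contraction_fixed_point[OF complS _ _ r(1,2)] by blast
  have yc: "y \<in> carrier C" "star C y = y" "y \<otimes> b = b \<otimes> y" using y by (auto simp: S_def)
  define s where "s = \<one> \<ominus> y"
  have sc: "s \<in> carrier C" using yc by (simp add: s_def)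
  \<comment> \<open>The fixed point equation b^2 + y^2 = 2 y is the same as b^2 + (1 - y)^2 =
    1.\<close>
  have "b \<otimes> b \<oplus> y \<otimes> y = 2 \<odot> f y"
    using b yc by (simp add: f_def)
  then have eq: "b \<otimes> b \<oplus> y \<otimes> y = 2 \<odot> y" using y by simp
  have "s \<otimes> s = \<one> \<oplus> ((-2) \<odot> y \<oplus> y \<otimes> y)"
  proof -
    have "(-2) \<odot> y = (-1 + -1) \<odot> y" by simp
    also have "\<dots> = (-1) \<odot> y \<oplus> (-1) \<odot> y" using yc by (simp only: smult_add_left)
    finally show ?thesis
      using yc by (simp add: s_def to_smult l_distr r_distr a_ac)
  qed
  then have "b \<otimes> b \<oplus> s \<otimes> s = (b \<otimes> b \<oplus> y \<otimes> y) \<oplus> ((-2) \<odot> y \<oplus> \<one>)"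
    using b yc by (simp add: a_ac)
  also have "\<dots> = \<one>"
  proof -
    have "2 \<odot> y \<oplus> (-2) \<odot> y = (2 + -2) \<odot> y" using yc by (simp only: smult_add_left)
    then have "2 \<odot> y \<oplus> (-2) \<odot> y = \<zero>" using yc by simp
    then show ?thesis unfolding eq using yc by (simp add: a_assoc[symmetric])
  qed
  finally show ?thesis
    using that[of s] sc yc b
    by (simp add: s_def star_diff) (simp add: to_smult l_distr r_distr)
qed

text \<open>On the unit circle Re z is (z + 1/z) / 2, and \<open>b\<close> is formed from
  \<open>u\<close> and its inverse \<open>v\<close> in the same way. Multiplying by a power of z,
  respectively of \<open>u\<close>, clears the negative powers; one polynomial \<open>q\<close>
  serves both.\<close>

lemma unitary_poly:
  assumes u: "u \<in> carrier C" and v: "v \<in> carrier C" and uv: "u \<otimes> v = \<one>" "v \<otimes> u = \<one>"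
    and b: "b = (1/2) \<odot> (u \<oplus> v)"
  shows "\<exists>q d. (\<forall>z. cmod z = 1 \<longrightarrow> poly q z = z ^ d * poly p (of_real (Re z))) \<and>
    u [^] d \<otimes> pev b p = pev u q"
proof (induction p)
  case 0
  show ?case by (rule exI[of _ 0], rule exI[of _ 0]) (use u in auto)
next
  case (pCons c p)
  then obtain q d where q: "\<And>z. cmod z = 1 \<Longrightarrow> poly q z = z ^ d * poly p (of_real (Re z))"
    "u [^] d \<otimes> pev b p = pev u q" by blast
  have bc: "b \<in> carrier C" using u v b by simp
  \<comment> \<open>One Horner step: z^(d+1) (c + Re z * p) = c z^(d+1) + (1/2 + z^2/2) (z^d
    p).\<close>
  define q' where "q' = Polynomial.monom c (Suc d) + [:1/2, 0, 1/2:] * q"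
  have "poly q' z = z ^ Suc d * poly (pCons c p) (of_real (Re z))" if z: "cmod z = 1" for z
  proof -
    have "z * of_real (Re z) = z * ((z + cnj z) / 2)"
      by (simp add: complex_add_cnj)
    also have "\<dots> = (z * z + z * cnj z) / 2"
      by (simp add: algebra_simps)
    also have "z * cnj z = 1"
      using z by (simp add: complex_norm_square[symmetric])
    finally have "z * of_real (Re z) = 1/2 + z * (z * (1/2))"
      by (simp add: field_simps)
    moreover have "poly q' z = c * z ^ Suc d + (1/2 + z * (z * (1/2))) * (z ^ d * poly p (of_real (Re z)))"
      using q(1)[OF z] by (simp add: q'_def poly_monom) (simp add: field_simps)
    moreover have "z ^ Suc d * (c + w * y) = c * z ^ Suc d + (z * w) * (z ^ d * y)" for w y
      by (simp add: algebra_simps)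
    ultimately show ?thesis
      by (simp only: poly_pCons)
  qed
  moreover have "u [^] Suc d \<otimes> pev b (pCons c p) = pev u q'"
  proof -
    have ub: "u \<otimes> b = pev u [:1/2, 0, 1/2:]"
      using u v uv b by (simp add: smult_mult_right r_distr smult_add_right a_comm)
    have "u [^] d = pev u (Polynomial.monom 1 d)"
      using u by (simp add: pev_monom)
    then have comm: "u [^] d \<otimes> (u \<otimes> b) = (u \<otimes> b) \<otimes> u [^] d"
      using u by (simp only: ub pev_mult[symmetric] mult.commute)
    have "u [^] Suc d \<otimes> pev b (pCons c p) = c \<odot> u [^] Suc d \<oplus> u [^] Suc d \<otimes> (b \<otimes> pev b p)"
      using u bc by (simp add: r_distr smult_mult_right del: nat_pow_Suc)
    also have "u [^] Suc d \<otimes> (b \<otimes> pev b p) = (u [^] d \<otimes> (u \<otimes> b)) \<otimes> pev b p"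
      using u bc by (simp add: m_assoc)
    also have "\<dots> = (u \<otimes> b) \<otimes> pev u q"
      unfolding comm using u bc by (simp add: m_assoc q(2))
    finally show ?thesis
      unfolding ub q'_def using u by (simp only: pev_add pev_mult pev_monom)
  qed
  ultimately show ?case by blast
qed

text \<open>Powers of a selfadjoint element are selfadjoint, so each application of the C*-identity
  doubles the exponent.\<close>

lemma nrm_power_two_power:
  assumes "x \<in> carrier C" "star C x = x"
  shows "nrm C (x [^] (2 ^ k :: nat)) = nrm C x ^ (2 ^ k)"
proof -
  have st: "star C (x [^] n) = x [^] n" for n :: nat
  proof (induction n)
    case (Suc n)
    then show ?case
      using assms by (simp add: star_mult nat_pow_Suc2[symmetric])
  qed simp
  show ?thesis
  proof (induction k)
    case (Suc k)
    have "x [^] (2 ^ Suc k :: nat) = star C (x [^] (2 ^ k :: nat)) \<otimes> x [^] (2 ^ k :: nat)"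
      using assms st by (simp add: nat_pow_mult mult_2)
    then show ?case
      using assms Suc by (simp only: cstar_identity nat_pow_closed) (simp add: power_mult[symmetric] mult.commute)
  qed (use assms in simp)
qed

lemma nrm_pow_le_one: "v \<in> carrier C \<Longrightarrow> nrm C v \<le> 1 \<Longrightarrow> nrm C (v [^] (n::nat)) \<le> 1"
proof (induction n)
  case (Suc n)
  then show ?case using nrm_mult_le[of "v [^] n" v 1 1] by simp
qed (simp add: nrm_one_le)

text \<open>With the unitary \<open>u = b + \<i> (1 - b\<^sup>2)\<^sup>1\<^sup>/\<^sup>2\<close>, the element \<open>u\<^sup>d p(b)\<close> is a polynomial in \<open>u\<close> whose
  coefficients are at most \<open>M\<close> by Cauchy's inequality. Applied to \<open>p\<^sup>m\<close> this gives
  \<open>nrm C (p(b))\<^sup>m = O(m M\<^sup>m)\<close> for \<open>m = 2\<^sup>k\<close>.\<close>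

lemma nrm_pev_le_unit_selfadjoint:
  assumes b: "b \<in> carrier C" "star C b = b" "nrm C b < 1"
    and p: "star C (pev b p) = pev b p"
    and M: "\<And>t. \<bar>t\<bar> \<le> 1 \<Longrightarrow> cmod (poly p (of_real t)) \<le> M"
  shows "nrm C (pev b p) \<le> M"
proof -
  obtain s where s: "s \<in> carrier C" "star C s = s" "s \<otimes> b = b \<otimes> s" "b \<otimes> b \<oplus> s \<otimes> s = \<one>"
    using exists_sqrt_one_minus[OF b] by blast
  define u where "u = b \<oplus> \<i> \<odot> s"
  define v where "v = b \<oplus> (-\<i>) \<odot> s"
  have u: "u \<in> carrier C" and v: "v \<in> carrier C" using b s by (auto simp: u_def v_def)
  have canc: "\<i> \<odot> (b \<otimes> s) \<oplus> (-\<i>) \<odot> (b \<otimes> s) = \<zero>"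
    using b s smult_add_left[of "b \<otimes> s" "\<i>" "-\<i>"] by simp
  have canc': "\<i> \<odot> (b \<otimes> s) \<oplus> ((-\<i>) \<odot> (b \<otimes> s) \<oplus> w) = w" if "w \<in> carrier C" for w
    using canc b s that by (simp add: a_assoc[symmetric])
  have uv: "u \<otimes> v = \<one>"
    using b s canc' by (simp add: u_def v_def l_distr r_distr smult_mult_left smult_mult_right smult_add_right a_ac)
  have vu: "v \<otimes> u = \<one>"
    using b s canc' by (simp add: u_def v_def l_distr r_distr smult_mult_left smult_mult_right smult_add_right a_ac)
  have sv: "star C v = u" "star C u = v"
    using b s by (simp_all add: u_def v_def star_add star_smult)
  have beq: "b = (1/2) \<odot> (u \<oplus> v)"
  proof -
    have "\<i> \<odot> s \<oplus> (-\<i>) \<odot> s = \<zero>" using s smult_add_left[of s "\<i>" "-\<i>"] by simp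
    then have "u \<oplus> v = b \<oplus> b" using b s by (simp add: u_def v_def a_ac a_assoc[symmetric])
    also have "\<dots> = 2 \<odot> b" using b smult_add_left[of b 1 1] by simp
    finally show ?thesis using b by simp
  qed
  have nv: "nrm C v \<le> 1"
  proof -
    have "(nrm C v)\<^sup>2 = nrm C \<one>" using cstar_identity[OF v] sv uv by simp
    then have "(nrm C v)\<^sup>2 \<le> 1" using nrm_one_le by simp
    then show ?thesis using power2_le_imp_le[of "nrm C v" 1] by simp
  qed
  have nu: "nrm C u \<le> 1" using nv nrm_star[OF v] sv by simp
  have M0: "0 \<le> M" using order.trans[OF norm_ge_zero M[of 0]] by simp
  obtain q d where q: "\<And>z. cmod z = 1 \<Longrightarrow> poly q z = z ^ d * poly p (of_real (Re z))"
    "u [^] d \<otimes> pev b p = pev u q" using unitary_poly[OF u v uv vu beq, of p] by blast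
  define P where "P = pev b p"
  have P: "P \<in> carrier C" using b by (simp add: P_def)
  have bnd: "nrm C (P [^] m) \<le> (real m * real (degree q) + 1) * M ^ m" for m :: nat
  proof -
    have ub: "u \<otimes> b = b \<otimes> u" using b s by (simp add: u_def l_distr r_distr smult_mult_left smult_mult_right)
    have uP: "P \<otimes> u = u \<otimes> P" using pev_commute[OF b(1) u ub] by (simp add: P_def)
    have "P \<otimes> u [^] d = u [^] d \<otimes> P"
      using pev_commute[OF u P uP, of "Polynomial.monom 1 d"] u by (simp add: pev_monom)
    then have "(u [^] d \<otimes> P) [^] m = (u [^] d) [^] m \<otimes> P [^] m"
      using u P by (intro pow_mult_distrib) auto
    then have eq: "pev u (q ^ m) = u [^] (d * m) \<otimes> P [^] m"
      using u q(2) by (simp add: pev_power P_def nat_pow_pow)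
    have "v [^] n \<otimes> u [^] n = \<one>" for n :: nat
    proof -
      have "(v \<otimes> u) [^] n = v [^] n \<otimes> u [^] n" using u v uv vu by (intro pow_mult_distrib) auto
      then show ?thesis using vu by simp
    qed
    \<comment> \<open>The power of \<open>u\<close> is removed by its inverse \<open>v\<close>, a
      contraction, so nothing is lost in norm.\<close>
    then have "P [^] m = v [^] (d * m) \<otimes> pev u (q ^ m)"
      unfolding eq using u v P by (simp add: m_assoc[symmetric])
    then have "nrm C (P [^] m) \<le> 1 * nrm C (pev u (q ^ m))"
      using u v nv by (simp only:) (intro nrm_mult_le nrm_pow_le_one; simp)
    also have "nrm C (pev u (q ^ m)) \<le> real (length (coeffs (q ^ m))) * M ^ m"
    proof (rule nrm_pev_le_coeffs[OF u nu], rule norm_coeff_le_circle)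
      fix z :: complex assume z: "cmod z = 1"
      have "cmod (poly q z) \<le> M"
        using z q(1)[OF z] M[of "Re z"] abs_Re_le_cmod[of z] by (simp add: norm_mult norm_power)
      then show "cmod (poly (q ^ m) z) \<le> M ^ m"
        by (simp add: norm_power power_mono)
    qed
    also have "\<dots> \<le> (real m * real (degree q) + 1) * M ^ m"
    proof (rule mult_right_mono)
      have "length (coeffs (q ^ m)) \<le> Suc (degree (q ^ m))"
        by (cases "q ^ m = 0") (auto simp: length_coeffs_degree power_0_left)
      also have "degree (q ^ m) \<le> degree q * m" by (rule degree_power_le)
      finally have "real (length (coeffs (q ^ m))) \<le> real (Suc (degree q * m))"
        by (simp only: of_nat_le_iff Suc_le_mono)
      then show "real (length (coeffs (q ^ m))) \<le> real m * real (degree q) + 1"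
        by (simp add: algebra_simps)
    qed (use M0 in simp)
    finally show ?thesis by simp
  qed
  show ?thesis
    unfolding P_def[symmetric]
  proof (rule le_of_power_le_linear[OF _ M0])
    fix k
    show "nrm C P ^ 2 ^ k \<le> (2 ^ k * real (degree q) + 1) * M ^ 2 ^ k"
      using bnd[of "2 ^ k"] nrm_power_two_power[OF P, of k] p by (simp add: P_def)
  qed
qed

text \<open>Rescaling by \<open>R\<close> reduces to the unit case. There the polynomial must have a
  selfadjoint value, so it is applied to \<open>h\<close>, the product of \<open>p'\<close> with its
  conjugate, whose value has norm \<open>(nrm C (pev a p))\<^sup>2\<close>. The strict bound on
  \<open>nrm C a\<close> is what the root of \<open>\<one> \<ominus> b \<otimes> b\<close>
  requires.\<close>

lemma nrm_pev_le:
  assumes a: "a \<in> carrier C" "star C a = a" "nrm C a < R"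
    and M: "\<And>t. \<bar>t\<bar> \<le> R \<Longrightarrow> cmod (poly p (of_real t)) \<le> M"
  shows "nrm C (pev a p) \<le> M"
proof -
  have R: "R > 0" using a nrm_nonneg[of a] by linarith
  have M0: "0 \<le> M" using order.trans[OF norm_ge_zero M[of 0]] R by simp
  define b where "b = of_real (1 / R) \<odot> a"
  have b: "b \<in> carrier C" "star C b = b" "nrm C b < 1"
    using a R by (auto simp: b_def star_smult nrm_smult norm_divide field_simps)
  define p' where "p' = pcompose p [:0, of_real R:]"
  have p': "pev b p' = pev a p"
    using a R b by (simp add: p'_def pev_pcompose smult_mult_right) (simp add: b_def smult_mult_right)
  define h where "h = map_poly cnj p' * p'"
  have h: "pev b h = star C (pev b p') \<otimes> pev b p'"
    using b by (simp add: h_def pev_mult pev_star)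
  have "nrm C (pev b h) \<le> M\<^sup>2"
  proof (rule nrm_pev_le_unit_selfadjoint[OF b])
    show "star C (pev b h) = pev b h"
      using b by (simp add: h star_mult)
    fix t :: real assume t: "\<bar>t\<bar> \<le> 1"
    then have "\<bar>R * t\<bar> \<le> R" using R by (simp add: abs_mult mult_left_le)
    then have "cmod (poly p (of_real (R * t))) \<le> M" by (rule M)
    then have "cmod (poly p' (of_real t)) \<le> M" by (simp add: p'_def poly_pcompose mult.commute)
    moreover have "poly (map_poly cnj p') (of_real t) = cnj (poly p' (of_real t))"
      using poly_cnj[of p' "of_real t"] by simp
    ultimately show "cmod (poly h (of_real t)) \<le> M\<^sup>2"
      unfolding h_def poly_mult norm_mult power2_eq_square using M0 by (intro mult_mono) auto
  qed
  then have "(nrm C (pev b p'))\<^sup>2 \<le> M\<^sup>2"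
    using b by (simp add: h cstar_identity)
  then show ?thesis
    using M0 p' by (simp add: power2_le_iff_abs_le)
qed

end

section \<open>Continuous functional calculus\<close>

text \<open>Uniform approximation on [-R, R] with a prescribed rate and a free constant: the rate
  survives sums and products, and one form serves Cauchy estimates and limits alike.\<close>

definition poly_approx :: "real \<Rightarrow> (nat \<Rightarrow> complex poly) \<Rightarrow> (real \<Rightarrow> real) \<Rightarrow> bool" where
  "poly_approx R P g \<longleftrightarrow>
    (\<exists>K. \<forall>n t. \<bar>t\<bar> \<le> R \<longrightarrow> cmod (poly (P n) (of_real t) - of_real (g t)) \<le> K / real (Suc n))"

lemma poly_approxE:
  assumes "poly_approx R P g"
  obtains K where "K \<ge> 0"
    "\<And>n t. \<bar>t\<bar> \<le> R \<Longrightarrow> cmod (poly (P n) (of_real t) - of_real (g t)) \<le> K / real (Suc n)"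
proof -
  obtain K where K: "\<And>n t. \<bar>t\<bar> \<le> R \<Longrightarrow> cmod (poly (P n) (of_real t) - of_real (g t)) \<le> K / real (Suc n)"
    using assms by (auto simp: poly_approx_def)
  have "K / real (Suc n) \<le> \<bar>K\<bar> / real (Suc n)" for n
    by (intro divide_right_mono) auto
  then show ?thesis
    using K by (intro that[of "\<bar>K\<bar>"]) (auto intro: order.trans)
qed

lemma poly_approx_exists:
  assumes "continuous_on {-R..R} g"
  obtains P where "poly_approx R P g"
proof -
  have "\<exists>p :: complex poly. \<forall>t\<in>{-R..R}. cmod (poly p (of_real t) - of_real (g t)) \<le> 1 / real (Suc n)" for n
  proof -
    obtain h where h: "real_polynomial_function h" "\<And>t. t \<in> {-R..R} \<Longrightarrow> \<bar>g t - h t\<bar> < 1 / real (Suc n)"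
      using Stone_Weierstrass_real_polynomial_function[of "{-R..R}" g "1 / real (Suc n)"] assms by auto
    obtain a N where a: "h = (\<lambda>x. \<Sum>i\<le>N. a i * x ^ i)"
      using h(1) unfolding real_polynomial_function_iff_sum by blast
    define p where "p = (\<Sum>i\<le>N. Polynomial.monom (complex_of_real (a i)) i)"
    have "poly p (of_real t) = of_real (h t)" for t
      by (simp add: p_def a poly_sum poly_monom)
    then have "cmod (poly p (of_real t) - of_real (g t)) = \<bar>g t - h t\<bar>" for t
      by (metis norm_of_real of_real_diff abs_minus_commute)
    with h(2) show ?thesis by (intro exI[of _ p]) (auto intro: less_imp_le)
  qed
  then obtain P :: "nat \<Rightarrow> complex poly" where
    "\<And>n t. t \<in> {-R..R} \<Longrightarrow> cmod (poly (P n) (of_real t) - of_real (g t)) \<le> 1 / real (Suc n)"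
    by metis
  then have "poly_approx R P g"
    unfolding poly_approx_def by (intro exI[of _ 1]) (auto simp: abs_le_iff)
  then show ?thesis by (rule that)
qed

lemma poly_approx_poly:
  assumes "\<And>t. \<bar>t\<bar> \<le> R \<Longrightarrow> poly p (of_real t) = of_real (g t)"
  shows "poly_approx R (\<lambda>_. p) g"
  unfolding poly_approx_def using assms by (intro exI[of _ 0]) simp

lemma poly_approx_cong:
  assumes "poly_approx R P g" "\<And>t. \<bar>t\<bar> \<le> R \<Longrightarrow> g t = h t"
  shows "poly_approx R P h"
  using assms by (simp add: poly_approx_def)

text \<open>At real points conjugated coefficients give the conjugate value, and the target is real.
  This is the source of selfadjointness of \<open>cfc\<close>.\<close>

lemma poly_approx_cnj: "poly_approx R P g \<Longrightarrow> poly_approx R (\<lambda>n. map_poly cnj (P n)) g"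
proof -
  have "cmod (poly (map_poly cnj p) (of_real t) - of_real x) = cmod (poly p (of_real t) - of_real x)"
    for p :: "complex poly" and t x
    using poly_cnj[of p "of_real t"] by (metis complex_cnj_complex_of_real complex_cnj_diff complex_mod_cnj)
  then show "poly_approx R P g \<Longrightarrow> poly_approx R (\<lambda>n. map_poly cnj (P n)) g"
    by (simp add: poly_approx_def)
qed

lemma poly_approx_add:
  assumes "poly_approx R P g" "poly_approx R Q h"
  shows "poly_approx R (\<lambda>n. P n + Q n) (\<lambda>t. g t + h t)"
proof -
  obtain K where K: "\<And>n t. \<bar>t\<bar> \<le> R \<Longrightarrow> cmod (poly (P n) (of_real t) - of_real (g t)) \<le> K / real (Suc n)"
    using assms(1) by (rule poly_approxE) blast
  obtain L where L: "\<And>n t. \<bar>t\<bar> \<le> R \<Longrightarrow> cmod (poly (Q n) (of_real t) - of_real (h t)) \<le> L / real (Suc n)"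
    using assms(2) by (rule poly_approxE) blast
  have "cmod (poly (P n + Q n) (of_real t) - of_real (g t + h t)) \<le> (K + L) / real (Suc n)"
    if "\<bar>t\<bar> \<le> R" for n t
  proof -
    have "poly (P n + Q n) (of_real t) - of_real (g t + h t) =
      (poly (P n) (of_real t) - of_real (g t)) + (poly (Q n) (of_real t) - of_real (h t))"
      by simp
    then show ?thesis
      using norm_triangle_le[OF add_mono[OF K[OF that] L[OF that]]] by (simp only: add_divide_distrib)
  qed
  then show ?thesis unfolding poly_approx_def by blast
qed

lemma poly_approx_bounded:
  assumes "poly_approx R P g" "continuous_on {-R..R} g"
  obtains B where "B \<ge> 0" "\<And>t. \<bar>t\<bar> \<le> R \<Longrightarrow> \<bar>g t\<bar> \<le> B"
    "\<And>n t. \<bar>t\<bar> \<le> R \<Longrightarrow> cmod (poly (P n) (of_real t)) \<le> B"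
proof -
  obtain K where K: "K \<ge> 0" "\<And>n t. \<bar>t\<bar> \<le> R \<Longrightarrow> cmod (poly (P n) (of_real t) - of_real (g t)) \<le> K / real (Suc n)"
    using assms(1) by (rule poly_approxE) blast
  have "bounded (g ` {-R..R})"
    using assms(2) by (intro compact_imp_bounded compact_continuous_image) auto
  then obtain B where B: "B > 0" "\<And>t. t \<in> {-R..R} \<Longrightarrow> \<bar>g t\<bar> \<le> B"
    by (auto simp: bounded_pos)
  have "cmod (poly (P n) (of_real t)) \<le> B + K" if t: "\<bar>t\<bar> \<le> R" for n t
  proof -
    have "K / real (Suc n) \<le> K" using K(1) by (simp add: divide_le_eq mult_le_cancel_left1)
    moreover have "\<bar>g t\<bar> \<le> B" using B t by (auto simp: abs_le_iff)
    moreover have "cmod (poly (P n) (of_real t)) \<le> cmod (of_real (g t)) + cmod (poly (P n) (of_real t) - of_real (g t))"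
      by (rule norm_triangle_sub)
    ultimately show ?thesis using K(2)[OF t, of n] by (simp only: norm_of_real)
  qed
  note PB = this
  show ?thesis
  proof (rule that[of "B + K"])
    fix t assume "\<bar>t\<bar> \<le> R"
    then have "\<bar>g t\<bar> \<le> B" using B(2)[of t] by (simp add: abs_le_iff)
    then show "\<bar>g t\<bar> \<le> B + K" using K(1) by linarith
  qed (use B K PB in auto)
qed

lemma poly_approx_mult:
  assumes P: "poly_approx R P g" "continuous_on {-R..R} g" and Q: "poly_approx R Q h" "continuous_on {-R..R} h"
  shows "poly_approx R (\<lambda>n. P n * Q n) (\<lambda>t. g t * h t)"
proof -
  obtain K where K: "\<And>n t. \<bar>t\<bar> \<le> R \<Longrightarrow> cmod (poly (P n) (of_real t) - of_real (g t)) \<le> K / real (Suc n)"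
    using P(1) by (rule poly_approxE) blast
  obtain L where L: "\<And>n t. \<bar>t\<bar> \<le> R \<Longrightarrow> cmod (poly (Q n) (of_real t) - of_real (h t)) \<le> L / real (Suc n)"
    using Q(1) by (rule poly_approxE) blast
  obtain B where B: "B \<ge> 0" "\<And>t. \<bar>t\<bar> \<le> R \<Longrightarrow> \<bar>g t\<bar> \<le> B" using P by (rule poly_approx_bounded) blast
  obtain D where D: "D \<ge> 0" "\<And>n t. \<bar>t\<bar> \<le> R \<Longrightarrow> cmod (poly (Q n) (of_real t)) \<le> D"
    using Q by (rule poly_approx_bounded) blast
  have "cmod (poly (P n * Q n) (of_real t) - of_real (g t * h t)) \<le> (K * D + B * L) / real (Suc n)"
    if t: "\<bar>t\<bar> \<le> R" for n t
  proof -
    have "poly (P n * Q n) (of_real t) - of_real (g t * h t) =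
      (poly (P n) (of_real t) - of_real (g t)) * poly (Q n) (of_real t)
      + of_real (g t) * (poly (Q n) (of_real t) - of_real (h t))"
      by (simp add: algebra_simps)
    moreover have "cmod ((poly (P n) (of_real t) - of_real (g t)) * poly (Q n) (of_real t)) \<le> K / real (Suc n) * D"
      unfolding norm_mult using K[OF t] D t by (intro mult_mono) (auto intro: order.trans[OF norm_ge_zero])
    moreover have "cmod (of_real (g t) * (poly (Q n) (of_real t) - of_real (h t))) \<le> B * (L / real (Suc n))"
      unfolding norm_mult using L[OF t] B t by (intro mult_mono) auto
    ultimately have "cmod (poly (P n * Q n) (of_real t) - of_real (g t * h t)) \<le> K / real (Suc n) * D + B * (L / real (Suc n))"
      by (metis norm_triangle_le add_mono)
    then show ?thesis by (simp only: add_divide_distrib) simp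
  qed
  then show ?thesis unfolding poly_approx_def by blast
qed

context cstar_algebra
begin

text \<open>\<open>nrm_pev_le\<close> asks for \<open>nrm C a < R\<close>. Widening the interval by
  \<open>\<delta>\<close> repairs this, and uniform continuity keeps the loss below an arbitrary
  \<open>e\<close>.\<close>

lemma nrm_pev_le':
  assumes a: "a \<in> carrier C" "star C a = a" "nrm C a \<le> R"
    and M: "\<And>t. \<bar>t\<bar> \<le> R \<Longrightarrow> cmod (poly p (of_real t)) \<le> M"
  shows "nrm C (pev a p) \<le> M"
proof (rule field_le_epsilon)
  fix e :: real assume e: "e > 0"
  have R: "R \<ge> 0" using a nrm_nonneg[of a] by linarith
  let ?f = "\<lambda>t. cmod (poly p (of_real t))"
  have "uniformly_continuous_on {-(R+1)..R+1} ?f"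
    by (intro compact_uniformly_continuous continuous_intros) auto
  then obtain d where d: "d > 0" "\<And>t t'. t \<in> {-(R+1)..R+1} \<Longrightarrow> t' \<in> {-(R+1)..R+1} \<Longrightarrow> dist t' t < d \<Longrightarrow> dist (?f t') (?f t) < e"
    unfolding uniformly_continuous_on_def using e by metis
  define \<delta> where "\<delta> = min 1 (d/2)"
  have \<delta>: "\<delta> > 0" "\<delta> \<le> 1" "\<delta> < d" using d(1) by (auto simp: \<delta>_def)
  show "nrm C (pev a p) \<le> M + e"
  proof (rule nrm_pev_le)
    fix t :: real assume t: "\<bar>t\<bar> \<le> R + \<delta>"
    \<comment> \<open>The point of [-R, R] nearest to \<open>t\<close>.\<close>
    define t' where "t' = max (-R) (min R t)"
    have t': "\<bar>t'\<bar> \<le> R" "\<bar>t - t'\<bar> \<le> \<delta>" using t R \<delta> by (auto simp: t'_def)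
    have "dist (?f t) (?f t') < e"
      using t t' \<delta> by (intro d(2)) (auto simp: dist_real_def)
    then show "?f t \<le> M + e" using M[OF t'(1)] by (simp add: dist_real_def)
  qed (use a \<delta> in auto)
qed

text \<open>Meaningful for selfadjoint \<open>a\<close> with \<open>nrm C a \<le> R\<close> and \<open>g\<close> continuous on \<open>[-R, R]\<close>.\<close>

definition cfc :: "real \<Rightarrow> 'a \<Rightarrow> (real \<Rightarrow> real) \<Rightarrow> 'a" where
  "cfc R a g = (SOME l. \<exists>P. poly_approx R P g \<and> approx sequentially (\<lambda>n. pev a (P n)) (\<lambda>_. l))"

definition selfadjoint_le :: "real \<Rightarrow> 'a \<Rightarrow> bool" where
  "selfadjoint_le R a \<longleftrightarrow> a \<in> carrier C \<and> star C a = a \<and> nrm C a \<le> R"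

lemma selfadjoint_leD [simp]:
  assumes "selfadjoint_le R a" shows "a \<in> carrier C" "star C a = a" "nrm C a \<le> R"
  using assms by (auto simp: selfadjoint_le_def)

lemma selfadjoint_le_nonneg: "selfadjoint_le R a \<Longrightarrow> 0 \<le> R"
  using nrm_nonneg selfadjoint_leD order.trans by metis

lemma poly_approx_bseq:
  assumes "selfadjoint_le R a" "continuous_on {-R..R} g" "poly_approx R P g"
  shows "bseq (\<lambda>n. pev a (P n))"
proof -
  obtain B where "\<And>n t. \<bar>t\<bar> \<le> R \<Longrightarrow> cmod (poly (P n) (of_real t)) \<le> B"
    using assms(3,2) by (rule poly_approx_bounded) blast
  then show ?thesis using assms(1) by (intro bseqI[of _ B] nrm_pev_le'[of _ R]) auto
qed

lemma tendsto_over_Suc: "(\<lambda>n. K / real (Suc n)) \<longlonglongrightarrow> 0"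
  using LIMSEQ_Suc[OF lim_const_over_n[of K]] by simp

lemma nrm_pev_diff_le:
  assumes a: "selfadjoint_le R a"
    and le: "\<And>t. \<bar>t\<bar> \<le> R \<Longrightarrow> cmod (poly p (of_real t) - poly q (of_real t)) \<le> M"
  shows "nrm C (pev a p \<ominus> pev a q) \<le> M"
proof -
  have "nrm C (pev a (p - q)) \<le> M"
    by (rule nrm_pev_le'[OF a[THEN selfadjoint_leD(1)] a[THEN selfadjoint_leD(2)] a[THEN selfadjoint_leD(3)]])
       (use le in simp)
  then show ?thesis using selfadjoint_leD(1)[OF a] by (simp add: pev_diff)
qed

text \<open>By the norm bound for polynomials, approximating sequences are Cauchy, and any two for
  the same \<open>g\<close> have the same limit. So the choice made in \<open>cfc\<close> is
  immaterial.\<close>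

lemma cfc_approx:
  assumes a: "selfadjoint_le R a" and g: "continuous_on {-R..R} g" and P: "poly_approx R P g"
  shows "approx sequentially (\<lambda>n. pev a (P n)) (\<lambda>_. cfc R a g)"
proof -
  have eq: "approx sequentially (\<lambda>n. pev a (P n)) (\<lambda>n. pev a (Q n))"
    if P: "poly_approx R P g" and Q: "poly_approx R Q g" for P Q
  proof -
    obtain K where K: "\<And>n t. \<bar>t\<bar> \<le> R \<Longrightarrow> cmod (poly (P n) (of_real t) - of_real (g t)) \<le> K / real (Suc n)"
      using P by (rule poly_approxE) blast
    obtain L where L: "\<And>n t. \<bar>t\<bar> \<le> R \<Longrightarrow> cmod (poly (Q n) (of_real t) - of_real (g t)) \<le> L / real (Suc n)"
      using Q by (rule poly_approxE) blast
    have "nrm C (pev a (P n) \<ominus> pev a (Q n)) \<le> (K + L) / real (Suc n)" for n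
    proof (rule nrm_pev_diff_le[OF a])
      fix t assume t: "\<bar>t\<bar> \<le> R"
      show "cmod (poly (P n) (of_real t) - poly (Q n) (of_real t)) \<le> (K + L) / real (Suc n)"
        using norm_triangle_le_diff[OF add_mono[OF K[OF t, of n] L[OF t, of n]]] by (simp add: add_divide_distrib)
    qed
    then show ?thesis
      by (intro approxI_bound[OF _ _ tendsto_over_Suc[of "K+L"]] poly_approx_bseq[OF a g] P Q) auto
  qed
  have "\<exists>l. approx sequentially (\<lambda>n. pev a (P n)) (\<lambda>_. l)"
  proof -
    obtain K where K: "K \<ge> 0" "\<And>n t. \<bar>t\<bar> \<le> R \<Longrightarrow> cmod (poly (P n) (of_real t) - of_real (g t)) \<le> K / real (Suc n)"
      using P by (rule poly_approxE) blast
    have d: "nrm C (pev a (P m) \<ominus> pev a (P n)) \<le> K / real (Suc m) + K / real (Suc n)" for m n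
    proof (rule nrm_pev_diff_le[OF a])
      fix t assume t: "\<bar>t\<bar> \<le> R"
      show "cmod (poly (P m) (of_real t) - poly (P n) (of_real t)) \<le> K / real (Suc m) + K / real (Suc n)"
        using norm_triangle_le_diff[OF add_mono[OF K(2)[OF t, of m] K(2)[OF t, of n]]] by simp
    qed
    have "\<exists>N. \<forall>m\<ge>N. \<forall>n\<ge>N. nrm C (pev a (P m) \<ominus> pev a (P n)) < e" if e: "e > 0" for e
    proof -
      have "\<forall>\<^sub>F n in sequentially. K / real (Suc n) < e / 2"
        using tendsto_over_Suc[of K] e by (intro order_tendstoD) auto
      then obtain N where N: "\<And>n. n \<ge> N \<Longrightarrow> K / real (Suc n) < e / 2"
        by (auto simp: eventually_sequentially)
      have "nrm C (pev a (P m) \<ominus> pev a (P n)) < e" if "m \<ge> N" "n \<ge> N" for m n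
        using d[of m n] N[OF that(1)] N[OF that(2)] by linarith
      then show ?thesis by blast
    qed
    moreover have "pev a (P n) \<in> carrier C" for n using a by simp
    ultimately obtain l where "l \<in> carrier C" "(\<lambda>n. nrm C (pev a (P n) \<ominus> l)) \<longlonglongrightarrow> 0"
      using Cauchy_converges[of "\<lambda>n. pev a (P n)"] by blast
    then show ?thesis
      using poly_approx_bseq[OF a g P] unfolding approx_def by (intro exI[of _ l] conjI bseq_const)
  qed
  then have "\<exists>l P. poly_approx R P g \<and> approx sequentially (\<lambda>n. pev a (P n)) (\<lambda>_. l)"
    using P by blast
  then have "\<exists>P. poly_approx R P g \<and> approx sequentially (\<lambda>n. pev a (P n)) (\<lambda>_. cfc R a g)"
    unfolding cfc_def by (rule someI_ex)
  then show ?thesis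
    using eq[OF P] approx_trans by blast
qed

lemma cfc_eqI:
  assumes "selfadjoint_le R a" "continuous_on {-R..R} g" "poly_approx R P g"
    "approx sequentially (\<lambda>n. pev a (P n)) (\<lambda>_. l)"
  shows "cfc R a g = l"
  using approx_trans[OF approx_sym[OF cfc_approx[OF assms(1-3)]] assms(4)]
  by (rule approx_const_eq) simp

lemma cfc_closed [simp]:
  assumes "selfadjoint_le R a" "continuous_on {-R..R} g" shows "cfc R a g \<in> carrier C"
proof -
  obtain P where P: "poly_approx R P g" using assms(2) by (rule poly_approx_exists)
  show ?thesis using cfc_approx[OF assms P] by (auto simp: approx_def bseq_def)
qed

lemma cfc_star [simp]:
  assumes "selfadjoint_le R a" "continuous_on {-R..R} g" shows "star C (cfc R a g) = cfc R a g"
proof -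
  obtain P where P: "poly_approx R P g" using assms(2) by (rule poly_approx_exists)
  have "approx sequentially (\<lambda>n. pev a (map_poly cnj (P n))) (\<lambda>_. star C (cfc R a g))"
    using approx_star[OF cfc_approx[OF assms P]] assms(1) by (simp add: pev_star)
  from cfc_eqI[OF assms poly_approx_cnj[OF P] this] show ?thesis by simp
qed

lemma cfc_poly:
  assumes a: "selfadjoint_le R a" and "\<And>t. \<bar>t\<bar> \<le> R \<Longrightarrow> poly p (of_real t) = of_real (g t)"
  shows "cfc R a g = pev a p"
proof (rule cfc_eqI[OF a _ poly_approx_poly[OF assms(2)]])
  have "continuous_on {-R..R} (\<lambda>t. Re (poly p (of_real t)))" by (intro continuous_intros)
  then show "continuous_on {-R..R} g"
    by (rule continuous_on_eq) (use assms(2) in \<open>auto simp: abs_le_iff\<close>)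
qed (use a in auto)

lemma cfc_id: "selfadjoint_le R a \<Longrightarrow> cfc R a (\<lambda>t. t) = a"
  by (subst cfc_poly[of _ _ "[:0, 1:]"]) auto

lemma cfc_add:
  assumes "selfadjoint_le R a" "continuous_on {-R..R} g" "continuous_on {-R..R} h"
  shows "cfc R a (\<lambda>t. g t + h t) = cfc R a g \<oplus> cfc R a h"
proof -
  obtain P where P: "poly_approx R P g" using assms(2) by (rule poly_approx_exists)
  obtain Q where Q: "poly_approx R Q h" using assms(3) by (rule poly_approx_exists)
  show ?thesis
    using approx_add[OF cfc_approx[OF assms(1,2) P] cfc_approx[OF assms(1,3) Q]] assms
    by (intro cfc_eqI[OF _ _ poly_approx_add[OF P Q]]) (auto simp: pev_add intro!: continuous_intros)
qed

lemma cfc_mult: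
  assumes "selfadjoint_le R a" "continuous_on {-R..R} g" "continuous_on {-R..R} h"
  shows "cfc R a (\<lambda>t. g t * h t) = cfc R a g \<otimes> cfc R a h"
proof -
  obtain P where P: "poly_approx R P g" using assms(2) by (rule poly_approx_exists)
  obtain Q where Q: "poly_approx R Q h" using assms(3) by (rule poly_approx_exists)
  show ?thesis
    using approx_mult[OF cfc_approx[OF assms(1,2) P] cfc_approx[OF assms(1,3) Q]] assms
    by (intro cfc_eqI[OF _ _ poly_approx_mult[OF P assms(2) Q assms(3)]]) (auto simp: pev_mult intro!: continuous_intros)
qed

lemma cfc_cong:
  assumes "selfadjoint_le R a" "continuous_on {-R..R} g" "\<And>t. \<bar>t\<bar> \<le> R \<Longrightarrow> g t = h t"
  shows "cfc R a g = cfc R a h"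
proof -
  obtain P where P: "poly_approx R P g" using assms(2) by (rule poly_approx_exists)
  have "continuous_on {-R..R} h"
    using assms(2) by (rule continuous_on_eq) (use assms(3) in \<open>auto simp: abs_le_iff\<close>)
  from cfc_eqI[OF assms(1) this poly_approx_cong[OF P assms(3)] cfc_approx[OF assms(1,2) P]]
  show ?thesis by simp
qed

lemma nrm_cfc_pev_le:
  assumes a: "selfadjoint_le R a" and g: "continuous_on {-R..R} g"
    and le: "\<And>t. \<bar>t\<bar> \<le> R \<Longrightarrow> cmod (poly p (of_real t) - of_real (g t)) \<le> M"
  shows "nrm C (cfc R a g \<ominus> pev a p) \<le> M"
proof (rule field_le_epsilon)
  fix e :: real assume e: "e > 0"
  obtain P where P: "poly_approx R P g" using g by (rule poly_approx_exists)
  obtain K where K: "\<And>n t. \<bar>t\<bar> \<le> R \<Longrightarrow> cmod (poly (P n) (of_real t) - of_real (g t)) \<le> K / real (Suc n)"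
    using P by (rule poly_approxE) blast
  have ev: "\<forall>\<^sub>F n in sequentially. K / real (Suc n) < e"
    using tendsto_over_Suc[of K] e by (intro order_tendstoD) auto
  show "nrm C (cfc R a g \<ominus> pev a p) \<le> M + e"
  proof (rule approx_nrm_le)
    show "approx sequentially (\<lambda>n. pev a (P n) \<ominus> pev a p) (\<lambda>_. cfc R a g \<ominus> pev a p)"
      by (rule approx_diff[OF cfc_approx[OF a g P] approx_refl[OF bseq_const[OF pev_closed[OF selfadjoint_leD(1)[OF a]]]]])
    show "\<forall>\<^sub>F n in sequentially. nrm C (pev a (P n) \<ominus> pev a p) \<le> M + e"
      using ev
    proof eventually_elim
      case (elim n)
      show ?case
      proof (rule nrm_pev_diff_le[OF a])
        fix t assume t: "\<bar>t\<bar> \<le> R"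
        have "cmod (poly (P n) (of_real t) - poly p (of_real t)) \<le> K / real (Suc n) + M"
          using norm_triangle_le_diff[OF add_mono[OF K[OF t, of n] le[OF t]]] by simp
        then show "cmod (poly (P n) (of_real t) - poly p (of_real t)) \<le> M + e"
          using elim by linarith
      qed
    qed
  qed auto
qed

lemma nrm_cfc_le:
  assumes a: "selfadjoint_le R a" and g: "continuous_on {-R..R} g"
    and le: "\<And>t. \<bar>t\<bar> \<le> R \<Longrightarrow> \<bar>g t\<bar> \<le> M"
  shows "nrm C (cfc R a g) \<le> M"
proof -
  have "cfc R a g \<ominus> pev a 0 = cfc R a g" using a g by (simp add: a_minus_def)
  then show ?thesis using nrm_cfc_pev_le[OF a g, of 0 M] le by simp
qed

text \<open>The relation passes from \<open>a\<close> and \<open>b\<close> to polynomials and then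
  to limits. It is applied in \<open>pos_star_mult_self\<close> to
  \<open>star C w \<otimes> w\<close> and \<open>w \<otimes> star C w\<close>, which
  \<open>w\<close> intertwines.\<close>

lemma cfc_intertwine:
  assumes a: "selfadjoint_le R a" and b: "selfadjoint_le R b" and w: "w \<in> carrier C" "w \<otimes> a = b \<otimes> w"
    and g: "continuous_on {-R..R} g"
  shows "w \<otimes> cfc R a g = cfc R b g \<otimes> w"
proof -
  have eq: "w \<otimes> pev a p = pev b p \<otimes> w" for p
  proof (induction p)
    case (pCons c p)
    have "w \<otimes> (a \<otimes> pev a p) = (b \<otimes> w) \<otimes> pev a p"
      using a b w by (simp add: m_assoc[symmetric])
    also have "\<dots> = b \<otimes> (pev b p \<otimes> w)" using a b w pCons by (simp add: m_assoc)
    finally show ?case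
      using a b w by (simp add: r_distr l_distr smult_mult_left smult_mult_right m_assoc)
  qed (use w in auto)
  obtain P where P: "poly_approx R P g" using g by (rule poly_approx_exists)
  have "approx sequentially (\<lambda>_. w \<otimes> cfc R a g) (\<lambda>n. w \<otimes> pev a (P n))"
    by (intro approx_sym[OF approx_mult] cfc_approx a g P approx_refl bseq_const w)
  also have "(\<lambda>n. w \<otimes> pev a (P n)) = (\<lambda>n. pev b (P n) \<otimes> w)" by (simp add: eq)
  also have "approx sequentially (\<lambda>n. pev b (P n) \<otimes> w) (\<lambda>_. cfc R b g \<otimes> w)"
    by (intro approx_mult cfc_approx b g P approx_refl bseq_const w)
  finally show ?thesis by (rule approx_const_eq) simp
qed

text \<open>Composition with a polynomial that is real on the interval. It plays the part of
  spectral mapping: if an element is a polynomial in \<open>s\<close>, only the values of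
  \<open>g\<close> on the range of that polynomial matter.\<close>

lemma cfc_pev:
  assumes s: "selfadjoint_le S s" and r: "\<And>t. \<bar>t\<bar> \<le> S \<Longrightarrow> poly r (of_real t) = of_real (\<rho> t)"
    and \<rho>: "\<And>t. \<bar>t\<bar> \<le> S \<Longrightarrow> \<bar>\<rho> t\<bar> \<le> K" and g: "continuous_on {-K..K} g"
  shows "selfadjoint_le K (pev s r)" "cfc K (pev s r) g = cfc S s (\<lambda>t. g (\<rho> t))"
proof -
  have c\<rho>: "continuous_on {-S..S} \<rho>"
  proof -
    have "continuous_on {-S..S} (\<lambda>t. Re (poly r (of_real t)))" by (intro continuous_intros)
    then show ?thesis by (rule continuous_on_eq) (use r in \<open>auto simp: abs_le_iff\<close>)
  qed
  have eq: "cfc S s \<rho> = pev s r" using s r by (rule cfc_poly)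
  show sa: "selfadjoint_le K (pev s r)"
    unfolding selfadjoint_le_def eq[symmetric]
    by (intro conjI cfc_closed[OF s c\<rho>] cfc_star[OF s c\<rho>] nrm_cfc_le[OF s c\<rho> \<rho>])
  have cg: "continuous_on {-S..S} (\<lambda>t. g (\<rho> t))"
  proof (rule continuous_on_compose2[OF g c\<rho>], rule image_subsetI)
    fix t assume "t \<in> {-S..S}"
    then have "\<bar>\<rho> t\<bar> \<le> K" by (intro \<rho>) auto
    then show "\<rho> t \<in> {-K..K}" by auto
  qed
  obtain P where P: "poly_approx K P g" using g by (rule poly_approx_exists)
  have "poly_approx S (\<lambda>n. pcompose (P n) r) (\<lambda>t. g (\<rho> t))"
  proof -
    obtain L where L: "\<And>n t. \<bar>t\<bar> \<le> K \<Longrightarrow> cmod (poly (P n) (of_real t) - of_real (g t)) \<le> L / real (Suc n)"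
      using P by (rule poly_approxE) blast
    have "cmod (poly (pcompose (P n) r) (of_real t) - of_real (g (\<rho> t))) \<le> L / real (Suc n)"
      if t: "\<bar>t\<bar> \<le> S" for n t
      using L[OF \<rho>[OF t], of n] by (simp only: poly_pcompose r[OF t])
    then show ?thesis unfolding poly_approx_def by blast
  qed
  from cfc_approx[OF s cg this] have "approx sequentially (\<lambda>n. pev (pev s r) (P n)) (\<lambda>_. cfc S s (\<lambda>t. g (\<rho> t)))"
    using s by (simp add: pev_pcompose)
  then show "cfc K (pev s r) g = cfc S s (\<lambda>t. g (\<rho> t))"
    by (rule cfc_eqI[OF sa g P])
qed

end

section \<open>Positive elements\<close>

context cstar_algebra
begin

lemma add_diff_cancel [simp]:
  "\<lbrakk>x \<in> carrier C; y \<in> carrier C\<rbrakk> \<Longrightarrow> (x \<oplus> y) \<ominus> y = x"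
  by (simp add: a_minus_def a_assoc r_neg)

lemma diff_add_cancel [simp]:
  "\<lbrakk>x \<in> carrier C; y \<in> carrier C\<rbrakk> \<Longrightarrow> (x \<ominus> y) \<oplus> y = x"
  by (simp add: a_minus_def a_assoc l_neg)

lemma diff_diff_self [simp]:
  "\<lbrakk>x \<in> carrier C; y \<in> carrier C\<rbrakk> \<Longrightarrow> x \<ominus> (x \<ominus> y) = y"
  by (simp add: a_minus_def minus_add a_assoc[symmetric] r_neg)

lemma selfadjoint_leI: "a \<in> carrier C \<Longrightarrow> star C a = a \<Longrightarrow> nrm C a \<le> R \<Longrightarrow> selfadjoint_le R a"
  by (simp only: selfadjoint_le_def simp_thms)

lemma nrm_selfadjoint_square:
  assumes "s \<in> carrier C" "star C s = s" shows "nrm C (s \<otimes> s) = (nrm C s)\<^sup>2"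
  using cstar_identity[of s] assms by simp

text \<open>Squares of selfadjoint elements are the form on which the functional calculus acts
  directly; \<open>positives_eq_pos\<close> identifies them with \<open>positives\<close>.\<close>

definition pos :: "'a \<Rightarrow> bool" where
  "pos a \<longleftrightarrow> (\<exists>s\<in>carrier C. star C s = s \<and> a = s \<otimes> s)"

lemma posI: "s \<in> carrier C \<Longrightarrow> star C s = s \<Longrightarrow> pos (s \<otimes> s)"
  by (auto simp: pos_def)

lemma posE:
  assumes "pos a" obtains s where "s \<in> carrier C" "star C s = s" "a = s \<otimes> s" "(nrm C s)\<^sup>2 = nrm C a"
  using assms nrm_selfadjoint_square by (auto simp: pos_def)

lemma pos_closed [simp]: "pos a \<Longrightarrow> a \<in> carrier C"
  by (auto simp: pos_def)

lemma pos_star [simp]: "pos a \<Longrightarrow> star C a = a"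
  by (auto simp: pos_def star_mult)

text \<open>With a = s^2 the element is the value at \<open>s\<close> of t - x^2, which lies between
  0 and t as long as |x| is at most sqrt t.\<close>

lemma pos_imp_norm_le:
  assumes "pos a" "nrm C a \<le> t" shows "nrm C (of_real t \<odot> \<one> \<ominus> a) \<le> t"
proof -
  obtain s where s: "s \<in> carrier C" "star C s = s" "a = s \<otimes> s" "(nrm C s)\<^sup>2 = nrm C a"
    using assms(1) by (rule posE)
  have t: "0 \<le> t" using assms nrm_nonneg[of a] pos_closed by fastforce
  have "nrm C s \<le> sqrt t" using s(4) assms(2) nrm_nonneg[OF s(1)] by (metis real_le_rsqrt)
  moreover have "of_real t \<odot> \<one> \<ominus> a = pev s [:of_real t, 0, -1:]"
    using s by (simp add: to_smult)
  moreover have "cmod (poly [:of_real t, 0, -1:] (of_real x)) \<le> t" if "\<bar>x\<bar> \<le> sqrt t" for x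
  proof -
    have "x\<^sup>2 \<le> t" using that t by (metis real_sqrt_le_iff real_sqrt_abs)
    moreover have "poly [:of_real t, 0, -1:] (of_real x) = complex_of_real (t - x\<^sup>2)"
      by (simp add: power2_eq_square)
    ultimately show ?thesis by (simp only: norm_of_real) simp
  qed
  ultimately show ?thesis using nrm_pev_le'[OF s(1,2)] by presburger
qed

text \<open>Here a = t - b with \<open>nrm C b \<le> t\<close>, and t - x has a continuous root on
  [-t, t]. Together with \<open>pos_imp_norm_le\<close> this turns positivity into a norm condition,
  so that sums of positive elements are governed by the triangle inequality.\<close>

lemma norm_le_imp_pos:
  assumes a: "a \<in> carrier C" "star C a = a" and le: "nrm C (of_real t \<odot> \<one> \<ominus> a) \<le> t"
  shows "pos a"
proof -
  define b where "b = of_real t \<odot> \<one> \<ominus> a"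
  have b: "selfadjoint_le t b"
    using a le by (intro selfadjoint_leI) (simp_all add: b_def star_diff star_smult)
  let ?g = "\<lambda>x. sqrt (max 0 (t - x))"
  have g: "continuous_on {-t..t} ?g" by (intro continuous_intros)
  have "cfc t b ?g \<otimes> cfc t b ?g = cfc t b (\<lambda>x. ?g x * ?g x)"
    by (rule cfc_mult[symmetric]) (fact b g)+
  also have "\<dots> = pev b [:of_real t, -1:]"
    by (rule cfc_poly[OF b]) (auto simp: abs_le_iff)
  also have "\<dots> = of_real t \<odot> \<one> \<ominus> b"
    using selfadjoint_leD(1)[OF b] by (simp add: to_smult)
  also have "\<dots> = a"
    using a by (simp add: b_def)
  finally show ?thesis
    using posI[OF cfc_closed[OF b g] cfc_star[OF b g]] by simp
qed

lemma pos_add: assumes "pos a" "pos b" shows "pos (a \<oplus> b)"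
proof (rule norm_le_imp_pos)
  let ?t = "nrm C a" and ?u = "nrm C b"
  have c: "a \<in> carrier C" "b \<in> carrier C" using assms by auto
  have "of_real (?t + ?u) \<odot> \<one> \<ominus> (a \<oplus> b) = (of_real ?t \<odot> \<one> \<ominus> a) \<oplus> (of_real ?u \<odot> \<one> \<ominus> b)"
    using c by (simp add: to_smult smult_add_left a_ac)
  then show "nrm C (of_real (?t + ?u) \<odot> \<one> \<ominus> (a \<oplus> b)) \<le> ?t + ?u"
    using nrm_triangle[of "of_real ?t \<odot> \<one> \<ominus> a" "of_real ?u \<odot> \<one> \<ominus> b"] c
      pos_imp_norm_le[OF assms(1) order.refl] pos_imp_norm_le[OF assms(2) order.refl] by simp
qed (use assms in \<open>auto simp: star_add\<close>)

lemma pos_smult: assumes "pos a" "0 \<le> c" shows "pos (of_real c \<odot> a)"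
proof -
  obtain s where s: "s \<in> carrier C" "star C s = s" "a = s \<otimes> s" using assms(1) by (rule posE)
  have "pos (of_real (sqrt c) \<odot> s \<otimes> (of_real (sqrt c) \<odot> s))"
    using s by (intro posI) (auto simp: star_smult)
  then show ?thesis
    using s assms(2) by (simp add: smult_mult_left smult_mult_right flip: of_real_mult)
qed

lemma pos_norm_minus:
  assumes "a \<in> carrier C" "star C a = a" "nrm C a \<le> t"
  shows "pos (of_real t \<odot> \<one> \<ominus> a)" "pos (of_real t \<odot> \<one> \<oplus> a)"
proof -
  have *: "pos (of_real t \<odot> \<one> \<ominus> a)" if "a \<in> carrier C" "star C a = a" "nrm C a \<le> t" for a
    using that by (intro norm_le_imp_pos[of _ t]) (auto simp: star_diff star_smult)
  show "pos (of_real t \<odot> \<one> \<ominus> a)" by (rule *) fact+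
  have "pos (of_real t \<odot> \<one> \<ominus> (-1) \<odot> a)" using assms by (intro *) (auto simp: star_smult nrm_smult)
  then show "pos (of_real t \<odot> \<one> \<oplus> a)" using assms by (simp add: to_smult)
qed

text \<open>This replaces the statement that the spectrum of \<open>a\<close> lies above
  \<open>l\<close>. Writing a = l + s^2 makes \<open>a\<close> a polynomial in \<open>s\<close> with
  values at least \<open>l\<close>, and the bound by \<open>K\<close> keeps these values inside the
  interval of the calculus.\<close>

lemma cfc_cong_lower:
  assumes a: "selfadjoint_le K a" and p: "pos (a \<ominus> of_real l \<odot> \<one>)"
    and K: "\<bar>l\<bar> + nrm C (a \<ominus> of_real l \<odot> \<one>) \<le> K"
    and g: "continuous_on {-K..K} g" "continuous_on {-K..K} h" "\<And>t. l \<le> t \<Longrightarrow> t \<le> K \<Longrightarrow> g t = h t"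
  shows "cfc K a g = cfc K a h"
proof -
  have aC: "a \<in> carrier C" using a by simp
  obtain s where s: "s \<in> carrier C" "star C s = s" "a \<ominus> of_real l \<odot> \<one> = s \<otimes> s"
      "(nrm C s)\<^sup>2 = nrm C (a \<ominus> of_real l \<odot> \<one>)"
    using p by (rule posE)
  define S where "S = nrm C s"
  have sS: "selfadjoint_le S s" using s by (intro selfadjoint_leI) (simp_all add: S_def)
  have "a = (a \<ominus> of_real l \<odot> \<one>) \<oplus> of_real l \<odot> \<one>" using aC by simp
  also have "\<dots> = pev s [:of_real l, 0, 1:]" using s by (simp add: a_comm)
  finally have a_eq: "a = pev s [:of_real l, 0, 1:]" .
  have sq: "t\<^sup>2 \<le> S\<^sup>2" if "\<bar>t\<bar> \<le> S" for t
    using that by (simp add: abs_le_square_iff[symmetric])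
  have r: "poly [:of_real l, 0, 1:] (of_real t) = complex_of_real (l + t\<^sup>2)" for t
    by (simp add: power2_eq_square)
  have K': "\<bar>l + t\<^sup>2\<bar> \<le> K" if "\<bar>t\<bar> \<le> S" for t
    using sq[OF that] K s(4) zero_le_power2[of t] by (simp only: S_def[symmetric])
  have 1: "cfc K a g = cfc S s (\<lambda>t. g (l + t\<^sup>2))"
    unfolding a_eq by (rule cfc_pev(2)[OF sS r K' g(1)])
  have 2: "cfc K a h = cfc S s (\<lambda>t. h (l + t\<^sup>2))"
    unfolding a_eq by (rule cfc_pev(2)[OF sS r K' g(2)])
  have "cfc S s (\<lambda>t. g (l + t\<^sup>2)) = cfc S s (\<lambda>t. h (l + t\<^sup>2))"
  proof (rule cfc_cong[OF sS])
    show "continuous_on {-S..S} (\<lambda>t. g (l + t\<^sup>2))"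
    proof (rule continuous_on_compose2[OF g(1)], intro continuous_intros, rule image_subsetI)
      fix t assume "t \<in> {-S..S}"
      then have "\<bar>l + t\<^sup>2\<bar> \<le> K" by (intro K') auto
      then show "l + t\<^sup>2 \<in> {-K..K}" by auto
    qed
    show "g (l + t\<^sup>2) = h (l + t\<^sup>2)" if "\<bar>t\<bar> \<le> S" for t
      using K'[OF that] by (intro g(3)) auto
  qed
  with 1 2 show ?thesis by simp
qed

lemma cfc_cong_pos:
  assumes a: "pos a" "nrm C a \<le> K"
    and g: "continuous_on {-K..K} g" "continuous_on {-K..K} h" "\<And>t. 0 \<le> t \<Longrightarrow> t \<le> K \<Longrightarrow> g t = h t"
  shows "cfc K a g = cfc K a h"
proof (rule cfc_cong_lower[where l = 0])
  have "a \<ominus> of_real 0 \<odot> \<one> = a" using a by (simp add: a_minus_def)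
  then show "pos (a \<ominus> of_real 0 \<odot> \<one>)" "\<bar>0\<bar> + nrm C (a \<ominus> of_real 0 \<odot> \<one>) \<le> K"
    using a by auto
  show "selfadjoint_le K a" using a by (intro selfadjoint_leI) (simp_all)
qed (use g in auto)

lemma cfc_uminus:
  assumes a: "selfadjoint_le K a" and g: "continuous_on {-K..K} g"
  shows "selfadjoint_le K ((-1) \<odot> a)" "cfc K ((-1) \<odot> a) g = cfc K a (\<lambda>t. g (-t))"
proof -
  have r: "poly [:0, -1:] (of_real t) = complex_of_real (- t)" for t by simp
  have "pev a [:0, -1:] = (-1) \<odot> a" using a by (simp add: smult_mult_right)
  then show "selfadjoint_le K ((-1) \<odot> a)" "cfc K ((-1) \<odot> a) g = cfc K a (\<lambda>t. g (-t))"
    using cfc_pev[OF a r _ g] by simp_all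
qed

text \<open>The hypotheses say that \<open>a\<close> lies between -t and t. Truncating the identity
  function at these two levels leaves \<open>a\<close> unchanged, and the truncated function is
  bounded by \<open>t\<close>.\<close>

lemma nrm_le_of_pos:
  assumes a: "a \<in> carrier C" "0 \<le> t" and p: "pos (of_real t \<odot> \<one> \<ominus> a)" "pos (of_real t \<odot> \<one> \<oplus> a)"
  shows "nrm C a \<le> t"
proof -
  have sa: "star C a = a"
  proof -
    have "a = (of_real t \<odot> \<one> \<oplus> a) \<ominus> of_real t \<odot> \<one>" using a by (simp add: a_comm)
    also have "star C \<dots> = \<dots>" using pos_star[OF p(2)] a by (simp only: star_diff pos_closed[OF p(2)] smult_closed' one_closed) (simp add: star_smult)
    finally show ?thesis .
  qed
  define K where "K = t + nrm C (of_real t \<odot> \<one> \<ominus> a) + nrm C (of_real t \<odot> \<one> \<oplus> a) + nrm C a"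
  have nn: "0 \<le> nrm C (of_real t \<odot> \<one> \<ominus> a)" "0 \<le> nrm C (of_real t \<odot> \<one> \<oplus> a)" "0 \<le> nrm C a"
    using a by (auto intro!: nrm_nonneg)
  have aK: "selfadjoint_le K a" using a sa nn by (intro selfadjoint_leI) (simp_all add: K_def)
  have m: "selfadjoint_le K ((-1) \<odot> a)"
    using a sa nn by (intro selfadjoint_leI) (simp_all add: star_smult nrm_smult K_def)
  have e1: "a \<ominus> of_real (-t) \<odot> \<one> = of_real t \<odot> \<one> \<oplus> a"
    using a by (simp add: to_smult a_comm)
  have e2: "(-1) \<odot> a \<ominus> of_real (-t) \<odot> \<one> = of_real t \<odot> \<one> \<ominus> a"
    using a by (simp add: to_smult a_comm)
  \<comment> \<open>A lower bound for an element allows truncation from below only; the upper bound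
    of \<open>a\<close> is used as a lower bound of its negative.\<close>
  have "a = cfc K a (\<lambda>x. x)" using cfc_id[OF aK] by simp
  also have "\<dots> = cfc K a (\<lambda>x. max (-t) x)"
    by (rule cfc_cong_lower[OF aK, of "-t"])
       (use a p nn in \<open>auto simp: e1[simplified] K_def intro!: continuous_intros\<close>)
  also have "\<dots> = cfc K ((-1) \<odot> a) (\<lambda>x. max (-t) (-x))"
    by (subst cfc_uminus(2)[OF aK]) (auto intro!: continuous_intros)
  also have "\<dots> = cfc K ((-1) \<odot> a) (\<lambda>x. max (-t) (min t (-x)))"
    by (rule cfc_cong_lower[OF m, of "-t"])
       (use a p nn in \<open>auto simp: e2[simplified] K_def intro!: continuous_intros\<close>)
  finally have "nrm C a = nrm C (cfc K ((-1) \<odot> a) (\<lambda>x. max (-t) (min t (-x))))" by simp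
  also have "\<dots> \<le> t"
    by (rule nrm_cfc_le[OF m]) (use a in \<open>auto intro!: continuous_intros\<close>)
  finally show ?thesis .
qed

text \<open>With t the norm of \<open>b\<close>, t - a = (t - b) + (b - a) and t + a are
  positive.\<close>

lemma nrm_mono:
  assumes a: "pos a" and b: "b \<in> carrier C" "pos (b \<ominus> a)" shows "nrm C a \<le> nrm C b"
proof (rule nrm_le_of_pos)
  let ?t = "of_real (nrm C b) \<odot> \<one>"
  have aC: "a \<in> carrier C" using a by simp
  then show "a \<in> carrier C" .
  show "0 \<le> nrm C b" using b nrm_nonneg by simp
  have "pos ?t"
    using pos_smult[OF posI[of "\<one>"], of "nrm C b"] nrm_nonneg[OF b(1)] by simp
  then show "pos (?t \<oplus> a)" by (rule pos_add[OF _ a])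
  have "star C b = b"
  proof -
    have "b = (b \<ominus> a) \<oplus> a" using aC b by simp
    also have "star C \<dots> = \<dots>" using pos_star[OF b(2)] pos_closed[OF b(2)] a aC by (simp only: star_add) simp
    finally show ?thesis .
  qed
  then have "pos (?t \<ominus> b)" using b by (intro pos_norm_minus) auto
  then have "pos ((?t \<ominus> b) \<oplus> (b \<ominus> a))" using b by (intro pos_add) auto
  then show "pos (?t \<ominus> a)" using b aC by (simp add: diff_add_diff)
qed

text \<open>Let \<open>q\<close> be the root of the negative part of \<open>a = y\<^sup>* y\<close> and \<open>w = y q\<close>. Then \<open>w\<^sup>* w \<le> 0\<close>, hence
  \<open>w w\<^sup>* = (w w\<^sup>* + w\<^sup>* w) - w\<^sup>* w \<ge> 0\<close>, and intertwining the positive parts of \<open>w\<^sup>* w\<close> and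
  \<open>w w\<^sup>*\<close> by \<open>w\<close> gives \<open>w = 0\<close>.\<close>

lemma pos_star_mult_self: assumes y: "y \<in> carrier C" shows "pos (star C y \<otimes> y)"
proof -
  define a where "a = star C y \<otimes> y"
  define K where "K = nrm C a"
  have a: "selfadjoint_le K a" using y by (intro selfadjoint_leI) (simp_all add: a_def K_def star_mult)
  have aC: "a \<in> carrier C" using a by simp
  define q where "q = cfc K a (\<lambda>t. sqrt (max 0 (-t)))"
  define m where "m = cfc K a (\<lambda>t. max 0 (-t))"
  have cq: "continuous_on {-K..K} (\<lambda>t. sqrt (max 0 (-t)))" and cm: "continuous_on {-K..K} (\<lambda>t. max 0 (-t))"
    and cid: "continuous_on {-K..K} (\<lambda>t. t)"
    by (intro continuous_intros)+
  have q: "q \<in> carrier C" "star C q = q" using a cq by (simp_all add: q_def)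
  have m: "m \<in> carrier C" "star C m = m" using a cm by (simp_all add: m_def)
  define w where "w = y \<otimes> q"
  have w: "w \<in> carrier C" using y q by (simp add: w_def)
  have ww: "star C w \<otimes> w = (-1) \<odot> (m \<otimes> m)"
  proof -
    have "star C w \<otimes> w = (q \<otimes> a) \<otimes> q" using y q by (simp add: w_def star_mult a_def m_assoc)
    also have "q \<otimes> a = cfc K a (\<lambda>t. sqrt (max 0 (-t)) * t)"
      using cfc_mult[OF a cq cid] cfc_id[OF a] by (simp add: q_def)
    also have "\<dots> \<otimes> q = cfc K a (\<lambda>t. sqrt (max 0 (-t)) * t * sqrt (max 0 (-t)))"
      unfolding q_def by (rule cfc_mult[symmetric, OF a _ cq]) (intro continuous_intros)
    also have "\<dots> = cfc K a (\<lambda>t. - max 0 (-t) * max 0 (-t))"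
    proof (rule cfc_cong[OF a])
      show "sqrt (max 0 (-t)) * t * sqrt (max 0 (-t)) = - max 0 (-t) * max 0 (-t)" for t :: real
      proof -
        have "sqrt (max 0 (-t)) * t * sqrt (max 0 (-t)) = (sqrt (max 0 (-t)) * sqrt (max 0 (-t))) * t"
          by (simp only: mult_ac)
        also have "\<dots> = max 0 (-t) * t" by (subst real_sqrt_mult_self) simp
        finally show ?thesis by (cases "t \<le> 0") auto
      qed
    qed (intro continuous_intros)
    also have "\<dots> = cfc K a (\<lambda>t. - max 0 (-t)) \<otimes> m"
      unfolding m_def by (rule cfc_mult[OF a _ cm]) (intro continuous_intros)
    also have "cfc K a (\<lambda>t. - max 0 (-t)) = (-1) \<odot> m"
    proof -
      have "cfc K a (\<lambda>t. -1 * max 0 (-t)) = cfc K a (\<lambda>t. -1) \<otimes> m"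
        unfolding m_def by (rule cfc_mult[OF a _ cm]) (intro continuous_intros)
      also have "cfc K a (\<lambda>t. -1) = pev a [:-1:]" by (rule cfc_poly[OF a]) simp
      also have "\<dots> = (-1) \<odot> \<one>" using aC by simp
      finally show ?thesis using m by (simp add: smult_mult_left)
    qed
    finally show ?thesis using m by (simp add: smult_mult_left)
  qed
  define c where "c = w \<otimes> star C w"
  have cC: "c \<in> carrier C" using w by (simp add: c_def)
  have pc: "pos c"
  proof -
    \<comment> \<open>\<open>h\<close> and \<open>k\<close> are the real and imaginary parts of
      \<open>w\<close>, scaled by sqrt 2, so that the sum of their squares is exactly
      \<open>w \<otimes> star C w \<oplus> star C w \<otimes> w\<close>.\<close>
    define r where "r = complex_of_real (sqrt (1/2))"
    have rr: "r * r = 1/2" unfolding r_def of_real_mult[symmetric] by simp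
    define h where "h = r \<odot> (w \<oplus> star C w)"
    define k where "k = (- \<i> * r) \<odot> (w \<ominus> star C w)"
    have hk: "h \<in> carrier C" "star C h = h" "k \<in> carrier C" "star C k = k"
    proof -
      show "h \<in> carrier C" "k \<in> carrier C" using w by (auto simp: h_def k_def)
      show "star C h = h" using w by (simp add: h_def star_smult star_add r_def a_comm)
      show "star C k = k" using w by (simp add: k_def star_smult star_add r_def a_comm to_smult)
    qed
    have sum: "(1/2) \<odot> x \<oplus> (1/2) \<odot> x = x" "(1/2) \<odot> x \<oplus> ((1/2) \<odot> x \<oplus> z) = x \<oplus> z"
      "(-1/2) \<odot> x \<oplus> (1/2) \<odot> x = \<zero>" "(-1/2) \<odot> x \<oplus> ((1/2) \<odot> x \<oplus> z) = z"
      if "x \<in> carrier C" "z \<in> carrier C" for x z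
    proof -
      show 1: "(1/2) \<odot> x \<oplus> (1/2) \<odot> x = x"
        using that smult_add_left[of x "1/2" "1/2"] by simp
      show 2: "(-1/2) \<odot> x \<oplus> (1/2) \<odot> x = \<zero>"
        using that smult_add_left[of x "-1/2" "1/2"] by simp
      show "(1/2) \<odot> x \<oplus> ((1/2) \<odot> x \<oplus> z) = x \<oplus> z"
        using that 1 by (simp add: a_assoc[symmetric])
      show "(-1/2) \<odot> x \<oplus> ((1/2) \<odot> x \<oplus> z) = z"
        using that 2 by (simp add: a_assoc[symmetric])
    qed
    let ?W = "w \<otimes> w" and ?V = "star C w \<otimes> star C w" and ?d = "star C w \<otimes> w"
    have h2: "h \<otimes> h = ((1/2) \<odot> ?W \<oplus> (1/2) \<odot> ?V) \<oplus> ((1/2) \<odot> c \<oplus> (1/2) \<odot> ?d)"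
      using w by (simp add: h_def c_def smult_mult_left smult_mult_right smult_add_right l_distr r_distr rr a_ac)
    have k2: "k \<otimes> k = ((-1/2) \<odot> ?W \<oplus> (-1/2) \<odot> ?V) \<oplus> ((1/2) \<odot> c \<oplus> (1/2) \<odot> ?d)"
      using w by (simp add: k_def c_def to_smult l_distr r_distr a_ac mult_ac rr)
    have "h \<otimes> h \<oplus> k \<otimes> k =
      ((-1/2) \<odot> ?W \<oplus> ((1/2) \<odot> ?W \<oplus> ((-1/2) \<odot> ?V \<oplus> (1/2) \<odot> ?V)))
      \<oplus> (((1/2) \<odot> c \<oplus> (1/2) \<odot> c) \<oplus> ((1/2) \<odot> ?d \<oplus> (1/2) \<odot> ?d))"
      unfolding h2 k2 using w cC by (simp add: a_ac)
    also have "\<dots> = c \<oplus> ?d"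
      using w cC by (simp only: sum m_closed star_closed zero_closed smult_closed' a_closed l_zero)
    finally have "c \<oplus> ?d = h \<otimes> h \<oplus> k \<otimes> k" ..
    then have "c \<oplus> ?d \<oplus> m \<otimes> m = h \<otimes> h \<oplus> k \<otimes> k \<oplus> m \<otimes> m" by simp
    also have "c \<oplus> ?d \<oplus> m \<otimes> m = c"
    proof -
      have "(-1) \<odot> (m \<otimes> m) \<oplus> m \<otimes> m = \<zero>"
        using m by (simp add: minus_smult[symmetric] l_neg)
      then show ?thesis unfolding ww using cC m by (simp add: a_assoc)
    qed
    finally show ?thesis
      using hk m by (auto intro!: pos_add posI)
  qed
  have "w = \<zero>"
  proof -
    define d where "d = star C w \<otimes> w"
    define L where "L = nrm C c + nrm C d + nrm C (m \<otimes> m)"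
    have dC: "d \<in> carrier C" using w by (simp add: d_def)
    have nn: "0 \<le> nrm C c" "0 \<le> nrm C d" "0 \<le> nrm C (m \<otimes> m)" using cC dC m by (auto intro: nrm_nonneg)
    have cL: "selfadjoint_le L c" using pc nn by (intro selfadjoint_leI) (simp_all add: L_def)
    have dL: "selfadjoint_le L d" using dC w nn by (intro selfadjoint_leI) (simp_all add: L_def d_def star_mult)
    have pm: "pos (m \<otimes> m)" "nrm C (m \<otimes> m) \<le> L" using m nn by (auto simp: L_def intro: posI)
    have mL: "selfadjoint_le L (m \<otimes> m)" using pm by (intro selfadjoint_leI) (simp_all)
    have cg: "continuous_on {-L..L} (\<lambda>t. max 0 t)" by (intro continuous_intros)
    have "cfc L c (\<lambda>t. max 0 t) = cfc L c (\<lambda>t. t)"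
      using pc nn by (intro cfc_cong_pos) (auto simp: L_def intro!: continuous_intros)
    then have gc: "cfc L c (\<lambda>t. max 0 t) = c" using cfc_id[OF cL] by simp
    have "d = (-1) \<odot> (m \<otimes> m)" using ww by (simp add: d_def)
    then have "cfc L d (\<lambda>t. max 0 t) = cfc L (m \<otimes> m) (\<lambda>t. max 0 (-t))"
      using cfc_uminus(2)[OF mL cg] by simp
    also have "\<dots> = cfc L (m \<otimes> m) (\<lambda>t. 0)"
      using pm by (intro cfc_cong_pos) (auto intro!: continuous_intros)
    also have "\<dots> = pev (m \<otimes> m) 0" by (rule cfc_poly[OF mL]) simp
    finally have gd: "cfc L d (\<lambda>t. max 0 t) = \<zero>" by simp
    have "w \<otimes> cfc L d (\<lambda>t. max 0 t) = cfc L c (\<lambda>t. max 0 t) \<otimes> w"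
      using w by (intro cfc_intertwine dL cL cg) (auto simp: c_def d_def m_assoc)
    then have cw: "c \<otimes> w = \<zero>" using gc gd w by simp
    have "d \<otimes> d = star C w \<otimes> (c \<otimes> w)" using w by (simp add: d_def c_def m_assoc)
    then have "d \<otimes> d = \<zero>" using cw w by simp
    then have "(nrm C d)\<^sup>2 = 0" using nrm_selfadjoint_square[of d] dC selfadjoint_leD(2)[OF dL] by simp
    then have "(nrm C w)\<^sup>2 = 0" using cstar_identity[OF w] by (simp add: d_def)
    then show ?thesis using w nrm_eq_0_iff by simp
  qed
  \<comment> \<open>From \<open>w = \<zero>\<close> the negative part \<open>m\<close> vanishes, and
    \<open>a\<close> is its own positive part.\<close>
  then have m0: "(-1) \<odot> (m \<otimes> m) = \<zero>" using ww by simp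
  have "m \<otimes> m = (-1) \<odot> ((-1) \<odot> (m \<otimes> m))" using m by simp
  then have "m \<otimes> m = \<zero>" by (simp only: m0 smult_zero_right)
  then have "m = \<zero>" using nrm_selfadjoint_square[OF m] nrm_eq_0_iff[OF m(1)] by simp
  let ?p = "\<lambda>t. sqrt (max 0 t)"
  have cp: "continuous_on {-K..K} ?p" by (intro continuous_intros)
  have "cfc K a (\<lambda>t. -1 * max 0 (-t)) = cfc K a (\<lambda>t. -1) \<otimes> m"
    unfolding m_def by (rule cfc_mult[OF a _ cm]) (intro continuous_intros)
  then have neg: "cfc K a (\<lambda>t. - max 0 (-t)) = \<zero>"
    using \<open>m = \<zero>\<close> cfc_closed[OF a continuous_on_const] by simp
  have "a = cfc K a (\<lambda>t. t)" using cfc_id[OF a] by simp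
  also have "\<dots> = cfc K a (\<lambda>t. ?p t * ?p t + - max 0 (- t))"
    by (rule cfc_cong[OF a cid]) (auto simp: max_def)
  also have "\<dots> = cfc K a (\<lambda>t. ?p t * ?p t) \<oplus> cfc K a (\<lambda>t. - max 0 (-t))"
    by (rule cfc_add[OF a]) (intro continuous_intros)+
  also note neg
  also have "cfc K a (\<lambda>t. ?p t * ?p t) = cfc K a ?p \<otimes> cfc K a ?p"
    by (rule cfc_mult[OF a cp cp])
  finally have "a = cfc K a ?p \<otimes> cfc K a ?p" using cfc_closed[OF a cp] by simp
  then show ?thesis
    using posI[OF cfc_closed[OF a cp] cfc_star[OF a cp]] by (simp add: a_def)
qed

lemma pos_conj: assumes "pos a" "x \<in> carrier C" shows "pos (star C x \<otimes> a \<otimes> x)"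
proof -
  obtain s where s: "s \<in> carrier C" "star C s = s" "a = s \<otimes> s" using assms(1) by (rule posE)
  then have "star C x \<otimes> a \<otimes> x = star C (s \<otimes> x) \<otimes> (s \<otimes> x)"
    using assms(2) by (simp add: star_mult m_assoc)
  then show ?thesis using pos_star_mult_self s assms(2) by simp
qed

lemma positives_eq_pos: "positives C = Collect pos"
proof -
  have "pos a \<Longrightarrow> a \<in> positives C" for a
    by (erule posE) (force simp: positives_def)
  then show ?thesis using pos_star_mult_self by (auto simp: positives_def)
qed

section \<open>Positive square roots\<close>

definition pos_root :: "real \<Rightarrow> 'a \<Rightarrow> 'a" where
  "pos_root R a = cfc R a (\<lambda>t. sqrt (max 0 t))"

lemma pos_root:
  assumes a: "pos a" "nrm C a \<le> R"
  shows "pos (pos_root R a)" "pos_root R a \<otimes> pos_root R a = a" "nrm C (pos_root R a) \<le> sqrt R"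
proof -
  have aR: "selfadjoint_le R a" using a by (intro selfadjoint_leI) (simp_all)
  let ?g = "\<lambda>t. sqrt (max 0 t)" and ?h = "\<lambda>t. sqrt (sqrt (max 0 t))"
  have c: "continuous_on {-R..R} ?g" "continuous_on {-R..R} ?h" by (intro continuous_intros)+
  have "cfc R a (\<lambda>t. ?h t * ?h t) = cfc R a ?h \<otimes> cfc R a ?h" by (rule cfc_mult[OF aR c(2) c(2)])
  then have "pos_root R a = cfc R a ?h \<otimes> cfc R a ?h" by (simp add: pos_root_def)
  then show "pos (pos_root R a)" using posI[OF cfc_closed[OF aR c(2)] cfc_star[OF aR c(2)]] by simp
  have "pos_root R a \<otimes> pos_root R a = cfc R a (\<lambda>t. ?g t * ?g t)"
    unfolding pos_root_def by (rule cfc_mult[OF aR c(1) c(1), symmetric])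
  also have "\<dots> = cfc R a (\<lambda>t. t)"
    by (rule cfc_cong_pos[OF a]) (auto intro!: continuous_intros)
  also have "\<dots> = a" by (rule cfc_id[OF aR])
  finally show "pos_root R a \<otimes> pos_root R a = a" .
  show "nrm C (pos_root R a) \<le> sqrt R"
    unfolding pos_root_def by (rule nrm_cfc_le[OF aR c(1)]) (use selfadjoint_le_nonneg[OF aR] in auto)
qed

text \<open>Uniqueness of positive roots in usable form: a positive element is recovered from its
  square by a fixed continuous function.\<close>

lemma pos_root_square:
  assumes b: "pos b" "nrm C b \<le> S" shows "pos_root (S\<^sup>2) (b \<otimes> b) = b"
proof -
  have bS: "selfadjoint_le S b" using b by (intro selfadjoint_leI) (simp_all)
  have S0: "0 \<le> S" by (rule selfadjoint_le_nonneg[OF bS])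
  have r: "poly [:0, 0, 1:] (of_real t) = complex_of_real (t\<^sup>2)" for t
    by (simp add: power2_eq_square)
  have \<rho>: "\<bar>t\<^sup>2\<bar> \<le> S\<^sup>2" if "\<bar>t\<bar> \<le> S" for t
    using that S0 by (simp add: abs_le_square_iff[symmetric])
  have bb: "b \<otimes> b = pev b [:0, 0, 1:]" using b by simp
  have "pos_root (S\<^sup>2) (b \<otimes> b) = cfc S b (\<lambda>t. sqrt (max 0 (t\<^sup>2)))"
    unfolding pos_root_def bb by (rule cfc_pev(2)[OF bS r \<rho>]) (auto intro!: continuous_intros)
  also have "\<dots> = cfc S b (\<lambda>t. t)"
    by (rule cfc_cong_pos[OF b]) (auto intro!: continuous_intros)
  also have "\<dots> = b" by (rule cfc_id[OF bS])
  finally show ?thesis .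
qed

lemma approx_pev:
  assumes "approx F a b" shows "approx F (\<lambda>n. pev (a n) p) (\<lambda>n. pev (b n) p)"
proof (induction p)
  case (pCons c p)
  have "approx F (\<lambda>n. c \<odot> \<one> \<oplus> a n \<otimes> pev (a n) p) (\<lambda>n. c \<odot> \<one> \<oplus> b n \<otimes> pev (b n) p)"
    by (intro approx_add approx_mult assms pCons approx_refl bseq_const) auto
  then show ?case using approxD(1,2)[OF assms] by simp
qed (simp add: approx_refl)

text \<open>One polynomial approximates \<open>g\<close> within e/3 on the whole interval, hence at
  all \<open>a n\<close> and \<open>b n\<close> at once; its values at these are asymptotically
  equal. This yields uniqueness of roots in the ultrapower.\<close>

lemma approx_cfc:
  assumes ab: "approx F a b" and sa: "\<And>n. selfadjoint_le R (a n)" "\<And>n. selfadjoint_le R (b n)"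
    and g: "continuous_on {-R..R} g"
  shows "approx F (\<lambda>n. cfc R (a n) g) (\<lambda>n. cfc R (b n) g)"
proof -
  obtain P where P: "poly_approx R P g" using g by (rule poly_approx_exists)
  obtain B where B: "\<And>t. \<bar>t\<bar> \<le> R \<Longrightarrow> \<bar>g t\<bar> \<le> B" using P g by (rule poly_approx_bounded) blast
  obtain K where K: "\<And>n t. \<bar>t\<bar> \<le> R \<Longrightarrow> cmod (poly (P n) (of_real t) - of_real (g t)) \<le> K / real (Suc n)"
    using P by (rule poly_approxE) blast
  have bs: "bseq (\<lambda>n. cfc R (a n) g)" "bseq (\<lambda>n. cfc R (b n) g)"
    using sa g by (auto intro!: bseqI[of _ B] nrm_cfc_le B)
  have "((\<lambda>n. nrm C (cfc R (a n) g \<ominus> cfc R (b n) g)) \<longlongrightarrow> 0) F"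
  proof (rule tendstoI)
    fix e :: real assume e: "e > 0"
    have "\<forall>\<^sub>F n in sequentially. K / real (Suc n) < e / 3"
      using tendsto_over_Suc[of K] e by (intro order_tendstoD) auto
    then obtain m where m: "K / real (Suc m) < e / 3" by (auto simp: eventually_sequentially)
    have near: "nrm C (cfc R x g \<ominus> pev x (P m)) \<le> e / 3" if "selfadjoint_le R x" for x
    proof (rule nrm_cfc_pev_le[OF that g])
      fix t assume "\<bar>t\<bar> \<le> R"
      from K[OF this, of m] m show "cmod (poly (P m) (of_real t) - of_real (g t)) \<le> e / 3" by linarith
    qed
    have "\<forall>\<^sub>F n in F. nrm C (pev (a n) (P m) \<ominus> pev (b n) (P m)) < e / 3"
      using approxD(3)[OF approx_pev[OF ab, of "P m"]] e by (intro order_tendstoD) auto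
    then show "\<forall>\<^sub>F n in F. dist (nrm C (cfc R (a n) g \<ominus> cfc R (b n) g)) 0 < e"
    proof eventually_elim
      case (elim n)
      let ?x = "cfc R (a n) g" and ?y = "cfc R (b n) g" and ?p = "pev (a n) (P m)" and ?q = "pev (b n) (P m)"
      have c: "?x \<in> carrier C" "?y \<in> carrier C" "?p \<in> carrier C" "?q \<in> carrier C"
        using sa g by (auto intro!: cfc_closed pev_closed intro: selfadjoint_leD)
      have "nrm C (?x \<ominus> ?y) \<le> nrm C (?x \<ominus> ?p) + (nrm C (?p \<ominus> ?q) + nrm C (?q \<ominus> ?y))"
        using nrm_diff_trans[OF c(1,3,2)] nrm_diff_trans[OF c(3,4,2)] by linarith
      also have "nrm C (?q \<ominus> ?y) = nrm C (?y \<ominus> ?q)" using c by (simp add: nrm_diff_commute)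
      finally have "nrm C (?x \<ominus> ?y) < e"
        using near[OF sa(1)[of n]] near[OF sa(2)[of n]] elim by linarith
      then show ?case using c by (simp add: nrm_nonneg)
    qed
  qed
  then show ?thesis using bs by (simp add: approx_def)
qed

end

section \<open>Conditional expectations of index-finite type\<close>

lemma (in cstar_algebra) nrm_finsum_le:
  assumes "\<And>j. j < n \<Longrightarrow> f j \<in> carrier C"
  shows "nrm C (\<Oplus>j\<in>{..<n::nat}. f j) \<le> (\<Sum>j<n. nrm C (f j))"
  using assms
proof (induction n)
  case (Suc n)
  have c: "f n \<in> carrier C" "(\<Oplus>j\<in>{..<n}. f j) \<in> carrier C"
    using Suc.prems by (auto intro!: finsum_closed)
  have "(\<Oplus>j\<in>{..<Suc n}. f j) = f n \<oplus> (\<Oplus>j\<in>{..<n}. f j)"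
    unfolding lessThan_Suc by (rule finsum_insert) (use Suc.prems in auto)
  then show ?case
    using nrm_triangle[OF c] Suc by simp
qed simp

lemma (in cstar_algebra) finsum_swap:
  fixes n m :: nat
  assumes "\<And>i j. i < n \<Longrightarrow> j < m \<Longrightarrow> f i j \<in> carrier C"
  shows "(\<Oplus>i\<in>{..<n}. \<Oplus>j\<in>{..<m}. f i j) = (\<Oplus>j\<in>{..<m}. \<Oplus>i\<in>{..<n}. f i j)"
  using assms
proof (induction n)
  case (Suc n)
  have "(\<Oplus>i\<in>{..<Suc n}. \<Oplus>j\<in>{..<m}. f i j) = (\<Oplus>j\<in>{..<m}. f n j) \<oplus> (\<Oplus>i\<in>{..<n}. \<Oplus>j\<in>{..<m}. f i j)"
    unfolding lessThan_Suc by (rule finsum_insert) (use Suc.prems in \<open>auto intro!: finsum_closed\<close>)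
  also have "\<dots> = (\<Oplus>j\<in>{..<m}. f n j \<oplus> (\<Oplus>i\<in>{..<n}. f i j))"
    using Suc by (subst finsum_addf) (auto intro!: finsum_closed)
  also have "\<dots> = (\<Oplus>j\<in>{..<m}. \<Oplus>i\<in>{..<Suc n}. f i j)"
  proof (rule finsum_cong')
    show "f n j \<oplus> (\<Oplus>i\<in>{..<n}. f i j) = (\<Oplus>i\<in>{..<Suc n}. f i j)" if "j \<in> {..<m}" for j
      unfolding lessThan_Suc by (rule finsum_insert[symmetric]) (use Suc.prems that in auto)
  qed (use Suc.prems in \<open>auto intro!: finsum_closed\<close>)
  finally show ?case .
qed simp

locale index_finite_expectation = cstar_algebra A for A :: "'a cstar" (structure) +
  fixes P :: "'a set" and E :: "'a \<Rightarrow> 'a"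
  assumes subalgebra: "unital_cstar_subalgebra P A"
    and expectation: "conditional_expectation A P E"
    and index_finite: "index_finite A E"
begin

section \<open>Algebraic rules for the subalgebra and the expectation\<close>

lemma P_subring: "subring P A"
  using subalgebra by (simp add: unital_cstar_subalgebra_def)

lemma P_carrier [simp, intro]: "p \<in> P \<Longrightarrow> p \<in> carrier A"
  using subringE(1)[OF P_subring] by auto

lemma P_one [simp]: "\<one> \<in> P" and P_zero [simp]: "\<zero> \<in> P"
  and P_mult [simp, intro]: "p \<in> P \<Longrightarrow> q \<in> P \<Longrightarrow> p \<otimes> q \<in> P"
  and P_add [simp, intro]: "p \<in> P \<Longrightarrow> q \<in> P \<Longrightarrow> p \<oplus> q \<in> P"
  using subringE[OF P_subring] by auto

lemma P_star [simp, intro]: "p \<in> P \<Longrightarrow> star A p \<in> P"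
  and P_smult [simp, intro]: "p \<in> P \<Longrightarrow> c \<odot> p \<in> P"
  using subalgebra by (auto simp: unital_cstar_subalgebra_def)

lemma E_closed_P [simp, intro]: "x \<in> carrier A \<Longrightarrow> E x \<in> P"
  using expectation by (auto simp: conditional_expectation_def)

lemma E_closed [simp, intro]: "x \<in> carrier A \<Longrightarrow> E x \<in> carrier A"
  by blast

lemma E_add: "x \<in> carrier A \<Longrightarrow> y \<in> carrier A \<Longrightarrow> E (x \<oplus> y) = E x \<oplus> E y"
  and E_smult: "x \<in> carrier A \<Longrightarrow> E (c \<odot> x) = c \<odot> E x"
  and E_P [simp]: "p \<in> P \<Longrightarrow> E p = p"
  and E_bimodule: "p \<in> P \<Longrightarrow> x \<in> carrier A \<Longrightarrow> q \<in> P \<Longrightarrow> E (p \<otimes> x \<otimes> q) = p \<otimes> E x \<otimes> q"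
  using expectation by (auto simp: conditional_expectation_def)

lemma E_left: "p \<in> P \<Longrightarrow> x \<in> carrier A \<Longrightarrow> E (p \<otimes> x) = p \<otimes> E x"
  using E_bimodule[of p x "\<one>"] by simp

lemma E_right: "x \<in> carrier A \<Longrightarrow> q \<in> P \<Longrightarrow> E (x \<otimes> q) = E x \<otimes> q"
  using E_bimodule[of "\<one>" x q] by simp

lemma E_diff: "x \<in> carrier A \<Longrightarrow> y \<in> carrier A \<Longrightarrow> E (x \<ominus> y) = E x \<ominus> E y"
  by (simp add: diff_smult E_add E_smult)

section \<open>Positivity and boundedness of the expectation\<close>

lemma E_pos: assumes "pos x" shows "pos (E x)"
proof -
  have "x \<in> positives A" using assms by (simp add: positives_eq_pos)
  then have "E x \<in> positives (A\<lparr>carrier := P\<rparr>)"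
    using expectation by (auto simp: conditional_expectation_def)
  then show ?thesis
    by (auto simp: positives_def pos_star_mult_self)
qed

text \<open>Between minus and plus its norm, \<open>x\<close> is squeezed by scalars;
  \<open>E\<close> preserves positivity and fixes scalars, so \<open>E x\<close> is squeezed by the
  same ones.\<close>

lemma E_selfadjoint:
  assumes x: "x \<in> carrier A" "star A x = x"
  shows "star A (E x) = E x" "nrm A (E x) \<le> nrm A x"
proof -
  let ?t = "of_real (nrm A x) \<odot> \<one>"
  have "pos (E (?t \<oplus> x))" "pos (E (?t \<ominus> x))"
    using pos_norm_minus[OF x order.refl] by (auto intro: E_pos)
  moreover have "E ?t = ?t" by simp
  ultimately have p: "pos (?t \<oplus> E x)" "pos (?t \<ominus> E x)"
    using x by (simp_all add: E_add E_diff)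
  show "nrm A (E x) \<le> nrm A x"
    by (rule nrm_le_of_pos) (use x p nrm_nonneg in auto)
  have "E x = (?t \<oplus> E x) \<ominus> ?t" using x by (simp add: a_comm)
  moreover have "star A ((?t \<oplus> E x) \<ominus> ?t) = star A (?t \<oplus> E x) \<ominus> star A ?t"
    using x by (simp add: star_diff)
  ultimately show "star A (E x) = E x"
    using pos_star[OF p(1)] x by (simp add: star_smult)
qed

lemma selfadjoint_parts:
  assumes "x \<in> carrier A"
  obtains h k where "h \<in> carrier A" "k \<in> carrier A" "star A h = h" "star A k = k"
    "x = h \<oplus> \<i> \<odot> k" "nrm A h \<le> nrm A x" "nrm A k \<le> nrm A x"
proof
  let ?h = "(1/2) \<odot> (x \<oplus> star A x)" and ?k = "(-\<i>/2) \<odot> (x \<ominus> star A x)"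
  show "?h \<in> carrier A" "?k \<in> carrier A" using assms by auto
  show "star A ?h = ?h" "star A ?k = ?k" using assms by (simp_all add: star_smult star_add to_smult a_comm)
  have "nrm A (x \<oplus> star A x) \<le> 2 * nrm A x" "nrm A (x \<ominus> star A x) \<le> 2 * nrm A x"
    using nrm_triangle[of x "star A x"] nrm_diff_triangle[of x "star A x"] assms by auto
  then show "nrm A ?h \<le> nrm A x" "nrm A ?k \<le> nrm A x" using assms by (simp_all add: nrm_smult norm_divide)
  have "(1/2) \<odot> x \<oplus> (1/2) \<odot> x = x"
    using assms smult_add_left[of x "1/2" "1/2"] by simp
  moreover have "(1/2) \<odot> star A x \<oplus> (-1/2) \<odot> star A x = \<zero>"
    using assms smult_add_left[of "star A x" "1/2" "-1/2"] by simp
  moreover have "?h \<oplus> \<i> \<odot> ?k = ((1/2) \<odot> x \<oplus> (1/2) \<odot> x) \<oplus> ((1/2) \<odot> star A x \<oplus> (-1/2) \<odot> star A x)"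
    using assms by (simp add: to_smult a_ac)
  ultimately show "x = ?h \<oplus> \<i> \<odot> ?k" using assms by simp
qed

lemma E_star: assumes "x \<in> carrier A" shows "E (star A x) = star A (E x)"
proof -
  obtain h k where hk: "h \<in> carrier A" "k \<in> carrier A" "star A h = h" "star A k = k" "x = h \<oplus> \<i> \<odot> k"
    using assms by (rule selfadjoint_parts)
  have "star A (E h) = E h" "star A (E k) = E k" using hk E_selfadjoint by auto
  then show ?thesis using hk by (simp add: E_add E_smult star_add star_smult)
qed

text \<open>The factor 2 comes from treating real and imaginary part separately. It reappears in the
  constants of all later estimates involving \<open>E\<close>.\<close>

lemma nrm_E_le: assumes "x \<in> carrier A" shows "nrm A (E x) \<le> 2 * nrm A x"
proof -
  obtain h k where hk: "h \<in> carrier A" "k \<in> carrier A" "star A h = h" "star A k = k" "x = h \<oplus> \<i> \<odot> k"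
    "nrm A h \<le> nrm A x" "nrm A k \<le> nrm A x"
    using assms by (rule selfadjoint_parts)
  have "nrm A (E h) \<le> nrm A x" "nrm A (E k) \<le> nrm A x" using hk E_selfadjoint(2) by fastforce+
  moreover have "E x = E h \<oplus> \<i> \<odot> E k" using hk by (simp add: E_add E_smult)
  ultimately show ?thesis
    using nrm_triangle[of "E h" "\<i> \<odot> E k"] hk(1,2) by (simp add: nrm_smult)
qed

lemma bseq_E: "bseq x \<Longrightarrow> bseq (\<lambda>n. E (x n))"
proof -
  assume x: "bseq x"
  then obtain K where K: "\<And>n. nrm A (x n) \<le> K" by (rule bseqE) blast
  have "nrm A (E (x n)) \<le> 2 * K" for n
    using nrm_E_le[of "x n"] K[of n] x by simp
  with x show ?thesis by (intro bseqI[of _ "2 * K"]) auto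
qed

lemma approx_E: assumes "approx F x y" shows "approx F (\<lambda>n. E (x n)) (\<lambda>n. E (y n))"
proof (rule approxI_bound)
  show "((\<lambda>n. 2 * nrm A (x n \<ominus> y n)) \<longlongrightarrow> 0) F"
    using approxD(3)[OF assms] by (rule tendsto_mult_right_zero)
  have c: "x n \<in> carrier A" "y n \<in> carrier A" for n using assms by (auto simp: approx_def)
  show "\<forall>\<^sub>F n in F. nrm A (E (x n) \<ominus> E (y n)) \<le> 2 * nrm A (x n \<ominus> y n)"
    using nrm_E_le[of "x n \<ominus> y n" for n] c by (intro always_eventually) (simp add: E_diff)
qed (use approxD[OF assms] in \<open>auto intro: bseq_E\<close>)

lemma E_Schwarz_aux:
  assumes v: "v \<in> carrier A" and x: "x \<in> carrier A" and D: "D > 0" "nrm A (E (v \<otimes> star A v)) \<le> D"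
  shows "(nrm A (E (v \<otimes> x)))\<^sup>2 \<le> D * nrm A (E (star A x \<otimes> x))"
proof -
  define p where "p = E (v \<otimes> x)"
  have p: "p \<in> P" using v x by (simp add: p_def)
  then have pC: "p \<in> carrier A" by auto
  define d where "d = complex_of_real (1 / D)"
  have dr: "cnj d = d" "d * of_real D = 1" using D by (simp_all add: d_def)
  define w where "w = x \<ominus> d \<odot> (star A v \<otimes> p)"
  have w: "w \<in> carrier A" using v x p by (simp add: w_def)
  define G where "G = E (v \<otimes> star A v)"
  have G: "G \<in> carrier A" "star A G = G"
    using v E_selfadjoint(1)[of "v \<otimes> star A v"] by (simp_all add: G_def star_mult)
  let ?X = "E (star A x \<otimes> x)" and ?pp = "star A p \<otimes> p" and ?q = "star A p \<otimes> G \<otimes> p"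
  have c: "?X \<in> carrier A" "?pp \<in> carrier A" "?q \<in> carrier A" using x pC G by auto
  have "star A w \<otimes> w = star A x \<otimes> x \<oplus> (-d) \<odot> (star A x \<otimes> star A v \<otimes> p)
     \<oplus> ((-d) \<odot> (star A p \<otimes> (v \<otimes> x)) \<oplus> (d * d) \<odot> (star A p \<otimes> (v \<otimes> star A v) \<otimes> p))"
    using v x pC dr(1)
    by (simp add: w_def to_smult star_add star_smult star_mult l_distr r_distr m_assoc a_ac)
  moreover have "E (star A x \<otimes> star A v \<otimes> p) = ?pp"
    using v x p E_star[of "v \<otimes> x"] by (simp add: E_right star_mult p_def[symmetric])
  moreover have "E (star A p \<otimes> (v \<otimes> x)) = ?pp"
    using v x p by (simp add: E_left p_def[symmetric])
  moreover have "E (star A p \<otimes> (v \<otimes> star A v) \<otimes> p) = ?q"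
    using v p by (simp add: E_bimodule G_def)
  ultimately have Ew: "E (star A w \<otimes> w) = ?X \<oplus> (-d) \<odot> ?pp \<oplus> ((-d) \<odot> ?pp \<oplus> (d * d) \<odot> ?q)"
    using v x pC by (simp add: E_add E_smult)
  have 1: "pos (E (star A w \<otimes> w))" using w by (intro E_pos pos_star_mult_self)
  have "pos (of_real D \<odot> \<one> \<ominus> G)" using G D by (intro pos_norm_minus) (auto simp: G_def)
  then have "pos (star A p \<otimes> (of_real D \<odot> \<one> \<ominus> G) \<otimes> p)" using pC by (rule pos_conj)
  then have "pos (of_real (1 / D * (1 / D)) \<odot> (star A p \<otimes> (of_real D \<odot> \<one> \<ominus> G) \<otimes> p))"
    using D by (intro pos_smult) auto
  also have "of_real (1 / D * (1 / D)) \<odot> (star A p \<otimes> (of_real D \<odot> \<one> \<ominus> G) \<otimes> p)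
    = (d * d) \<odot> (of_real D \<odot> ?pp \<oplus> (-1) \<odot> ?q)"
  proof -
    have "star A p \<otimes> (of_real D \<odot> \<one> \<ominus> G) \<otimes> p = of_real D \<odot> ?pp \<oplus> (-1) \<odot> ?q"
      using pC G by (simp add: to_smult l_distr r_distr)
    then show ?thesis by (simp add: d_def)
  qed
  also have "\<dots> = d \<odot> ?pp \<oplus> (- (d * d)) \<odot> ?q"
    using c dr(2) by (simp add: smult_add_right mult.assoc)
  finally have 2: "pos (d \<odot> ?pp \<oplus> (- (d * d)) \<odot> ?q)" .
  have can: "e \<odot> y \<oplus> (- e) \<odot> y = \<zero>" if "y \<in> carrier A" for e y
    using that smult_add_left[of y e "-e"] by simp
  have "E (star A w \<otimes> w) \<oplus> (d \<odot> ?pp \<oplus> (- (d * d)) \<odot> ?q)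
    = ?X \<oplus> (-d) \<odot> ?pp \<oplus> ((d \<odot> ?pp \<oplus> (-d) \<odot> ?pp) \<oplus> ((d * d) \<odot> ?q \<oplus> (- (d * d)) \<odot> ?q))"
    unfolding Ew using c by (simp add: a_ac)
  also have "\<dots> = ?X \<ominus> d \<odot> ?pp"
    using c by (simp add: can to_smult)
  finally have "pos (?X \<ominus> d \<odot> ?pp)"
    using pos_add[OF 1 2] by simp
  moreover have "pos (d \<odot> ?pp)"
    unfolding d_def using D pC by (intro pos_smult pos_star_mult_self) auto
  ultimately have "nrm A (d \<odot> ?pp) \<le> nrm A ?X"
    using nrm_mono c by blast
  then have "(1 / D) * (nrm A p)\<^sup>2 \<le> nrm A ?X"
    using pC D by (simp add: nrm_smult cstar_identity d_def norm_divide)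
  then show ?thesis
    using D by (simp add: p_def field_simps)
qed

text \<open>The auxiliary bound needs \<open>D > 0\<close>, so it is taken at
  \<open>?G + 1 / real (Suc n)\<close> and n tends to infinity.\<close>

lemma E_Schwarz:
  assumes v: "v \<in> carrier A" and x: "x \<in> carrier A"
  shows "(nrm A (E (v \<otimes> x)))\<^sup>2 \<le> nrm A (E (v \<otimes> star A v)) * nrm A (E (star A x \<otimes> x))"
proof -
  let ?G = "nrm A (E (v \<otimes> star A v))" and ?X = "nrm A (E (star A x \<otimes> x))"
  have G: "0 \<le> ?G" using v by (intro nrm_nonneg) auto
  have "(nrm A (E (v \<otimes> x)))\<^sup>2 \<le> (?G + 1 / real (Suc n)) * ?X" for n
    using E_Schwarz_aux[OF v x, of "?G + 1 / real (Suc n)"] G by (simp add: add_nonneg_pos)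
  moreover have "(\<lambda>n. (?G + 1 / real (Suc n)) * ?X) \<longlonglongrightarrow> (?G + 0) * ?X"
    by (intro tendsto_intros tendsto_over_Suc)
  ultimately show ?thesis
    using LIMSEQ_le_const by fastforce
qed

section \<open>The module norm and its equivalence with the C*-norm\<close>

definition enorm :: "'a \<Rightarrow> real" where
  "enorm x = sqrt (nrm A (E (star A x \<otimes> x)))"

lemma enorm_nonneg [simp]: "x \<in> carrier A \<Longrightarrow> 0 \<le> enorm x"
  by (simp add: enorm_def nrm_nonneg)

lemma enorm_power2: "x \<in> carrier A \<Longrightarrow> (enorm x)\<^sup>2 = nrm A (E (star A x \<otimes> x))"
  by (simp add: enorm_def nrm_nonneg)

lemma nrm_E_inner_le:
  assumes "x \<in> carrier A" "y \<in> carrier A" shows "nrm A (E (star A x \<otimes> y)) \<le> enorm x * enorm y"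
proof -
  have "(nrm A (E (star A x \<otimes> y)))\<^sup>2 \<le> (enorm x * enorm y)\<^sup>2"
    using E_Schwarz[of "star A x" y] assms by (simp add: power_mult_distrib enorm_power2)
  then show ?thesis using assms by (simp add: power2_le_iff_abs_le)
qed

lemma enorm_triangle:
  assumes x: "x \<in> carrier A" and y: "y \<in> carrier A" shows "enorm (x \<oplus> y) \<le> enorm x + enorm y"
proof -
  let ?e = "\<lambda>x y. E (star A x \<otimes> y)"
  have 1: "?e (x \<oplus> y) (x \<oplus> y) = (?e x x \<oplus> ?e x y) \<oplus> (?e y x \<oplus> ?e y y)"
    using x y by (simp add: star_add l_distr r_distr E_add a_ac)
  have 2: "nrm A ((?e x x \<oplus> ?e x y) \<oplus> (?e y x \<oplus> ?e y y))
      \<le> (nrm A (?e x x) + nrm A (?e x y)) + (nrm A (?e y x) + nrm A (?e y y))"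
    by (rule order.trans[OF nrm_triangle add_mono[OF nrm_triangle nrm_triangle]]) (use x y in auto)
  have 3: "(nrm A (?e x x) + nrm A (?e x y)) + (nrm A (?e y x) + nrm A (?e y y))
      \<le> (enorm x * enorm x + enorm x * enorm y) + (enorm y * enorm x + enorm y * enorm y)"
    by (rule add_mono[OF add_mono[OF nrm_E_inner_le[OF x x] nrm_E_inner_le[OF x y]]
          add_mono[OF nrm_E_inner_le[OF y x] nrm_E_inner_le[OF y y]]])
  have 4: "(a * a + a * b) + (b * a + b * b) = (a + b)\<^sup>2" for a b :: real
    by (simp add: power2_eq_square algebra_simps)
  have "(enorm (x \<oplus> y))\<^sup>2 \<le> (enorm x + enorm y)\<^sup>2"
    using order.trans[OF 2 3] unfolding enorm_power2[OF a_closed[OF x y]] 1 4 .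
  then show ?thesis by (rule power2_le_imp_le) (use x y in simp)
qed

lemma enorm_le_nrm: assumes "x \<in> carrier A" shows "enorm x \<le> nrm A x"
proof -
  have "(enorm x)\<^sup>2 \<le> (nrm A x)\<^sup>2"
    using E_selfadjoint(2)[of "star A x \<otimes> x"] assms by (simp add: enorm_power2 star_mult cstar_identity)
  then show ?thesis using assms nrm_nonneg[OF assms] by (simp add: power2_le_iff_abs_le)
qed

text \<open>Finite index at work: \<open>x\<close> is a finite sum of terms u_j E(v_j x), and the
  Schwarz inequality bounds each E(v_j x) by the module norm of \<open>x\<close>.\<close>

lemma nrm_le_enorm: obtains K where "K > 0" "\<And>x. x \<in> carrier A \<Longrightarrow> nrm A x \<le> K * enorm x"
proof -
  obtain n u v where qb: "quasi_basis A E n u v" using index_finite by (auto simp: index_finite_def)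
  have u: "u j \<in> carrier A" and v: "v j \<in> carrier A" if "j < n" for j
    using qb that by (auto simp: quasi_basis_def)
  \<comment> \<open>Adding 1 makes \<open>K\<close> positive even for a sum that vanishes.\<close>
  define K where "K = (\<Sum>j<n. nrm A (u j) * enorm (star A (v j))) + 1"
  have K: "K > 0" unfolding K_def using u v by (intro add_nonneg_pos sum_nonneg mult_nonneg_nonneg) (auto simp: nrm_nonneg)
  have "nrm A x \<le> K * enorm x" if x: "x \<in> carrier A" for x
  proof -
    have "nrm A x = nrm A (\<Oplus>j\<in>{..<n}. u j \<otimes> E (v j \<otimes> x))"
      using qb x by (simp add: quasi_basis_def)
    also have "\<dots> \<le> (\<Sum>j<n. nrm A (u j \<otimes> E (v j \<otimes> x)))"
      using u v x by (intro nrm_finsum_le) auto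
    also have "\<dots> \<le> (\<Sum>j<n. nrm A (u j) * (enorm (star A (v j)) * enorm x))"
    proof (intro sum_mono nrm_mult_le)
      fix j assume "j \<in> {..<n}"
      then have j: "u j \<in> carrier A" "v j \<in> carrier A" using u v by auto
      then show "nrm A (E (v j \<otimes> x)) \<le> enorm (star A (v j)) * enorm x"
        using nrm_E_inner_le[of "star A (v j)" x] x by simp
    qed (use u v x in auto)
    also have "\<dots> \<le> K * enorm x"
      using enorm_nonneg[OF x] by (simp add: K_def sum_distrib_right sum_distrib_left algebra_simps)
    finally show ?thesis .
  qed
  with K show ?thesis by (rule that)
qed

lemma nrm_le_of_homogeneous:
  assumes S: "\<And>y. y \<in> carrier A \<Longrightarrow> S y \<in> carrier A"
    "\<And>c y. y \<in> carrier A \<Longrightarrow> S (c \<odot> y) = c \<odot> S y"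
    and le: "\<And>y. y \<in> carrier A \<Longrightarrow> nrm A y \<le> 1 \<Longrightarrow> nrm A (S y) \<le> c"
    and y: "y \<in> carrier A"
  shows "nrm A (S y) \<le> c * nrm A y"
proof (cases "nrm A y = 0")
  case True
  then have "y = 0 \<odot> y" using y nrm_eq_0_iff by simp
  then have "S y = 0 \<odot> S y" using S(2)[OF y] by metis
  then show ?thesis using True S(1)[OF y] by simp
next
  case False
  then have pos: "nrm A y > 0" using y nrm_nonneg[of y] by simp
  have "nrm A (S (of_real (1 / nrm A y) \<odot> y)) \<le> c"
    using pos y by (intro le) (auto simp: nrm_smult norm_divide)
  then show ?thesis
    using pos y S by (simp add: nrm_smult norm_divide field_simps)
qed

text \<open>Each x u_j is expanded in the second family, the two sums are exchanged, and the first
  family resums E(v'_l x u_j) v_j to v'_l x. At \<open>x = \<one>\<close> this shows independence of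
  the family, and for two equal families centrality.\<close>

lemma quasi_basis_index_eq:
  assumes q: "quasi_basis A E n u v" and q': "quasi_basis A E m u' v'" and x: "x \<in> carrier A"
  shows "x \<otimes> (\<Oplus>j\<in>{..<n}. u j \<otimes> v j) = (\<Oplus>j\<in>{..<m}. u' j \<otimes> v' j) \<otimes> x"
proof -
  have c: "u j \<in> carrier A" "v j \<in> carrier A" if "j < n" for j using q that by (auto simp: quasi_basis_def)
  have c': "u' j \<in> carrier A" "v' j \<in> carrier A" if "j < m" for j using q' that by (auto simp: quasi_basis_def)
  have "x \<otimes> (\<Oplus>j\<in>{..<n}. u j \<otimes> v j) = (\<Oplus>j\<in>{..<n}. x \<otimes> (u j \<otimes> v j))"
    using c x by (intro finsum_rdistr) auto
  also have "\<dots> = (\<Oplus>j\<in>{..<n}. \<Oplus>l\<in>{..<m}. u' l \<otimes> E (v' l \<otimes> x \<otimes> u j) \<otimes> v j)"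
  proof (rule finsum_cong')
    fix j assume "j \<in> {..<n}"
    then have j: "u j \<in> carrier A" "v j \<in> carrier A" using c by auto
    have "x \<otimes> (u j \<otimes> v j) = x \<otimes> u j \<otimes> v j" using j x by (simp add: m_assoc)
    also have "x \<otimes> u j = (\<Oplus>l\<in>{..<m}. u' l \<otimes> E (v' l \<otimes> (x \<otimes> u j)))"
      using q' j x by (simp add: quasi_basis_def)
    also have "\<dots> \<otimes> v j = (\<Oplus>l\<in>{..<m}. u' l \<otimes> E (v' l \<otimes> (x \<otimes> u j)) \<otimes> v j)"
      using c' j x by (intro finsum_ldistr) auto
    also have "\<dots> = (\<Oplus>l\<in>{..<m}. u' l \<otimes> E (v' l \<otimes> x \<otimes> u j) \<otimes> v j)"
      using c' j x by (intro finsum_cong') (auto simp: m_assoc)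
    finally show "x \<otimes> (u j \<otimes> v j) = (\<Oplus>l\<in>{..<m}. u' l \<otimes> E (v' l \<otimes> x \<otimes> u j) \<otimes> v j)" .
  qed (use c c' x in \<open>auto intro!: finsum_closed\<close>)
  also have "\<dots> = (\<Oplus>l\<in>{..<m}. \<Oplus>j\<in>{..<n}. u' l \<otimes> E (v' l \<otimes> x \<otimes> u j) \<otimes> v j)"
    using c c' x by (intro finsum_swap) auto
  also have "\<dots> = (\<Oplus>l\<in>{..<m}. u' l \<otimes> v' l \<otimes> x)"
  proof (rule finsum_cong')
    fix l assume "l \<in> {..<m}"
    then have l: "u' l \<in> carrier A" "v' l \<in> carrier A" using c' by auto
    have "(\<Oplus>j\<in>{..<n}. u' l \<otimes> E (v' l \<otimes> x \<otimes> u j) \<otimes> v j) = (\<Oplus>j\<in>{..<n}. u' l \<otimes> (E (v' l \<otimes> x \<otimes> u j) \<otimes> v j))"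
      using c l x by (intro finsum_cong') (auto simp: m_assoc)
    also have "\<dots> = u' l \<otimes> (\<Oplus>j\<in>{..<n}. E (v' l \<otimes> x \<otimes> u j) \<otimes> v j)"
      using c l x by (intro finsum_rdistr[symmetric]) auto
    also have "(\<Oplus>j\<in>{..<n}. E (v' l \<otimes> x \<otimes> u j) \<otimes> v j) = v' l \<otimes> x"
      using q l x by (simp add: quasi_basis_def)
    finally show "(\<Oplus>j\<in>{..<n}. u' l \<otimes> E (v' l \<otimes> x \<otimes> u j) \<otimes> v j) = u' l \<otimes> v' l \<otimes> x"
      using l x by (simp add: m_assoc)
  qed (use c c' x in \<open>auto intro!: finsum_closed\<close>)
  also have "\<dots> = (\<Oplus>l\<in>{..<m}. u' l \<otimes> v' l) \<otimes> x"
    using c' x by (intro finsum_ldistr[symmetric]) auto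
  finally show ?thesis .
qed

lemma index_elt:
  shows index_elt_closed [simp]: "index_elt A E \<in> carrier A"
    and index_elt_central: "x \<in> carrier A \<Longrightarrow> x \<otimes> index_elt A E = index_elt A E \<otimes> x"
proof -
  obtain n u v where q: "quasi_basis A E n u v" using index_finite by (auto simp: index_finite_def)
  let ?s = "\<lambda>n u v. \<Oplus>j\<in>{..<n::nat}. u j \<otimes> v j"
  have cl: "?s n u v \<in> carrier A" if "quasi_basis A E n u v" for n u v
    using that by (auto simp: quasi_basis_def intro!: finsum_closed)
  have "index_elt A E = ?s n u v"
    unfolding index_elt_def
  proof (rule the_equality)
    fix z assume "\<exists>n u v. quasi_basis A E n u v \<and> z = ?s n u v"
    then obtain m u' v' where q': "quasi_basis A E m u' v'" and z: "z = ?s m u' v'" by blast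
    from quasi_basis_index_eq[OF q q', of "\<one>"] show "z = ?s n u v"
      using cl[OF q] cl[OF q'] by (simp add: z)
  qed (use q in blast)
  then show "index_elt A E \<in> carrier A" "x \<in> carrier A \<Longrightarrow> x \<otimes> index_elt A E = index_elt A E \<otimes> x"
    using cl[OF q] quasi_basis_index_eq[OF q q] by auto
qed

end

section \<open>The Hilbert module and its operators\<close>

text \<open>A sequence converging along \<open>sequentially\<close> is bounded, so the boundedness
  built into \<open>approx\<close> follows here.\<close>

lemma (in cstar_algebra) approx_sequentially_const_iff:
  "approx sequentially s (\<lambda>_. a) \<longleftrightarrow>
    a \<in> carrier C \<and> (\<forall>n. s n \<in> carrier C) \<and> (\<lambda>n. nrm C (s n \<ominus> a)) \<longlonglongrightarrow> 0"
proof
  assume r: "a \<in> carrier C \<and> (\<forall>n. s n \<in> carrier C) \<and> (\<lambda>n. nrm C (s n \<ominus> a)) \<longlonglongrightarrow> 0"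
  then have "Bseq (\<lambda>n. nrm C (s n \<ominus> a))" by (intro convergent_imp_Bseq convergentI) auto
  then obtain K where K: "\<And>n. \<bar>nrm C (s n \<ominus> a)\<bar> \<le> K" by (auto simp: Bseq_def)
  have "nrm C (s n) \<le> K + nrm C a" for n
    using nrm_le_diff[of "s n" a] K[of n] r by fastforce
  then have "bseq s" using r by (intro bseqI) auto
  then show "approx sequentially s (\<lambda>_. a)" using r by (auto simp: approx_def)
qed (auto simp: approx_def bseq_def)

context index_finite_expectation
begin

section \<open>The completion of the algebra in the module norm adds no points\<close>

lemma enorm_smult: "x \<in> carrier A \<Longrightarrow> enorm (c \<odot> x) = cmod c * enorm x"
  by (simp add: enorm_def star_smult smult_mult_left smult_mult_right E_smult nrm_smult
      real_sqrt_mult norm_mult)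

lemma enorm_eq_0: "x \<in> carrier A \<Longrightarrow> enorm x = 0 \<longleftrightarrow> x = \<zero>"
proof
  assume x: "x \<in> carrier A" "enorm x = 0"
  obtain K where "nrm A x \<le> K * enorm x" using nrm_le_enorm x(1) by metis
  then show "x = \<zero>" using x nrm_nonneg[of x] nrm_eq_0_iff[of x] by simp
qed (simp add: enorm_def)

lemma edist_eq: "x \<in> carrier A \<Longrightarrow> y \<in> carrier A \<Longrightarrow> edist A E x y = enorm (x \<ominus> y)"
  by (simp add: edist_def enorm_def)

lemma Metric_space_edist: "Metric_space (carrier A) (edist A E)"
proof
  show "0 \<le> edist A E x y" for x y by (simp add: edist_def nrm_nonneg)
  show "edist A E x y = edist A E y x" for x y
  proof (cases "x \<in> carrier A \<and> y \<in> carrier A")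
    case True
    then have "x \<ominus> y = (-1) \<odot> (y \<ominus> x)" by (simp add: to_smult a_comm)
    then show ?thesis using True by (simp add: edist_eq enorm_smult)
  qed (auto simp: edist_def)
  show "edist A E x y = 0 \<longleftrightarrow> x = y" if "x \<in> carrier A" "y \<in> carrier A" for x y
    using that by (simp add: edist_eq enorm_eq_0)
  show "edist A E x w \<le> edist A E x y + edist A E y w"
    if "x \<in> carrier A" "y \<in> carrier A" "w \<in> carrier A" for x y w
    using that enorm_triangle[of "x \<ominus> y" "y \<ominus> w"] by (simp add: edist_eq diff_add_diff)
qed

lemma edist_limit_iff:
  assumes "\<And>n. s n \<in> carrier A" "\<And>n. t n \<in> carrier A"
  shows "(\<lambda>n. edist A E (s n) (t n)) \<longlonglongrightarrow> 0 \<longleftrightarrow> (\<lambda>n. nrm A (s n \<ominus> t n)) \<longlonglongrightarrow> 0"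
proof
  assume "(\<lambda>n. nrm A (s n \<ominus> t n)) \<longlonglongrightarrow> 0"
  then show "(\<lambda>n. edist A E (s n) (t n)) \<longlonglongrightarrow> 0"
    by (rule tendsto_sandwich[OF _ _ tendsto_const, rotated 2])
       (use assms enorm_le_nrm in \<open>auto simp: edist_eq intro!: always_eventually\<close>)
next
  assume e: "(\<lambda>n. edist A E (s n) (t n)) \<longlonglongrightarrow> 0"
  obtain K where K: "\<And>x. x \<in> carrier A \<Longrightarrow> nrm A x \<le> K * enorm x" using nrm_le_enorm by metis
  have "(\<lambda>n. K * edist A E (s n) (t n)) \<longlonglongrightarrow> 0" using e by (rule tendsto_mult_right_zero)
  then show "(\<lambda>n. nrm A (s n \<ominus> t n)) \<longlonglongrightarrow> 0"
    by (rule tendsto_sandwich[OF _ _ tendsto_const, rotated 2])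
       (use assms K in \<open>auto simp: edist_eq nrm_nonneg intro!: always_eventually\<close>)
qed

text \<open>The two norms are equivalent and \<open>A\<close> is complete, so a Cauchy sequence for
  the module norm already converges in \<open>A\<close>.\<close>

lemma ecauchy_iff:
  "s \<in> ecauchy A E \<longleftrightarrow> (\<exists>a. approx sequentially s (\<lambda>_. a))"
proof -
  interpret M: Metric_space "carrier A" "edist A E" by (rule Metric_space_edist)
  show ?thesis
  proof
    assume "s \<in> ecauchy A E"
    then have s: "\<And>n. s n \<in> carrier A"
      and c: "\<And>e. e > 0 \<Longrightarrow> \<exists>N. \<forall>m\<ge>N. \<forall>n\<ge>N. edist A E (s m) (s n) < e"
      by (auto simp: ecauchy_def M.MCauchy_def)
    obtain K where K: "K > 0" "\<And>x. x \<in> carrier A \<Longrightarrow> nrm A x \<le> K * enorm x" using nrm_le_enorm by metis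
    have "\<exists>N. \<forall>m\<ge>N. \<forall>n\<ge>N. nrm A (s m \<ominus> s n) < e" if e: "e > 0" for e
    proof -
      obtain N where N: "\<And>m n. m \<ge> N \<Longrightarrow> n \<ge> N \<Longrightarrow> edist A E (s m) (s n) < e / K"
        using c[OF divide_pos_pos[OF e K(1)]] by blast
      have "nrm A (s m \<ominus> s n) < e" if mn: "m \<ge> N" "n \<ge> N" for m n
      proof -
        have "nrm A (s m \<ominus> s n) \<le> K * edist A E (s m) (s n)" using K s by (simp add: edist_eq)
        also have "\<dots> < e" using N[OF mn] K by (simp add: field_simps)
        finally show ?thesis .
      qed
      then show ?thesis by blast
    qed
    with s obtain l where "l \<in> carrier A" "(\<lambda>n. nrm A (s n \<ominus> l)) \<longlonglongrightarrow> 0" by (rule Cauchy_converges)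
    with s show "\<exists>a. approx sequentially s (\<lambda>_. a)" by (auto simp: approx_sequentially_const_iff)
  next
    assume "\<exists>a. approx sequentially s (\<lambda>_. a)"
    then obtain a where a: "a \<in> carrier A" "\<And>n. s n \<in> carrier A" "(\<lambda>n. nrm A (s n \<ominus> a)) \<longlonglongrightarrow> 0"
      by (auto simp: approx_sequentially_const_iff)
    then have "(\<lambda>n. edist A E (s n) a) \<longlonglongrightarrow> 0" using edist_limit_iff[of s "\<lambda>_. a"] by simp
    then have "limitin M.mtopology s a sequentially"
      using a by (auto simp: M.limitin_metric_dist_null)
    then show "s \<in> ecauchy A E"
      using a M.convergent_imp_MCauchy[of s a] by (auto simp: ecauchy_def)
  qed
qed

text \<open>The canonical map into the completion. It is injective by \<open>cls_inj\<close> and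
  onto by \<open>carrier_H\<close>, so maps on the module can be computed on elements of
  \<open>A\<close>.\<close>

definition cls :: "'a \<Rightarrow> (nat \<Rightarrow> 'a) set" where
  "cls a = erel A E `` {\<lambda>_. a}"

lemma erel_iff: "(s, t) \<in> erel A E \<longleftrightarrow> (\<exists>a. approx sequentially s (\<lambda>_. a) \<and> approx sequentially t (\<lambda>_. a))"
proof
  assume "(s, t) \<in> erel A E"
  then obtain a b where ab: "approx sequentially s (\<lambda>_. a)" "approx sequentially t (\<lambda>_. b)"
    and "(\<lambda>n. edist A E (s n) (t n)) \<longlonglongrightarrow> 0"
    by (auto simp: erel_def ecauchy_iff)
  then have "approx sequentially s t"
    using edist_limit_iff[of s t] by (auto simp: approx_def)
  with ab show "\<exists>a. approx sequentially s (\<lambda>_. a) \<and> approx sequentially t (\<lambda>_. a)"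
    using approx_sym approx_trans by blast
next
  assume "\<exists>a. approx sequentially s (\<lambda>_. a) \<and> approx sequentially t (\<lambda>_. a)"
  then have "approx sequentially s t" "s \<in> ecauchy A E" "t \<in> ecauchy A E"
    using approx_sym approx_trans ecauchy_iff by blast+
  then show "(s, t) \<in> erel A E"
    using edist_limit_iff[of s t] by (auto simp: erel_def approx_def)
qed

lemma approx_const_unique: "approx sequentially s (\<lambda>_. a) \<Longrightarrow> approx sequentially s (\<lambda>_. b) \<Longrightarrow> a = b"
  by (rule approx_const_eq[OF approx_trans[OF approx_sym]]) (assumption | rule sequentially_bot)+

lemma mem_cls: assumes a: "a \<in> carrier A" shows "s \<in> cls a \<longleftrightarrow> approx sequentially s (\<lambda>_. a)"
proof
  assume "s \<in> cls a"
  then obtain b where b: "approx sequentially (\<lambda>_. a) (\<lambda>_. b)" "approx sequentially s (\<lambda>_. b)"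
    unfolding cls_def by (auto simp: erel_iff)
  then have "a = b" by (intro approx_const_eq[OF b(1)]) simp
  with b show "approx sequentially s (\<lambda>_. a)" by simp
next
  assume "approx sequentially s (\<lambda>_. a)"
  then show "s \<in> cls a"
    unfolding cls_def using approx_refl[OF bseq_const[OF a]] by (auto simp: erel_iff)
qed

lemma erel_class: "approx sequentially s (\<lambda>_. a) \<Longrightarrow> erel A E `` {s} = cls a"
proof -
  assume s: "approx sequentially s (\<lambda>_. a)"
  then have a: "a \<in> carrier A" by (simp add: approx_sequentially_const_iff)
  show ?thesis
  proof (intro equalityI subsetI)
    fix t assume "t \<in> erel A E `` {s}"
    then obtain b where b: "approx sequentially s (\<lambda>_. b)" "approx sequentially t (\<lambda>_. b)"
      by (auto simp: erel_iff)
    then show "t \<in> cls a"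
      unfolding mem_cls[OF a] using approx_const_unique[OF s b(1)] by simp
  next
    fix t assume "t \<in> cls a"
    then show "t \<in> erel A E `` {s}"
      using s unfolding mem_cls[OF a] by (auto simp: erel_iff)
  qed
qed

lemma cls_self [simp]: "a \<in> carrier A \<Longrightarrow> (\<lambda>_. a) \<in> cls a"
  by (simp add: mem_cls approx_refl)

lemma cls_inj [simp]: "a \<in> carrier A \<Longrightarrow> b \<in> carrier A \<Longrightarrow> cls a = cls b \<longleftrightarrow> a = b"
  by (metis cls_self mem_cls approx_const_eq sequentially_bot)

text \<open>Operations on the completion are unions over representatives. All representatives give
  the same class, so the union collapses.\<close>

lemma UN_erel_cls:
  assumes a: "a \<in> carrier A" and f: "\<And>s. approx sequentially s (\<lambda>_. a) \<Longrightarrow> approx sequentially (f s) (\<lambda>_. b)"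
  shows "(\<Union>s\<in>cls a. erel A E `` {f s}) = cls b"
proof -
  have "(\<Union>s\<in>cls a. erel A E `` {f s}) = (\<Union>s\<in>cls a. cls b)"
    using f mem_cls[OF a] by (intro SUP_cong refl erel_class) auto
  then show ?thesis using cls_self[OF a] by blast
qed

abbreviation "H \<equiv> expectation_module A P E"
abbreviation "L \<equiv> adjointable_operators (A\<lparr>carrier := P\<rparr>) H"
abbreviation "B \<equiv> basic_construction A P E"

section \<open>The module operations in terms of elements of the algebra\<close>

lemma carrier_H: "carrier H = cls ` carrier A"
proof -
  have "carrier H = ecauchy A E // erel A E" by (simp add: expectation_module_def)
  also have "\<dots> = cls ` carrier A"
  proof (intro equalityI subsetI)
    fix X assume "X \<in> ecauchy A E // erel A E"
    then obtain s where "s \<in> ecauchy A E" "X = erel A E `` {s}" by (auto elim: quotientE)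
    then show "X \<in> cls ` carrier A"
      using erel_class by (auto simp: ecauchy_iff approx_sequentially_const_iff)
  next
    fix X assume "X \<in> cls ` carrier A"
    then obtain a where "a \<in> carrier A" "X = cls a" by blast
    then show "X \<in> ecauchy A E // erel A E"
      unfolding cls_def by (auto simp: ecauchy_iff intro!: quotientI exI[of _ a] approx_refl)
  qed
  finally show ?thesis .
qed

lemma cls_mem [simp, intro]: "a \<in> carrier A \<Longrightarrow> cls a \<in> carrier H"
  by (simp add: carrier_H)

lemma carrier_HE: assumes "X \<in> carrier H" obtains a where "a \<in> carrier A" "X = cls a"
  using assms by (auto simp: carrier_H)

lemma zero_H: "\<zero>\<^bsub>H\<^esub> = cls \<zero>"
  by (simp add: expectation_module_def cls_def)

lemma add_H: assumes "a \<in> carrier A" "b \<in> carrier A" shows "cls a \<oplus>\<^bsub>H\<^esub> cls b = cls (a \<oplus> b)"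
proof -
  have "(\<Union>t\<in>cls b. erel A E `` {\<lambda>n. s n \<oplus> t n}) = cls (a \<oplus> b)" if "s \<in> cls a" for s
    using that assms by (intro UN_erel_cls approx_add) (auto simp: mem_cls)
  then have "(\<Union>s\<in>cls a. \<Union>t\<in>cls b. erel A E `` {\<lambda>n. s n \<oplus> t n}) = cls (a \<oplus> b)"
    using cls_self[OF assms(1)] by auto
  then show ?thesis by (simp add: expectation_module_def)
qed

lemma inner_H: assumes ab: "a \<in> carrier A" "b \<in> carrier A"
  shows "inner_prod H (cls a) (cls b) = E (star A a \<otimes> b)"
proof -
  have "(THE l. l \<in> P \<and> (\<forall>s\<in>cls a. \<forall>t\<in>cls b.
        limitin (norm_topology A) (\<lambda>n. E (star A (s n) \<otimes> t n)) l sequentially)) = E (star A a \<otimes> b)"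
  proof (rule the_equality)
    have "limitin (norm_topology A) (\<lambda>n. E (star A (s n) \<otimes> t n)) (E (star A a \<otimes> b)) sequentially"
      if "s \<in> cls a" "t \<in> cls b" for s t
    proof -
      have "approx sequentially (\<lambda>n. E (star A (s n) \<otimes> t n)) (\<lambda>_. E (star A a \<otimes> b))"
        using that ab by (intro approx_E approx_mult approx_star) (auto simp: mem_cls)
      then show ?thesis by (auto simp: limitin_iff approx_sequentially_const_iff)
    qed
    then show "E (star A a \<otimes> b) \<in> P \<and> (\<forall>s\<in>cls a. \<forall>t\<in>cls b.
        limitin (norm_topology A) (\<lambda>n. E (star A (s n) \<otimes> t n)) (E (star A a \<otimes> b)) sequentially)"
      using ab by auto
  next
    fix l assume "l \<in> P \<and> (\<forall>s\<in>cls a. \<forall>t\<in>cls b.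
        limitin (norm_topology A) (\<lambda>n. E (star A (s n) \<otimes> t n)) l sequentially)"
    then have "limitin (norm_topology A) (\<lambda>n. E (star A a \<otimes> b)) l sequentially"
      using cls_self ab by auto
    then have "approx sequentially (\<lambda>n. E (star A a \<otimes> b)) (\<lambda>_. l)"
      using ab by (simp add: limitin_iff approx_sequentially_const_iff)
    then show "l = E (star A a \<otimes> b)" using approx_const_eq sequentially_bot by metis
  qed
  then show ?thesis by (simp add: expectation_module_def)
qed

lemma module_norm_cls: "a \<in> carrier A \<Longrightarrow> module_norm (A\<lparr>carrier := P\<rparr>) H (cls a) = enorm a"
  by (simp add: module_norm_def inner_H enorm_def)

lemma module_extension_cls:
  assumes "a \<in> carrier A"
    "\<And>s. approx sequentially s (\<lambda>_. a) \<Longrightarrow> approx sequentially (\<lambda>n. f (s n)) (\<lambda>_. f a)"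
  shows "module_extension A P E f (cls a) = cls (f a)"
proof -
  have "(\<Union>s\<in>cls a. erel A E `` {\<lambda>n. f (s n)}) = cls (f a)"
    using assms(1) by (rule UN_erel_cls) (rule assms(2))
  then show ?thesis using cls_mem[OF assms(1)] by (simp only: module_extension_def restrict_apply if_True)
qed

lemma left_mult_cls: "x \<in> carrier A \<Longrightarrow> a \<in> carrier A \<Longrightarrow> left_mult A P E x (cls a) = cls (x \<otimes> a)"
  unfolding left_mult_def by (intro module_extension_cls approx_mult approx_refl) auto

lemma jones_projection_cls: "a \<in> carrier A \<Longrightarrow> jones_projection A P E (cls a) = cls (E a)"
  unfolding jones_projection_def by (intro module_extension_cls approx_E) auto

lemma PiE_H_I:
  assumes "\<And>a. a \<in> carrier A \<Longrightarrow> T (cls a) = cls (f a)" "\<And>a. a \<in> carrier A \<Longrightarrow> f a \<in> carrier A"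
    "T \<in> extensional (carrier H)"
  shows "T \<in> carrier H \<rightarrow>\<^sub>E carrier H"
  unfolding PiE_iff by (intro conjI ballI assms(3), elim carrier_HE) (simp add: assms(1,2) cls_mem)

lemma left_mult_PiE: "x \<in> carrier A \<Longrightarrow> left_mult A P E x \<in> carrier H \<rightarrow>\<^sub>E carrier H"
  by (rule PiE_H_I[where f = "\<lambda>a. x \<otimes> a"]) (auto simp: left_mult_cls, simp add: left_mult_def module_extension_def)

lemma jones_projection_PiE: "jones_projection A P E \<in> carrier H \<rightarrow>\<^sub>E carrier H"
  by (rule PiE_H_I[where f = E]) (auto simp: jones_projection_cls, simp add: jones_projection_def module_extension_def)

lemma left_mult_adjoint: "x \<in> carrier A \<Longrightarrow> is_adjoint H (left_mult A P E x) (left_mult A P E (star A x))"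
  unfolding is_adjoint_def
  by (intro conjI ballI left_mult_PiE)
     (auto elim!: carrier_HE simp: left_mult_cls inner_H star_mult m_assoc)

lemma jones_projection_adjoint: "is_adjoint H (jones_projection A P E) (jones_projection A P E)"
  unfolding is_adjoint_def
  by (intro conjI ballI jones_projection_PiE)
     (auto elim!: carrier_HE simp: jones_projection_cls inner_H E_left E_right E_star[symmetric])

section \<open>Adjointable operators\<close>

lemma carrier_L: "carrier L = {T. \<exists>S. is_adjoint H T S}"
  by (simp add: adjointable_operators_def)

lemma L_mult: "T \<otimes>\<^bsub>L\<^esub> S = compose (carrier H) T S"
  and L_add: "T \<oplus>\<^bsub>L\<^esub> S = (\<lambda>x\<in>carrier H. T x \<oplus>\<^bsub>H\<^esub> S x)"
  and L_zero: "\<zero>\<^bsub>L\<^esub> = (\<lambda>x\<in>carrier H. \<zero>\<^bsub>H\<^esub>)"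
  by (simp_all add: adjointable_operators_def)

lemma carrier_L_PiE: "T \<in> carrier L \<Longrightarrow> T \<in> carrier H \<rightarrow>\<^sub>E carrier H"
  by (auto simp: carrier_L is_adjoint_def)

lemma is_adjointD:
  assumes "is_adjoint H T S" "X \<in> carrier H"
  shows "T X \<in> carrier H" "S X \<in> carrier H"
    "Y \<in> carrier H \<Longrightarrow> inner_prod H (T X) Y = inner_prod H X (S Y)"
proof -
  have S: "T \<in> carrier H \<rightarrow>\<^sub>E carrier H" "S \<in> carrier H \<rightarrow>\<^sub>E carrier H"
    "\<forall>X\<in>carrier H. \<forall>Y\<in>carrier H. inner_prod H (T X) Y = inner_prod H X (S Y)"
    using assms(1) unfolding is_adjoint_def by auto
  show "T X \<in> carrier H" "S X \<in> carrier H" using S(1,2)[THEN PiE_mem, OF assms(2)] .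
  show "Y \<in> carrier H \<Longrightarrow> inner_prod H (T X) Y = inner_prod H X (S Y)"
    using S(3) assms(2) by blast
qed

lemma is_adjointI:
  assumes "\<And>X. X \<in> carrier H \<Longrightarrow> T X \<in> carrier H" "\<And>X. X \<in> carrier H \<Longrightarrow> S X \<in> carrier H"
    "T \<in> extensional (carrier H)" "S \<in> extensional (carrier H)"
    "\<And>X Y. X \<in> carrier H \<Longrightarrow> Y \<in> carrier H \<Longrightarrow> inner_prod H (T X) Y = inner_prod H X (S Y)"
  shows "is_adjoint H T S"
  unfolding is_adjoint_def PiE_iff by (intro conjI ballI assms)

lemma L_mult_closed: assumes "T \<in> carrier L" "T' \<in> carrier L" shows "T \<otimes>\<^bsub>L\<^esub> T' \<in> carrier L"
proof -
  obtain S S' where S: "is_adjoint H T S" "is_adjoint H T' S'" using assms unfolding carrier_L by blast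
  have "is_adjoint H (compose (carrier H) T T') (compose (carrier H) S' S)"
    by (rule is_adjointI) (simp_all add: compose_def is_adjointD[OF S(1)] is_adjointD[OF S(2)])
  then show ?thesis unfolding carrier_L L_mult by blast
qed

lemma H_add_closed: "X \<in> carrier H \<Longrightarrow> Y \<in> carrier H \<Longrightarrow> X \<oplus>\<^bsub>H\<^esub> Y \<in> carrier H"
  by (auto simp: carrier_H add_H)

lemma inner_add_left: "X \<in> carrier H \<Longrightarrow> Y \<in> carrier H \<Longrightarrow> Z \<in> carrier H \<Longrightarrow>
   inner_prod H (X \<oplus>\<^bsub>H\<^esub> Y) Z = inner_prod H X Z \<oplus> inner_prod H Y Z"
  and inner_add_right: "X \<in> carrier H \<Longrightarrow> Y \<in> carrier H \<Longrightarrow> Z \<in> carrier H \<Longrightarrow>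
   inner_prod H Z (X \<oplus>\<^bsub>H\<^esub> Y) = inner_prod H Z X \<oplus> inner_prod H Z Y"
  by (auto elim!: carrier_HE simp: add_H inner_H star_add l_distr r_distr E_add)

text \<open>This is the structure that finite sums of operators rest on; with it the sums in
  \<open>carrier_B\<close> are again adjointable.\<close>

lemma abelian_monoid_L: "abelian_monoid L"
proof (rule abelian_monoidI)
  fix T T' assume T: "T \<in> carrier L" "T' \<in> carrier L"
  then obtain S S' where S: "is_adjoint H T S" "is_adjoint H T' S'" unfolding carrier_L by blast
  have "is_adjoint H (T \<oplus>\<^bsub>L\<^esub> T') (S \<oplus>\<^bsub>L\<^esub> S')"
    by (rule is_adjointI)
       (simp_all add: L_add H_add_closed inner_add_left inner_add_right is_adjointD[OF S(1)] is_adjointD[OF S(2)])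
  then show "T \<oplus>\<^bsub>L\<^esub> T' \<in> carrier L" unfolding carrier_L by blast
next
  have "is_adjoint H \<zero>\<^bsub>L\<^esub> \<zero>\<^bsub>L\<^esub>"
    by (rule is_adjointI) (auto simp: L_zero zero_H inner_H elim!: carrier_HE)
  then show "\<zero>\<^bsub>L\<^esub> \<in> carrier L" unfolding carrier_L by blast
next
  fix T assume "T \<in> carrier L"
  then have T: "T \<in> carrier H \<rightarrow>\<^sub>E carrier H" by (rule carrier_L_PiE)
  have "\<zero>\<^bsub>H\<^esub> \<oplus>\<^bsub>H\<^esub> X = X" if "X \<in> carrier H" for X
    using that by (auto simp: zero_H add_H elim!: carrier_HE)
  then show "\<zero>\<^bsub>L\<^esub> \<oplus>\<^bsub>L\<^esub> T = T"
    using T by (intro extensionalityI[of _ "carrier H"]) (auto simp: L_add L_zero PiE_iff)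
next
  fix T T' assume "T \<in> carrier L" "T' \<in> carrier L"
  note T = this[THEN carrier_L_PiE]
  have "X \<oplus>\<^bsub>H\<^esub> Y = Y \<oplus>\<^bsub>H\<^esub> X" if "X \<in> carrier H" "Y \<in> carrier H" for X Y
    using that by (auto simp: add_H a_comm elim!: carrier_HE)
  then show "T \<oplus>\<^bsub>L\<^esub> T' = T' \<oplus>\<^bsub>L\<^esub> T"
    using T by (intro extensionalityI[of _ "carrier H"]) (auto simp: L_add PiE_iff)
next
  fix T T' T'' assume "T \<in> carrier L" "T' \<in> carrier L" "T'' \<in> carrier L"
  note T = this[THEN carrier_L_PiE]
  have "X \<oplus>\<^bsub>H\<^esub> Y \<oplus>\<^bsub>H\<^esub> Z = X \<oplus>\<^bsub>H\<^esub> (Y \<oplus>\<^bsub>H\<^esub> Z)"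
    if "X \<in> carrier H" "Y \<in> carrier H" "Z \<in> carrier H" for X Y Z
    using that by (auto simp: add_H a_assoc elim!: carrier_HE)
  then show "T \<oplus>\<^bsub>L\<^esub> T' \<oplus>\<^bsub>L\<^esub> T'' = T \<oplus>\<^bsub>L\<^esub> (T' \<oplus>\<^bsub>L\<^esub> T'')"
    using T by (intro extensionalityI[of _ "carrier H"]) (auto simp: L_add PiE_iff)
qed

section \<open>The basic construction and its norm\<close>

lemma carrier_B: "carrier B = {\<Oplus>\<^bsub>L\<^esub>j\<in>{..<n}. left_mult A P E (x j) \<otimes>\<^bsub>L\<^esub> jones_projection A P E \<otimes>\<^bsub>L\<^esub> left_mult A P E (y j)
            | (n :: nat) x y. x \<in> {..<n} \<rightarrow> carrier A \<and> y \<in> {..<n} \<rightarrow> carrier A}"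
  by (simp add: basic_construction_def Let_def)

lemma B_mult: "T \<otimes>\<^bsub>B\<^esub> S = compose (carrier H) T S"
  and B_add: "T \<oplus>\<^bsub>B\<^esub> S = (\<lambda>x\<in>carrier H. T x \<oplus>\<^bsub>H\<^esub> S x)"
  and nrm_B: "nrm B T = (SUP x\<in>{x \<in> carrier H. module_norm (A\<lparr>carrier := P\<rparr>) H x \<le> 1}.
      module_norm (A\<lparr>carrier := P\<rparr>) H (T x))"
  by (simp_all add: basic_construction_def Let_def adjointable_operators_def)

lemma zero_mem_B: "(\<lambda>x\<in>carrier H. \<zero>\<^bsub>H\<^esub>) \<in> carrier B"
proof -
  interpret L: abelian_monoid L by (rule abelian_monoid_L)
  show ?thesis
    unfolding carrier_B L_zero[symmetric]
    \<comment> \<open>The zero operator is the empty sum.\<close>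
    by (rule CollectI, rule exI[of _ "0::nat"]) auto
qed

lemma carrier_B_PiE: assumes "T \<in> carrier B" shows "T \<in> carrier H \<rightarrow>\<^sub>E carrier H"
proof -
  interpret L: abelian_monoid L by (rule abelian_monoid_L)
  have "left_mult A P E x \<in> carrier L" if "x \<in> carrier A" for x
    using left_mult_adjoint[OF that] by (auto simp: carrier_L)
  moreover have "jones_projection A P E \<in> carrier L"
    using jones_projection_adjoint by (auto simp: carrier_L)
  ultimately have "T \<in> carrier L"
    using assms unfolding carrier_B by (auto intro!: L.finsum_closed L_mult_closed)
  then show ?thesis by (rule carrier_L_PiE)
qed

lemma zero_H_add: "X \<in> carrier H \<Longrightarrow> \<zero>\<^bsub>H\<^esub> \<oplus>\<^bsub>H\<^esub> X = X"
  by (auto simp: zero_H add_H elim!: carrier_HE)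

lemma nrm_B_zero: "nrm B (\<lambda>x\<in>carrier H. \<zero>\<^bsub>H\<^esub>) = 0"
proof -
  have "cls \<zero> \<in> {x \<in> carrier H. module_norm (A\<lparr>carrier := P\<rparr>) H x \<le> 1}"
    by (simp add: module_norm_cls enorm_def)
  moreover have "module_norm (A\<lparr>carrier := P\<rparr>) H \<zero>\<^bsub>H\<^esub> = 0"
    by (simp add: zero_H module_norm_cls enorm_def)
  ultimately show ?thesis
    unfolding nrm_B by (subst SUP_cong[OF refl, of _ _ "\<lambda>_. 0"]) (auto intro!: cSUP_const)
qed

text \<open>The norm of \<open>B\<close> is a supremum, which is an upper bound only over a bounded
  set; \<open>bd\<close> supplies the boundedness. The C*-unit ball lies in the module unit ball, so
  it may be tested instead.\<close>

lemma enorm_le_nrm_B: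
  assumes T: "\<And>a. a \<in> carrier A \<Longrightarrow> T (cls a) = cls (f a)" "\<And>a. a \<in> carrier A \<Longrightarrow> f a \<in> carrier A"
    and bd: "\<And>a. a \<in> carrier A \<Longrightarrow> nrm A (f a) \<le> M * nrm A a" and M: "0 \<le> M"
    and a: "a \<in> carrier A" "nrm A a \<le> 1"
  shows "enorm (f a) \<le> nrm B T"
proof -
  obtain K where K: "K > 0" "\<And>x. x \<in> carrier A \<Longrightarrow> nrm A x \<le> K * enorm x" using nrm_le_enorm by metis
  have "enorm (f a) = module_norm (A\<lparr>carrier := P\<rparr>) H (T (cls a))"
    using T a by (simp add: module_norm_cls)
  also have "\<dots> \<le> nrm B T"
    unfolding nrm_B
  proof (rule cSUP_upper)
    show "cls a \<in> {x \<in> carrier H. module_norm (A\<lparr>carrier := P\<rparr>) H x \<le> 1}"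
      using a enorm_le_nrm[OF a(1)] by (simp add: module_norm_cls)
    show "bdd_above ((\<lambda>x. module_norm (A\<lparr>carrier := P\<rparr>) H (T x)) `
      {x \<in> carrier H. module_norm (A\<lparr>carrier := P\<rparr>) H x \<le> 1})"
    proof (rule bdd_aboveI2)
      fix X assume "X \<in> {x \<in> carrier H. module_norm (A\<lparr>carrier := P\<rparr>) H x \<le> 1}"
      then obtain b where b: "b \<in> carrier A" "X = cls b" "enorm b \<le> 1"
        by (auto elim!: carrier_HE simp: module_norm_cls)
      \<comment> \<open>\<open>bd\<close> is stated for the C*-norm, whereas \<open>b\<close> is
        bounded in the module norm; \<open>K\<close> converts one into the other.\<close>
      have "enorm (f b) \<le> M * nrm A b"
        using enorm_le_nrm[of "f b"] bd[OF b(1)] T b by fastforce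
      also have "\<dots> \<le> M * (K * 1)"
        using K b M by (intro mult_left_mono order.trans[OF K(2)]) auto
      finally show "module_norm (A\<lparr>carrier := P\<rparr>) H (T X) \<le> M * (K * 1)"
        using T b by (simp add: module_norm_cls)
    qed
  qed
  finally show ?thesis .
qed

end

section \<open>Ultrapowers and the Rokhlin property\<close>

context cstar_algebra
begin

section \<open>Cosets of bounded sequences modulo null sequences\<close>

lemma bseq_iff_ell_infty: "x \<in> carrier (ell_infty C) \<longleftrightarrow> bseq x"
  by (auto simp: ell_infty_def bseq_def bdd_above_def image_subset_iff)

definition ucls :: "nat filter \<Rightarrow> (nat \<Rightarrow> 'a) \<Rightarrow> (nat \<Rightarrow> 'a) set" where
  "ucls \<omega> x = omega_null \<omega> C +>\<^bsub>ell_infty C\<^esub> x"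

lemma mem_omega_null: "h \<in> omega_null \<omega> C \<longleftrightarrow> bseq h \<and> ((\<lambda>n. nrm C (h n)) \<longlongrightarrow> 0) \<omega>"
  by (simp add: omega_null_def bseq_iff_ell_infty)

lemma mem_ucls: assumes x: "bseq x" shows "y \<in> ucls \<omega> x \<longleftrightarrow> approx \<omega> y x"
proof
  assume "y \<in> ucls \<omega> x"
  then obtain h where h: "h \<in> omega_null \<omega> C" "y = (\<lambda>n. h n \<oplus> x n)"
    by (auto simp: ucls_def a_r_coset_def' ell_infty_def)
  then have hb: "bseq h" by (simp add: mem_omega_null)
  then have "nrm C (y n \<ominus> x n) = nrm C (h n)" for n using x h(2) by simp
  then show "approx \<omega> y x" using h hb x by (auto simp: approx_def mem_omega_null)
next
  assume yx: "approx \<omega> y x"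
  then have "(\<lambda>n. y n \<ominus> x n) \<in> omega_null \<omega> C" by (auto simp: approx_def mem_omega_null)
  moreover have "y = (\<lambda>n. (y n \<ominus> x n) \<oplus> x n)" using yx by (auto simp: approx_def)
  ultimately show "y \<in> ucls \<omega> x" by (auto simp: ucls_def a_r_coset_def' ell_infty_def)
qed

lemma ucls_eq_iff: assumes "bseq x" "bseq y" shows "ucls \<omega> x = ucls \<omega> y \<longleftrightarrow> approx \<omega> x y"
proof
  assume "ucls \<omega> x = ucls \<omega> y"
  then have "x \<in> ucls \<omega> y" using mem_ucls[OF assms(1)] approx_refl[OF assms(1)] by blast
  then show "approx \<omega> x y" using mem_ucls[OF assms(2)] by blast
next
  assume xy: "approx \<omega> x y"
  then show "ucls \<omega> x = ucls \<omega> y"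
    unfolding set_eq_iff mem_ucls[OF assms(1)] mem_ucls[OF assms(2)]
    by (intro allI iffI) (erule approx_trans[OF _ xy] approx_trans[OF _ approx_sym[OF xy]])+
qed

lemma carrier_ultrapower: "carrier (ultrapower \<omega> C) = ucls \<omega> ` Collect bseq"
  by (auto simp: ultrapower_def cstar_quotient_def FactRing_def A_RCOSETS_def' ucls_def bseq_iff_ell_infty)

text \<open>Operations on the ultrapower are unions over representatives as well; asymptotically
  equal sequences give one coset.\<close>

lemma UN_ucls:
  assumes x: "bseq x" and f: "\<And>s. approx \<omega> s x \<Longrightarrow> approx \<omega> (f s) y" and y: "bseq y"
  shows "(\<Union>s\<in>ucls \<omega> x. ucls \<omega> (f s)) = ucls \<omega> y"
proof -
  have "ucls \<omega> (f s) = ucls \<omega> y" if "s \<in> ucls \<omega> x" for s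
  proof -
    have "approx \<omega> (f s) y" using f that mem_ucls[OF x] by blast
    then show ?thesis using ucls_eq_iff[OF approxD(1) y] by blast
  qed
  moreover have "x \<in> ucls \<omega> x" using mem_ucls[OF x] approx_refl[OF x] by blast
  ultimately show ?thesis by blast
qed

lemma ucls_mult:
  assumes "bseq x" "bseq y"
  shows "ucls \<omega> x \<otimes>\<^bsub>ultrapower \<omega> C\<^esub> ucls \<omega> y = ucls \<omega> (\<lambda>n. x n \<otimes> y n)"
proof -
  have "ucls \<omega> x \<otimes>\<^bsub>ultrapower \<omega> C\<^esub> ucls \<omega> y = (\<Union>s\<in>ucls \<omega> x. \<Union>t\<in>ucls \<omega> y. ucls \<omega> (\<lambda>n. s n \<otimes> t n))"
    by (simp add: ultrapower_def cstar_quotient_def FactRing_def rcoset_mult_def ucls_def)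
       (simp add: ell_infty_def)
  also have "\<dots> = (\<Union>s\<in>ucls \<omega> x. ucls \<omega> (\<lambda>n. s n \<otimes> y n))"
  proof (rule SUP_cong[OF refl])
    fix s assume "s \<in> ucls \<omega> x"
    then have "bseq s" using mem_ucls[OF assms(1)] approxD(1) by blast
    then show "(\<Union>t\<in>ucls \<omega> y. ucls \<omega> (\<lambda>n. s n \<otimes> t n)) = ucls \<omega> (\<lambda>n. s n \<otimes> y n)"
      using assms by (intro UN_ucls approx_mult approx_refl bseq_mult)
  qed
  also have "\<dots> = ucls \<omega> (\<lambda>n. x n \<otimes> y n)"
    using assms by (intro UN_ucls approx_mult approx_refl bseq_mult)
  finally show ?thesis .
qed

lemma ucls_star:
  assumes "bseq x" shows "star (ultrapower \<omega> C) (ucls \<omega> x) = ucls \<omega> (\<lambda>n. star C (x n))"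
proof -
  have "star (ultrapower \<omega> C) (ucls \<omega> x) = (\<Union>s\<in>ucls \<omega> x. ucls \<omega> (\<lambda>n. star C (s n)))"
    by (simp add: ultrapower_def cstar_quotient_def ucls_def) (simp add: ell_infty_def)
  also have "\<dots> = ucls \<omega> (\<lambda>n. star C (x n))"
    using assms by (intro UN_ucls approx_star bseq_star)
  finally show ?thesis .
qed

lemma ultrapower_zero: "\<zero>\<^bsub>ultrapower \<omega> C\<^esub> = ucls \<omega> (\<lambda>_. \<zero>)"
proof -
  have "h \<in> omega_null \<omega> C \<longleftrightarrow> h \<in> ucls \<omega> (\<lambda>_. \<zero>)" for h
    unfolding mem_ucls[OF bseq_const[OF zero_closed]] by (auto simp: mem_omega_null approx_def a_minus_def)
  then show ?thesis by (auto simp: ultrapower_def cstar_quotient_def FactRing_def)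
qed

lemma ultra_const_ucls: "ultra_const \<omega> C a = ucls \<omega> (\<lambda>_. a)"
  by (simp add: ultra_const_def ucls_def)

lemma positives_ultrapower:
  "positives (ultrapower \<omega> C) = {ucls \<omega> (\<lambda>n. star C (y n) \<otimes> y n) | y. bseq y}"
proof -
  have "star (ultrapower \<omega> C) (ucls \<omega> y) \<otimes>\<^bsub>ultrapower \<omega> C\<^esub> ucls \<omega> y = ucls \<omega> (\<lambda>n. star C (y n) \<otimes> y n)"
    if "bseq y" for y
    using that by (simp add: ucls_star ucls_mult bseq_star)
  then show ?thesis unfolding positives_def carrier_ultrapower by (auto 4 3)
qed

lemma bseq_star_mult: "bseq y \<Longrightarrow> bseq (\<lambda>n. star C (y n) \<otimes> y n)"
  by (intro bseq_mult bseq_star)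

text \<open>\<open>pos_sqrt\<close> is a definite description, so the root must be shown to exist
  and to be unique before it means anything. Existence is coordinatewise; for uniqueness, two roots
  have asymptotically equal squares, and the functional calculus transfers this to the
  roots.\<close>

lemma pos_sqrt_ultrapower:
  assumes y: "bseq y"
  obtains f where "bseq f" "pos_sqrt (ultrapower \<omega> C) (ucls \<omega> (\<lambda>n. star C (y n) \<otimes> y n)) = ucls \<omega> f"
    "approx \<omega> (\<lambda>n. f n \<otimes> f n) (\<lambda>n. star C (y n) \<otimes> y n)"
proof -
  define e where "e = (\<lambda>n. star C (y n) \<otimes> y n)"
  have eb: "bseq e" unfolding e_def by (rule bseq_star_mult[OF y])
  have epos: "pos (e n)" for n unfolding e_def using y by (intro pos_star_mult_self) simp
  let ?Aw = "ultrapower \<omega> C"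
  let ?Q = "\<lambda>b. b \<in> positives ?Aw \<and> b \<otimes>\<^bsub>?Aw\<^esub> b = ucls \<omega> e"
  have Q_E: "\<exists>w. bseq w \<and> b = ucls \<omega> (\<lambda>n. star C (w n) \<otimes> w n) \<and>
      approx \<omega> (\<lambda>n. (star C (w n) \<otimes> w n) \<otimes> (star C (w n) \<otimes> w n)) e" if Q: "?Q b" for b
  proof -
    obtain w where w: "bseq w" "b = ucls \<omega> (\<lambda>n. star C (w n) \<otimes> w n)"
      using Q unfolding positives_ultrapower by blast
    have bb: "bseq (\<lambda>n. star C (w n) \<otimes> w n)" by (rule bseq_star_mult[OF w(1)])
    have "ucls \<omega> (\<lambda>n. (star C (w n) \<otimes> w n) \<otimes> (star C (w n) \<otimes> w n)) = ucls \<omega> e"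
      using Q unfolding w(2) ucls_mult[OF bb bb] by blast
    then show ?thesis using w unfolding ucls_eq_iff[OF bseq_mult[OF bb bb] eb] by blast
  qed
  have "\<exists>!b. ?Q b"
  proof (rule ex_ex1I)
    obtain R where R: "\<And>n. nrm C (e n) \<le> R" using eb by (rule bseqE) blast
    define r where "r = (\<lambda>n. pos_root R (e n))"
    \<comment> \<open>Membership in \<open>positives\<close> needs a bounded sequence whose star
      squares form the root, hence a selfadjoint \<open>s\<close> with square
      \<open>r n\<close>.\<close>
    have "\<exists>s. s \<in> carrier C \<and> star C s = s \<and> r n = s \<otimes> s \<and> (nrm C s)\<^sup>2 \<le> sqrt R" for n
      using pos_root(1)[OF epos R, of n] pos_root(3)[OF epos R, of n] by (metis posE r_def)
    then obtain s where s: "\<And>n. s n \<in> carrier C" "\<And>n. star C (s n) = s n" "\<And>n. r n = s n \<otimes> s n"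
        "\<And>n. (nrm C (s n))\<^sup>2 \<le> sqrt R" by metis
    have sb: "bseq s" by (rule bseqI[of _ "sqrt (sqrt R)"]) (rule s(1) real_le_rsqrt[OF s(4)])+
    have rr: "(\<lambda>n. (star C (s n) \<otimes> s n) \<otimes> (star C (s n) \<otimes> s n)) = e"
      using pos_root(2)[OF epos R] s(2) s(3)[symmetric] by (simp add: r_def)
    have "?Q (ucls \<omega> (\<lambda>n. star C (s n) \<otimes> s n))"
      unfolding ucls_mult[OF bseq_star_mult[OF sb] bseq_star_mult[OF sb]] rr positives_ultrapower
      using sb by blast
    then show "\<exists>b. ?Q b" by blast
  next
    fix b b' assume "?Q b" "?Q b'"
    then obtain w w' where w: "bseq w" "b = ucls \<omega> (\<lambda>n. star C (w n) \<otimes> w n)"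
        "approx \<omega> (\<lambda>n. (star C (w n) \<otimes> w n) \<otimes> (star C (w n) \<otimes> w n)) e"
      and w': "bseq w'" "b' = ucls \<omega> (\<lambda>n. star C (w' n) \<otimes> w' n)"
        "approx \<omega> (\<lambda>n. (star C (w' n) \<otimes> w' n) \<otimes> (star C (w' n) \<otimes> w' n)) e"
      using Q_E by meson
    let ?v = "\<lambda>n. star C (w n) \<otimes> w n" and ?v' = "\<lambda>n. star C (w' n) \<otimes> w' n"
    have vb: "bseq ?v" "bseq ?v'" using w(1) w'(1) by (simp_all add: bseq_star_mult)
    obtain S where S: "S > 0" "\<And>n. nrm C (?v n) \<le> S" using vb(1) by (rule bseqE) blast
    obtain S' where S': "S' > 0" "\<And>n. nrm C (?v' n) \<le> S'" using vb(2) by (rule bseqE) blast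
    \<comment> \<open>A common bound puts both squares under one functional calculus, on the
      interval of radius \<open>T\<^sup>2\<close>.\<close>
    define T where "T = S + S'"
    have vT: "nrm C (?v n) \<le> T" "nrm C (?v' n) \<le> T" for n
      using S(1) S(2)[of n] S'(1) S'(2)[of n] by (simp_all add: T_def)
    have vp: "pos (?v n)" "pos (?v' n)" for n
      using w(1) w'(1) by (auto intro: pos_star_mult_self)
    have sa: "selfadjoint_le (T\<^sup>2) (u \<otimes> u)" if "pos u" "nrm C u \<le> T" for u
    proof (rule selfadjoint_leI)
      show "nrm C (u \<otimes> u) \<le> T\<^sup>2"
        using that unfolding power2_eq_square by (intro nrm_mult_le) auto
    qed (use that in \<open>auto simp: star_mult\<close>)
    have "approx \<omega> (\<lambda>n. ?v n \<otimes> ?v n) (\<lambda>n. ?v' n \<otimes> ?v' n)"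
      using w(3) approx_sym[OF w'(3)] by (rule approx_trans)
    then have "approx \<omega> (\<lambda>n. cfc (T\<^sup>2) (?v n \<otimes> ?v n) (\<lambda>t. sqrt (max 0 t)))
        (\<lambda>n. cfc (T\<^sup>2) (?v' n \<otimes> ?v' n) (\<lambda>t. sqrt (max 0 t)))"
      by (rule approx_cfc) (intro sa vp vT continuous_intros)+
    moreover have "cfc (T\<^sup>2) (u \<otimes> u) (\<lambda>t. sqrt (max 0 t)) = u" if "pos u" "nrm C u \<le> T" for u
      using pos_root_square[OF that] by (simp add: pos_root_def)
    ultimately have "approx \<omega> ?v ?v'" using vp vT by simp
    then show "b = b'" unfolding w(2) w'(2) ucls_eq_iff[OF vb] .
  qed
  then have "?Q (pos_sqrt ?Aw (ucls \<omega> e))" unfolding pos_sqrt_def by (rule theI')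
  then obtain w where w: "bseq w" "pos_sqrt ?Aw (ucls \<omega> e) = ucls \<omega> (\<lambda>n. star C (w n) \<otimes> w n)"
      "approx \<omega> (\<lambda>n. (star C (w n) \<otimes> w n) \<otimes> (star C (w n) \<otimes> w n)) e"
    using Q_E by meson
  show ?thesis
    using that[of "\<lambda>n. star C (w n) \<otimes> w n"] w bseq_star_mult[OF w(1)] unfolding e_def by blast
qed

end

context index_finite_expectation
begin

text \<open>The zero sequence is null, so \<open>T\<close> lies in its own coset. The statement
  covers arbitrary maps on the module; left multiplications and compositions need not first be
  written as sums of the spanning operators.\<close>

lemma mem_coset_B:
  assumes "\<And>n. T n \<in> carrier H \<rightarrow>\<^sub>E carrier H"
  shows "T \<in> omega_null \<omega> B +>\<^bsub>ell_infty B\<^esub> T"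
proof -
  let ?z = "\<lambda>n :: nat. \<lambda>x\<in>carrier H. \<zero>\<^bsub>H\<^esub>"
  have "?z \<in> omega_null \<omega> B"
    by (simp add: omega_null_def ell_infty_def zero_mem_B nrm_B_zero image_subset_iff)
  moreover have "T = (\<lambda>n. ?z n \<oplus>\<^bsub>B\<^esub> T n)"
  proof
    fix n
    show "T n = ?z n \<oplus>\<^bsub>B\<^esub> T n"
      by (rule extensionalityI[of _ "carrier H"])
         (use assms[of n] in \<open>auto simp: B_add PiE_iff zero_H_add\<close>)
  qed
  ultimately show ?thesis by (auto simp: a_r_coset_def' ell_infty_def)
qed

text \<open>A product of cosets is a union of cosets of products, so it contains the product of
  representatives. Membership is enough: an equation in the ultrapower is read below as a statement
  that a representative of one side belongs to the other.\<close>

lemma mem_mult_Bw: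
  assumes "S \<in> X" "T \<in> Y" "\<And>n. compose (carrier H) (S n) (T n) \<in> carrier H \<rightarrow>\<^sub>E carrier H"
  shows "(\<lambda>n. compose (carrier H) (S n) (T n)) \<in> X \<otimes>\<^bsub>ultrapower \<omega> B\<^esub> Y"
proof -
  have "(\<lambda>n. compose (carrier H) (S n) (T n)) \<in> omega_null \<omega> B +>\<^bsub>ell_infty B\<^esub> (S \<otimes>\<^bsub>ell_infty B\<^esub> T)"
    using mem_coset_B[OF assms(3)] by (simp add: ell_infty_def B_mult)
  then show ?thesis
    using assms(1,2) by (auto simp: ultrapower_def cstar_quotient_def FactRing_def rcoset_mult_def)
qed

lemma mem_ultra_map_left_mult:
  assumes "x \<in> X" "bseq x"
  shows "(\<lambda>n. left_mult A P E (x n)) \<in> ultra_map \<omega> B (left_mult A P E) X"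
  unfolding ultra_map_def
  by (rule UN_I[OF assms(1)], rule mem_coset_B, rule left_mult_PiE, rule bseq_carrier[OF assms(2)])

lemma compose_PiE: "S \<in> carrier H \<rightarrow>\<^sub>E carrier H \<Longrightarrow> T \<in> carrier H \<rightarrow>\<^sub>E carrier H \<Longrightarrow>
    compose (carrier H) S T \<in> carrier H \<rightarrow>\<^sub>E carrier H"
  by (auto simp: compose_def PiE_iff)

lemma mem_ultra_mapE:
  assumes "Z \<in> ultra_map \<omega> B (left_mult A P E) X"
  obtains x h where "x \<in> X" "\<And>n. h n \<in> carrier B" "((\<lambda>n. nrm B (h n)) \<longlongrightarrow> 0) \<omega>"
    "\<And>n. Z n = h n \<oplus>\<^bsub>B\<^esub> left_mult A P E (x n)"
proof -
  obtain x where x: "x \<in> X" "Z \<in> omega_null \<omega> B +>\<^bsub>ell_infty B\<^esub> (\<lambda>n. left_mult A P E (x n))"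
    using assms unfolding ultra_map_def by (rule UN_E)
  obtain h where h: "h \<in> omega_null \<omega> B" "Z = h \<oplus>\<^bsub>ell_infty B\<^esub> (\<lambda>n. left_mult A P E (x n))"
    using x(2) unfolding a_r_coset_def' by blast
  have "range h \<subseteq> carrier B" "((\<lambda>n. nrm B (h n)) \<longlongrightarrow> 0) \<omega>"
    using h(1) unfolding omega_null_def ell_infty_def by simp_all
  moreover have "Z n = h n \<oplus>\<^bsub>B\<^esub> left_mult A P E (x n)" for n
    unfolding h(2) ell_infty_def by simp
  ultimately show ?thesis using x(1) by (intro that[of x h]) auto
qed

text \<open>The Rokhlin property at the unit, translated into sequences in \<open>A\<close>. Its
  operator identity says that a product of operators differs from left multiplication by a null
  sequence \<open>h\<close>; evaluated on classes of elements of \<open>A\<close>, this is an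
  inequality whose error is proportional to the norm of the argument.\<close>

lemma Rokhlin_sequences:
  assumes \<omega>: "\<omega> \<noteq> bot" and one: "\<one> \<noteq> \<zero>" and R: "weak_tracial_Rokhlin \<omega> A P E"
  obtains e f \<delta> where "bseq e" "bseq f" "\<And>n. star A (e n) = e n"
    "\<And>x. x \<in> carrier A \<Longrightarrow> approx \<omega> (\<lambda>n. e n \<otimes> x) (\<lambda>n. x \<otimes> e n)"
    "\<not> approx \<omega> e (\<lambda>_. \<zero>)" "approx \<omega> (\<lambda>n. f n \<otimes> f n) e" "(\<delta> \<longlongrightarrow> 0) \<omega>"
    "\<And>n x. x \<in> carrier A \<Longrightarrow>
      nrm A (index_elt A E \<otimes> (f n \<otimes> E (f n \<otimes> x)) \<ominus> e n \<otimes> x) \<le> \<delta> n * nrm A x"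
proof -
  let ?Aw = "ultrapower \<omega> A" and ?Bw = "ultrapower \<omega> B"
  let ?lam = "ultra_map \<omega> B (left_mult A P E)"
  define z where "z = index_elt A E"
  have zC: "z \<in> carrier A" by (simp add: z_def)
  \<comment> \<open>The unit of the ultrapower, presented as a star square, is the nonzero positive
    element to which the property is applied.\<close>
  have mem: "ucls \<omega> (\<lambda>n. star A \<one> \<otimes> \<one>) \<in> positives ?Aw"
    unfolding positives_ultrapower by (intro CollectI exI[of _ "\<lambda>_. \<one>"]) simp
  have ne: "ucls \<omega> (\<lambda>n. star A \<one> \<otimes> \<one>) \<noteq> \<zero>\<^bsub>?Aw\<^esub>"
    using approx_const_eq[of \<omega> "\<one>" "\<zero>"] \<omega> one by (auto simp: ultrapower_zero ucls_eq_iff)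
  note R' = mp[OF bspec[OF R[unfolded weak_tracial_Rokhlin_def Let_def z_def[symmetric]] mem] ne]
  from R' obtain X where X: "X \<in> positives ?Aw" "X \<noteq> \<zero>\<^bsub>?Aw\<^esub>"
      "\<forall>x\<in>carrier A. X \<otimes>\<^bsub>?Aw\<^esub> ultra_const \<omega> A x = ultra_const \<omega> A x \<otimes>\<^bsub>?Aw\<^esub> X"
      "?lam (ultra_const \<omega> A z) \<otimes>\<^bsub>?Bw\<^esub> (?lam (pos_sqrt ?Aw X) \<otimes>\<^bsub>?Bw\<^esub>
        ultra_const \<omega> B (jones_projection A P E) \<otimes>\<^bsub>?Bw\<^esub> ?lam (pos_sqrt ?Aw X)) = ?lam X"
    by (elim bexE conjE) (rule that; assumption)
  obtain y where y: "bseq y" "X = ucls \<omega> (\<lambda>n. star A (y n) \<otimes> y n)"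
    using X(1) unfolding positives_ultrapower by blast
  define e where "e = (\<lambda>n. star A (y n) \<otimes> y n)"
  have eb: "bseq e" unfolding e_def by (rule bseq_star_mult[OF y(1)])
  have Xe: "X = ucls \<omega> e" by (simp add: e_def y(2))
  obtain f where f: "bseq f" "pos_sqrt ?Aw X = ucls \<omega> f" "approx \<omega> (\<lambda>n. f n \<otimes> f n) e"
    unfolding Xe e_def using pos_sqrt_ultrapower[OF y(1)] by blast
  have fC: "f n \<in> carrier A" for n using f(1) by simp
  let ?l = "left_mult A P E" and ?j = "jones_projection A P E"
  let ?Z = "\<lambda>n. compose (carrier H) (?l z)
     (compose (carrier H) (compose (carrier H) (?l (f n)) ?j) (?l (f n)))"
  \<comment> \<open>\<open>?Z\<close> is built from representatives of the factors on the left of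
    the Rokhlin identity, hence belongs to its right side.\<close>
  have "?Z \<in> ?lam X"
  proof -
    have 1: "(\<lambda>n. ?l (f n)) \<in> ?lam (ucls \<omega> f)"
      using mem_ucls[OF f(1)] approx_refl[OF f(1)] f(1) by (intro mem_ultra_map_left_mult) auto
    have 2: "(\<lambda>n. ?j) \<in> ultra_const \<omega> B ?j"
      unfolding ultra_const_def by (rule mem_coset_B) (rule jones_projection_PiE)
    have 3: "(\<lambda>n. ?l z) \<in> ?lam (ultra_const \<omega> A z)"
      using zC mem_ultra_map_left_mult[of "\<lambda>n. z" "ucls \<omega> (\<lambda>n. z)" \<omega>]
      by (simp add: ultra_const_ucls mem_ucls approx_refl)
    show ?thesis
      unfolding X(4)[symmetric] f(2)
      by (intro mem_mult_Bw 1 2 3 compose_PiE left_mult_PiE jones_projection_PiE zC fC)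
  qed
  then obtain x h where x: "x \<in> X" and h: "\<And>n. h n \<in> carrier B" "((\<lambda>n. nrm B (h n)) \<longlongrightarrow> 0) \<omega>"
    and Z: "\<And>n. ?Z n = h n \<oplus>\<^bsub>B\<^esub> ?l (x n)"
    by (rule mem_ultra_mapE) blast
  have xe: "approx \<omega> x e" using x mem_ucls[OF eb] by (simp add: Xe)
  have xC: "x n \<in> carrier A" for n using approxD(1)[OF xe] by simp
  \<comment> \<open>The null operator \<open>h n\<close> as a map on \<open>A\<close>;
    \<open>x\<close> is the representative of \<open>X\<close> that accompanies
    \<open>h\<close>.\<close>
  define T where "T = (\<lambda>n a. z \<otimes> (f n \<otimes> E (f n \<otimes> a)) \<ominus> x n \<otimes> a)"
  have TC: "T n a \<in> carrier A" if "a \<in> carrier A" for n a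
    using that zC fC xC by (simp add: T_def)
  have hT: "h n (cls a) = cls (T n a)" if a: "a \<in> carrier A" for n a
  proof -
    have "h n (cls a) \<in> carrier H" using carrier_B_PiE[OF h(1)[of n]] a by (auto simp: PiE_iff)
    then obtain c where c: "c \<in> carrier A" "h n (cls a) = cls c" by (rule carrier_HE)
    have "cls (z \<otimes> (f n \<otimes> E (f n \<otimes> a))) = ?Z n (cls a)"
      using a zC fC by (simp add: compose_def left_mult_cls jones_projection_cls)
    also have "\<dots> = cls (c \<oplus> x n \<otimes> a)"
      unfolding Z B_add using a c xC by (simp add: left_mult_cls add_H)
    finally have "z \<otimes> (f n \<otimes> E (f n \<otimes> a)) = c \<oplus> x n \<otimes> a"
      using a c xC zC fC by simp
    then show ?thesis using a c xC by (simp add: T_def)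
  qed
  obtain K where K: "K > 0" "\<And>x. x \<in> carrier A \<Longrightarrow> nrm A x \<le> K * enorm x" using nrm_le_enorm by metis
  have T1: "nrm A (T n a) \<le> K * nrm B (h n)" if a: "a \<in> carrier A" "nrm A a \<le> 1" for n a
  proof -
    \<comment> \<open>This bound varies with n. It serves only to make the supremum in
      \<open>nrm B (h n)\<close> one over a bounded set.\<close>
    define M where "M = nrm A z * (nrm A (f n) * (2 * nrm A (f n))) + nrm A (x n)"
    have nn: "0 \<le> nrm A z" "0 \<le> nrm A (f n)" "0 \<le> nrm A (x n)" using zC fC xC nrm_nonneg by auto
    have "nrm A (T n b) \<le> M * nrm A b" if b: "b \<in> carrier A" for b
    proof -
      have "nrm A (E (f n \<otimes> b)) \<le> 2 * (nrm A (f n) * nrm A b)"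
        using nrm_E_le[of "f n \<otimes> b"] nrm_mult[of "f n" b] b fC[of n] by simp
      then have "nrm A (z \<otimes> (f n \<otimes> E (f n \<otimes> b))) \<le> nrm A z * (nrm A (f n) * (2 * (nrm A (f n) * nrm A b)))"
        using b zC fC by (intro nrm_mult_le) auto
      moreover have "nrm A (x n \<otimes> b) \<le> nrm A (x n) * nrm A b" using b xC by (intro nrm_mult) auto
      moreover have "nrm A (T n b) \<le> nrm A (z \<otimes> (f n \<otimes> E (f n \<otimes> b))) + nrm A (x n \<otimes> b)"
        unfolding T_def using b zC fC xC by (intro nrm_diff_triangle) auto
      ultimately show ?thesis by (simp add: M_def algebra_simps)
    qed
    then have "enorm (T n a) \<le> nrm B (h n)"
      using hT TC a nn by (intro enorm_le_nrm_B[where M = M]) (auto simp: M_def)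
    then have "K * enorm (T n a) \<le> K * nrm B (h n)" using K(1) by simp
    then show ?thesis using K(2)[OF TC[OF a(1)], of n] by linarith
  qed
  have T2: "nrm A (T n a) \<le> K * nrm B (h n) * nrm A a" if a: "a \<in> carrier A" for n a
    by (rule nrm_le_of_homogeneous[OF TC _ T1 a])
       (use zC fC xC in \<open>simp_all add: T_def to_smult E_smult mult.commute\<close>)
  \<comment> \<open>The second summand pays for replacing \<open>x n\<close> by
    \<open>e n\<close>.\<close>
  define \<delta> where "\<delta> = (\<lambda>n. K * nrm B (h n) + nrm A (x n \<ominus> e n))"
  show ?thesis
  proof (rule that[OF eb f(1) _ _ _ f(3)])
    show "star A (e n) = e n" for n using y(1) by (simp add: e_def star_mult)
    show "approx \<omega> (\<lambda>n. e n \<otimes> a) (\<lambda>n. a \<otimes> e n)" if a: "a \<in> carrier A" for a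
      using bspec[OF X(3) a] eb a
      by (simp add: Xe ultra_const_ucls ucls_mult ucls_eq_iff bseq_mult)
    show "\<not> approx \<omega> e (\<lambda>_. \<zero>)"
      using X(2) ucls_eq_iff[OF eb bseq_const[OF zero_closed]] by (simp add: Xe ultrapower_zero)
    show "(\<delta> \<longlongrightarrow> 0) \<omega>"
      unfolding \<delta>_def by (intro tendsto_add_zero tendsto_mult_right_zero h(2) approxD(3)[OF xe])
    fix n a assume a: "a \<in> carrier A"
    have eC: "e n \<in> carrier A" using eb by simp
    let ?u = "z \<otimes> (f n \<otimes> E (f n \<otimes> a))"
    have "nrm A (?u \<ominus> e n \<otimes> a) \<le> nrm A (?u \<ominus> x n \<otimes> a) + nrm A (x n \<otimes> a \<ominus> e n \<otimes> a)"
      using a zC fC xC eC by (intro nrm_diff_trans) auto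
    also have "nrm A (?u \<ominus> x n \<otimes> a) \<le> K * nrm B (h n) * nrm A a"
      using T2[OF a, of n] by (simp add: T_def)
    also have "x n \<otimes> a \<ominus> e n \<otimes> a = (x n \<ominus> e n) \<otimes> a"
      using a xC[of n] eC by (simp add: to_smult l_distr)
    also have "nrm A ((x n \<ominus> e n) \<otimes> a) \<le> nrm A (x n \<ominus> e n) * nrm A a"
      using a xC[of n] eC by (intro nrm_mult) auto
    finally show "nrm A (index_elt A E \<otimes> (f n \<otimes> E (f n \<otimes> a)) \<ominus> e n \<otimes> a) \<le> \<delta> n * nrm A a"
      by (simp add: z_def[symmetric] \<delta>_def distrib_right)
  qed
qed

end

section \<open>Proper ideals of the subalgebra\<close>

context index_finite_expectation
begin

text \<open>A Neumann series argument, with the series replaced by a fixed point.\<close>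

lemma right_inverse_near_one:
  assumes p: "p \<in> carrier A" "nrm A (\<one> \<ominus> p) < 1"
  obtains x where "x \<in> carrier A" "p \<otimes> x = \<one>"
proof -
  interpret M: Metric_space "carrier A" "cdist A" by (rule Metric_space_cdist)
  define g where "g = \<one> \<ominus> p"
  have g: "g \<in> carrier A" using p by (simp add: g_def)
  have "\<exists>x\<in>carrier A. \<one> \<oplus> g \<otimes> x = x"
  proof (rule M.contraction_fixed_point[OF complete])
    show "0 \<le> nrm A g" "nrm A g < 1" using p g by (simp_all add: g_def nrm_nonneg)
    fix x y assume xy: "x \<in> carrier A" "y \<in> carrier A"
    have "(\<one> \<oplus> g \<otimes> x) \<ominus> (\<one> \<oplus> g \<otimes> y) = (\<one> \<ominus> \<one>) \<oplus> g \<otimes> (x \<ominus> y)"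
      using xy g by (simp add: to_smult r_distr a_ac)
    then have "(\<one> \<oplus> g \<otimes> x) \<ominus> (\<one> \<oplus> g \<otimes> y) = g \<otimes> (x \<ominus> y)"
      using xy g by (simp add: a_minus_def r_neg)
    then show "cdist A (\<one> \<oplus> g \<otimes> x) (\<one> \<oplus> g \<otimes> y) \<le> nrm A g * cdist A x y"
      using xy g nrm_mult[of g "x \<ominus> y"] by (simp add: cdist_def)
  qed (use g in auto)
  then obtain x where x: "x \<in> carrier A" "\<one> \<oplus> g \<otimes> x = x" by blast
  have "\<one> = (\<one> \<oplus> g \<otimes> x) \<ominus> g \<otimes> x" using x(1) g by simp
  also have "\<dots> = x \<ominus> g \<otimes> x" by (simp only: x(2))
  also have "g \<otimes> x = x \<ominus> p \<otimes> x" using x(1) p by (simp add: g_def to_smult l_distr)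
  also have "x \<ominus> (x \<ominus> p \<otimes> x) = p \<otimes> x" using x(1) p by simp
  finally show ?thesis using that x(1) by simp
qed

end

locale proper_ideal = index_finite_expectation A P E for A :: "'a cstar" (structure) and P E +
  fixes I
  assumes ideal: "ideal I (A\<lparr>carrier := P\<rparr>)"
    and proper: "I \<noteq> P"
    and simple: "simple_cstar A"
begin

section \<open>Elements of the ideal and of the left ideal it generates\<close>

lemma I_P [simp]: "i \<in> I \<Longrightarrow> i \<in> P"
  using ideal.axioms(1)[OF ideal, THEN additive_subgroup.a_subset] by auto

lemma I_carrier [simp]: "i \<in> I \<Longrightarrow> i \<in> carrier A"
  by (intro P_carrier I_P)

lemma I_zero: "\<zero> \<in> I"
  using ideal.axioms(1)[OF ideal, THEN additive_subgroup.zero_closed] by simp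

lemma I_add: "i \<in> I \<Longrightarrow> j \<in> I \<Longrightarrow> i \<oplus> j \<in> I"
  using ideal.axioms(1)[OF ideal, THEN additive_subgroup.a_closed] by simp

lemma I_left: "i \<in> I \<Longrightarrow> p \<in> P \<Longrightarrow> p \<otimes> i \<in> I"
  using ideal.I_l_closed[OF ideal] by simp

lemma I_right: "i \<in> I \<Longrightarrow> p \<in> P \<Longrightarrow> i \<otimes> p \<in> I"
  using ideal.I_r_closed[OF ideal] by simp

lemma one_notin_I: "\<one> \<notin> I"
proof
  assume "\<one> \<in> I"
  have "P \<subseteq> I"
  proof
    fix p assume p: "p \<in> P"
    have "\<one> \<otimes> p \<in> I" by (rule I_right) fact+
    then show "p \<in> I" using p by simp
  qed
  moreover have "I \<subseteq> P" by (rule subsetI) (rule I_P)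
  ultimately have "I = P" by (intro subset_antisym)
  with proper show False by (rule notE)
qed

text \<open>The left ideal \<open>A I\<close> enters only through the following, possibly larger, left ideal.\<close>

definition J where "J = {w \<in> carrier A. \<forall>a\<in>carrier A. E (a \<otimes> w) \<in> I}"

lemma J_carrier: "w \<in> J \<Longrightarrow> w \<in> carrier A"
  by (simp add: J_def)

lemma J_zero: "\<zero> \<in> J"
  by (simp add: J_def I_zero)

lemma J_add: "v \<in> J \<Longrightarrow> w \<in> J \<Longrightarrow> v \<oplus> w \<in> J"
  by (simp add: J_def r_distr E_add I_add)

lemma J_left: "w \<in> J \<Longrightarrow> x \<in> carrier A \<Longrightarrow> x \<otimes> w \<in> J"
  by (simp add: J_def m_assoc[symmetric])

text \<open>This is the inclusion of \<open>A I\<close> in \<open>J\<close>: E(a x i) = E(a x)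
  i.\<close>

lemma J_mult_I: "x \<in> carrier A \<Longrightarrow> i \<in> I \<Longrightarrow> x \<otimes> i \<in> J"
  by (simp add: J_def m_assoc[symmetric] E_right I_left)

declare J_carrier [simp]

text \<open>Left multiplication by \<open>x\<close> has norm at most \<open>c\<close> on the quotient of \<open>A\<close> by \<open>J\<close>.\<close>

definition quot_le :: "real \<Rightarrow> 'a \<Rightarrow> bool" where
  "quot_le c x \<longleftrightarrow> (\<forall>y\<in>carrier A. \<forall>\<epsilon>>0. \<exists>w\<in>J. nrm A (x \<otimes> y \<ominus> w) \<le> (c + \<epsilon>) * nrm A y)"

section \<open>Sums, products and limits of norms on the quotient\<close>

lemma quot_leD:
  assumes "quot_le c x" "y \<in> carrier A" "\<epsilon> > 0"
  obtains w where "w \<in> J" "nrm A (x \<otimes> y \<ominus> w) \<le> (c + \<epsilon>) * nrm A y"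
  using assms(1)[unfolded quot_le_def, rule_format, OF assms(2,3)] that by blast

lemma quot_le_nrm: assumes "x \<in> carrier A" "nrm A x \<le> c" shows "quot_le c x"
  unfolding quot_le_def
proof (intro ballI allI impI)
  fix y :: 'a and \<epsilon> :: real assume y: "y \<in> carrier A" and \<epsilon>: "\<epsilon> > 0"
  have "nrm A (x \<otimes> y) \<le> (c + \<epsilon>) * nrm A y"
    using assms(2) \<epsilon> by (intro nrm_mult_le[OF assms(1) y _ order.refl]) simp
  moreover have "x \<otimes> y \<ominus> \<zero> = x \<otimes> y" using assms(1) y by (simp add: a_minus_def)
  ultimately show "\<exists>w\<in>J. nrm A (x \<otimes> y \<ominus> w) \<le> (c + \<epsilon>) * nrm A y"
    using J_zero by metis
qed

lemma quot_le_add: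
  assumes x: "x \<in> carrier A" "quot_le c x" and x': "x' \<in> carrier A" "quot_le d x'"
  shows "quot_le (c + d) (x \<oplus> x')"
  unfolding quot_le_def
proof (intro ballI allI impI)
  fix y :: 'a and \<epsilon> :: real assume y: "y \<in> carrier A" and \<epsilon>: "\<epsilon> > 0"
  obtain w where w: "w \<in> J" "nrm A (x \<otimes> y \<ominus> w) \<le> (c + \<epsilon>/2) * nrm A y"
    using quot_leD[OF x(2) y half_gt_zero[OF \<epsilon>]] .
  obtain w' where w': "w' \<in> J" "nrm A (x' \<otimes> y \<ominus> w') \<le> (d + \<epsilon>/2) * nrm A y"
    using quot_leD[OF x'(2) y half_gt_zero[OF \<epsilon>]] .
  have "(x \<oplus> x') \<otimes> y \<ominus> (w \<oplus> w') = (x \<otimes> y \<ominus> w) \<oplus> (x' \<otimes> y \<ominus> w')"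
    using x x' y w w' by (simp add: to_smult l_distr a_ac)
  then have "nrm A ((x \<oplus> x') \<otimes> y \<ominus> (w \<oplus> w')) \<le> nrm A (x \<otimes> y \<ominus> w) + nrm A (x' \<otimes> y \<ominus> w')"
    using nrm_triangle[of "x \<otimes> y \<ominus> w" "x' \<otimes> y \<ominus> w'"] x x' y w w' by simp
  also have "\<dots> \<le> (c + \<epsilon>/2) * nrm A y + (d + \<epsilon>/2) * nrm A y"
    by (rule add_mono[OF w(2) w'(2)])
  also have "\<dots> = (c + d + \<epsilon>) * nrm A y"
    by (simp add: algebra_simps)
  finally show "\<exists>v\<in>J. nrm A ((x \<oplus> x') \<otimes> y \<ominus> v) \<le> (c + d + \<epsilon>) * nrm A y"
    using J_add[OF w(1) w'(1)] by blast
qed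

text \<open>\<open>J\<close> is a left ideal: the correction \<open>w'\<close> of
  \<open>x' \<otimes> y\<close> becomes \<open>x \<otimes> w'\<close> in \<open>J\<close>, and the
  remainder is then corrected by \<open>w\<close>.\<close>

lemma quot_le_mult:
  assumes x: "x \<in> carrier A" "quot_le c x" "0 \<le> c" and x': "x' \<in> carrier A" "quot_le d x'" "0 \<le> d"
  shows "quot_le (c * d) (x \<otimes> x')"
  unfolding quot_le_def
proof (intro ballI allI impI)
  fix y :: 'a and \<epsilon> :: real assume y: "y \<in> carrier A" and \<epsilon>: "\<epsilon> > 0"
  \<comment> \<open>Chosen so that (c + \<eta>) (d + \<eta>) is at most c d + \<epsilon>.\<close>
  define \<eta> where "\<eta> = min 1 (\<epsilon> / (c + d + 1))"
  have cd: "0 < c + d + 1" using x(3) x'(3) by linarith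
  then have \<eta>: "0 < \<eta>" "\<eta> \<le> 1" using \<epsilon> by (simp_all add: \<eta>_def)
  have "\<eta> \<le> \<epsilon> / (c + d + 1)" by (simp add: \<eta>_def)
  then have \<eta>3: "\<eta> * (c + d + 1) \<le> \<epsilon>" using cd by (simp only: pos_le_divide_eq)
  obtain w' where w': "w' \<in> J" "nrm A (x' \<otimes> y \<ominus> w') \<le> (d + \<eta>) * nrm A y"
    using x'(2) y \<eta>(1) by (rule quot_leD)
  let ?r = "x' \<otimes> y \<ominus> w'"
  have rC: "?r \<in> carrier A" using x' y w' by simp
  obtain w where w: "w \<in> J" "nrm A (x \<otimes> ?r \<ominus> w) \<le> (c + \<eta>) * nrm A ?r"
    using x(2) rC \<eta>(1) by (rule quot_leD)
  have v: "x \<otimes> w' \<oplus> w \<in> J" using w w' x by (intro J_add J_left)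
  have "(x \<otimes> x') \<otimes> y \<ominus> (x \<otimes> w' \<oplus> w) = x \<otimes> ?r \<ominus> w"
    using x x' y w w' by (simp add: to_smult r_distr m_assoc a_ac)
  also have "nrm A (x \<otimes> ?r \<ominus> w) \<le> (c + \<eta>) * ((d + \<eta>) * nrm A y)"
    using w(2) mult_left_mono[OF w'(2), of "c + \<eta>"] x(3) \<eta>(1) by linarith
  also have "\<dots> = ((c + \<eta>) * (d + \<eta>)) * nrm A y" by simp
  also have "\<dots> \<le> (c * d + \<epsilon>) * nrm A y"
  proof (rule mult_right_mono)
    have "(c + \<eta>) * (d + \<eta>) = c * d + \<eta> * (c + d + \<eta>)" by (simp add: algebra_simps)
    also have "\<eta> * (c + d + \<eta>) \<le> \<eta> * (c + d + 1)" using \<eta> by (intro mult_left_mono) auto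
    finally show "(c + \<eta>) * (d + \<eta>) \<le> c * d + \<epsilon>" using \<eta>3 by linarith
  qed (use y nrm_nonneg in simp)
  finally show "\<exists>v\<in>J. nrm A ((x \<otimes> x') \<otimes> y \<ominus> v) \<le> (c * d + \<epsilon>) * nrm A y"
    using v by blast
qed

lemma quot_le_power:
  assumes "x \<in> carrier A" "quot_le c x" "0 \<le> c"
  shows "quot_le (c ^ n) (x [^] (n::nat))"
proof (induction n)
  case 0
  show ?case using nrm_one_le by (simp add: quot_le_nrm)
next
  case (Suc n)
  have "quot_le (c ^ n * c) (x [^] n \<otimes> x)"
    using assms Suc by (intro quot_le_mult) auto
  then show ?case by (simp add: mult.commute)
qed

lemma quot_le_0I:
  assumes "\<And>n. quot_le (c n) x" "c \<longlonglongrightarrow> 0" "x \<in> carrier A"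
  shows "quot_le 0 x"
  unfolding quot_le_def
proof (intro ballI allI impI)
  fix y :: 'a and \<epsilon> :: real assume y: "y \<in> carrier A" and \<epsilon>: "\<epsilon> > 0"
  have "\<forall>\<^sub>F n in sequentially. c n < \<epsilon> / 2" using assms(2) \<epsilon> by (intro order_tendstoD) auto
  then obtain n where n: "c n < \<epsilon> / 2" by (auto simp: eventually_sequentially)
  obtain w where w: "w \<in> J" "nrm A (x \<otimes> y \<ominus> w) \<le> (c n + \<epsilon> / 2) * nrm A y"
    using quot_leD[OF assms(1)[of n] y half_gt_zero[OF \<epsilon>]] .
  have "(c n + \<epsilon> / 2) * nrm A y \<le> (0 + \<epsilon>) * nrm A y"
    using n y nrm_nonneg by (intro mult_right_mono) auto
  then show "\<exists>w\<in>J. nrm A (x \<otimes> y \<ominus> w) \<le> (0 + \<epsilon>) * nrm A y"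
    using w by (intro bexI[OF _ w(1)]) linarith
qed

text \<open>Otherwise some \<open>w\<close> in \<open>J\<close> is near \<open>\<one>\<close>, so
  \<open>E w\<close>, an element of \<open>I\<close>, is near \<open>\<one>\<close> and has a right
  inverse \<open>x\<close>. Since \<open>E w\<close> belongs to \<open>P\<close>, the element
  \<open>E x\<close> of \<open>P\<close> is a right inverse too, and \<open>\<one>\<close> would be
  in \<open>I\<close>.\<close>

lemma not_quot_le_0_one: "\<not> quot_le 0 \<one>"
proof
  assume "quot_le 0 \<one>"
  \<comment> \<open>The distance 1/4 may be doubled by \<open>E\<close> and still stays below
    1.\<close>
  then obtain w where w: "w \<in> J" "nrm A (\<one> \<otimes> \<one> \<ominus> w) \<le> (0 + 1/4) * nrm A \<one>"
    by (rule quot_leD[of 0 "\<one>" "\<one>" "1/4"]) auto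
  have wC: "w \<in> carrier A" using w by simp
  have "nrm A (\<one> \<ominus> w) \<le> 1/4" using w(2) nrm_one_le by simp
  then have "nrm A (\<one> \<ominus> E w) < 1"
    using nrm_E_le[of "\<one> \<ominus> w"] wC by (simp add: E_diff)
  then obtain x where x: "x \<in> carrier A" "E w \<otimes> x = \<one>"
    using wC by (elim right_inverse_near_one[rotated]) auto
  have "E w \<otimes> E x = E (E w \<otimes> x)" using x(1) wC by (simp add: E_left)
  then have "E w \<otimes> E x = \<one>" using x(2) by simp
  moreover have "E (\<one> \<otimes> w) \<in> I" using w(1) unfolding J_def by blast
  ultimately have "\<one> \<in> I" using I_right[of "E w" "E x"] x(1) wC by simp
  then show False using one_notin_I by simp
qed

text \<open>The form in which simplicity is applied, with closedness tested on sequences. Negatives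
  come from multiplication by the scalar -1.\<close>

lemma ideal_of_closed:
  assumes M: "M \<subseteq> carrier A" "M \<noteq> {}" "\<And>x y. x \<in> M \<Longrightarrow> y \<in> M \<Longrightarrow> x \<oplus> y \<in> M"
    "\<And>x a. x \<in> M \<Longrightarrow> a \<in> carrier A \<Longrightarrow> a \<otimes> x \<in> M"
    "\<And>x a. x \<in> M \<Longrightarrow> a \<in> carrier A \<Longrightarrow> x \<otimes> a \<in> M"
    and cl: "\<And>x l. (\<And>n. x n \<in> M) \<Longrightarrow> l \<in> carrier A \<Longrightarrow> (\<lambda>n. nrm A (x n \<ominus> l)) \<longlonglongrightarrow> 0 \<Longrightarrow> l \<in> M"
  shows "M = {\<zero>} \<or> M = carrier A"
proof -
  have "subgroup M (add_monoid A)"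
  proof (rule add.subgroupI)
    fix x assume x: "x \<in> M"
    then have "((-1) \<odot> \<one>) \<otimes> x \<in> M" by (intro M(4)) auto
    moreover have "((-1) \<odot> \<one>) \<otimes> x = \<ominus> x"
      using x M(1) by (auto simp: minus_smult smult_mult_left)
    ultimately show "\<ominus> x \<in> M" by simp
  qed (use M in auto)
  then have "ideal M A"
    by (rule idealI[OF ring_axioms]) (use M in auto)
  moreover have "closedin (norm_topology A) M"
    unfolding closedin_norm_topology_iff using M(1) cl by blast
  ultimately show ?thesis
    using simple unfolding simple_cstar_def by blast
qed

text \<open>The elements acting as zero on the quotient form a closed two-sided ideal without
  \<open>\<one>\<close>, and \<open>A\<close> is simple.\<close>

lemma quot_le_0_imp_zero: assumes "x \<in> carrier A" "quot_le 0 x" shows "x = \<zero>"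
proof -
  let ?M = "{x \<in> carrier A. quot_le 0 x}"
  have "?M = {\<zero>} \<or> ?M = carrier A"
  proof (rule ideal_of_closed)
    show "?M \<noteq> {}" using assms by blast
    show "x \<oplus> y \<in> ?M" if "x \<in> ?M" "y \<in> ?M" for x y
      using that quot_le_add[of x 0 y 0] by simp
    show "a \<otimes> x \<in> ?M" "x \<otimes> a \<in> ?M" if "x \<in> ?M" "a \<in> carrier A" for x a
      using that quot_le_mult[of a "nrm A a" x 0] quot_le_mult[of x 0 a "nrm A a"] quot_le_nrm[of a] nrm_nonneg[of a]
      by simp_all
    fix x l assume x: "\<And>n. x n \<in> ?M" and l: "l \<in> carrier A" "(\<lambda>n. nrm A (x n \<ominus> l)) \<longlonglongrightarrow> 0"
    have "quot_le (nrm A (x n \<ominus> l)) l" for n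
    proof -
      have xn: "x n \<in> carrier A" "quot_le 0 (x n)" using x[of n] by auto
      have lx: "l \<ominus> x n \<in> carrier A" using xn l by simp
      have "quot_le (0 + nrm A (l \<ominus> x n)) (x n \<oplus> (l \<ominus> x n))"
        by (rule quot_le_add[OF xn lx quot_le_nrm[OF lx order.refl]])
      moreover have "x n \<oplus> (l \<ominus> x n) = l" using xn l by (simp add: a_comm[of "x n"])
      ultimately show ?thesis using nrm_diff_commute[OF xn(1) l(1)] by simp
    qed
    then show "l \<in> ?M" using l quot_le_0I[of "\<lambda>n. nrm A (x n \<ominus> l)" l] by simp
  qed auto
  then show ?thesis using assms not_quot_le_0_one by blast
qed

text \<open>Every submultiplicative norm below the C*-norm dominates it on selfadjoint elements: if
  \<open>quot_le c a\<close> with \<open>c < s < nrm A a\<close>, the part \<open>u\<close> of \<open>a\<close> above \<open>s\<close> factors as \<open>a\<^sup>m w\<^sub>m\<close> with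
  \<open>w\<^sub>m = O(s\<^sup>-\<^sup>m)\<close>, so \<open>quot_le 0 u\<close>.\<close>

lemma nrm_le_of_quot_le:
  assumes a: "a \<in> carrier A" "star A a = a" and c: "quot_le c a" "0 \<le> c"
  shows "nrm A a \<le> c"
proof (rule ccontr)
  assume "\<not> nrm A a \<le> c"
  define r where "r = nrm A a"
  have rc: "c < r" using \<open>\<not> nrm A a \<le> c\<close> by (simp add: r_def)
  define s where "s = (c + r) / 2"
  have s: "c < s" "s < r" "0 < s" using rc c(2) by (auto simp: s_def)
  have ar: "selfadjoint_le r a" using a by (intro selfadjoint_leI) (auto simp: r_def)
  \<comment> \<open>\<open>\<kappa>\<close> truncates to [-s, s], and \<open>\<mu>\<close> is what
    the truncation cuts off; \<open>u\<close> is the corresponding part of \<open>a\<close>.\<close>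
  define \<kappa> where "\<kappa> = (\<lambda>t::real. max (-s) (min s t))"
  define \<mu> where "\<mu> = (\<lambda>t. t - \<kappa> t)"
  have \<kappa>c: "continuous_on S \<kappa>" and \<mu>c: "continuous_on S \<mu>" for S
    unfolding \<mu>_def \<kappa>_def by (intro continuous_intros)+
  define u where "u = cfc r a \<mu>"
  have uC: "u \<in> carrier A" unfolding u_def by (rule cfc_closed[OF ar \<mu>c])
  have "quot_le ((c / s) ^ (2 * m) * r) u" for m
  proof -
    \<comment> \<open>The maximum with \<open>s\<close> keeps the denominator away from 0 and equals
      |t| wherever \<open>\<mu>\<close> is nonzero. The exponent is even so that the powers of t and
      |t| agree.\<close>
    let ?w = "\<lambda>t. \<mu> t / (max \<bar>t\<bar> s) ^ (2 * m)"
    have wc: "continuous_on {-r..r} ?w"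
      using s(3) by (intro continuous_intros \<mu>c) auto
    have pc: "continuous_on {-r..r} (\<lambda>t. t ^ (2 * m))" by (intro continuous_intros)
    have wC: "cfc r a ?w \<in> carrier A" by (rule cfc_closed[OF ar wc])
    have wn: "nrm A (cfc r a ?w) \<le> r / s ^ (2 * m)"
    proof (rule nrm_cfc_le[OF ar wc])
      fix t assume t: "\<bar>t\<bar> \<le> r"
      have "\<bar>\<mu> t\<bar> \<le> r" using t s by (auto simp: \<mu>_def \<kappa>_def)
      moreover have "s ^ (2 * m) \<le> (max \<bar>t\<bar> s) ^ (2 * m)" using s by (intro power_mono) auto
      ultimately show "\<bar>?w t\<bar> \<le> r / s ^ (2 * m)"
        using s by (auto simp: abs_divide intro!: frac_le)
    qed
    have "a [^] (2 * m) = cfc r a (\<lambda>t. t ^ (2 * m))"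
      using cfc_poly[OF ar, of "Polynomial.monom 1 (2 * m)" "\<lambda>t. t ^ (2 * m)"] a
      by (simp add: poly_monom pev_monom)
    then have "a [^] (2 * m) \<otimes> cfc r a ?w = cfc r a (\<lambda>t. t ^ (2 * m) * ?w t)"
      using cfc_mult[OF ar pc wc] by simp
    also have "\<dots> = u"
      unfolding u_def
    proof (rule cfc_cong[OF ar])
      show "continuous_on {-r..r} (\<lambda>t. t ^ (2 * m) * ?w t)"
        using pc wc by (rule continuous_on_mult)
      show "t ^ (2 * m) * ?w t = \<mu> t" for t
      proof (cases "\<bar>t\<bar> \<le> s")
        case True
        then have "\<mu> t = 0" by (auto simp: \<mu>_def \<kappa>_def)
        then show ?thesis by simp
      next
        case False
        then have "max \<bar>t\<bar> s ^ (2 * m) = t ^ (2 * m)" by (simp add: power_mult)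
        moreover have "t \<noteq> 0" using False s by auto
        ultimately show ?thesis by simp
      qed
    qed
    finally have eq: "a [^] (2 * m) \<otimes> cfc r a ?w = u" .
    have "quot_le (c ^ (2 * m) * (r / s ^ (2 * m))) (a [^] (2 * m) \<otimes> cfc r a ?w)"
      by (rule quot_le_mult[OF _ quot_le_power[OF a(1) c] _ wC quot_le_nrm[OF wC wn]]) (use a(1) c(2) s in auto)
    then show ?thesis unfolding eq by (simp add: power_divide)
  qed
  moreover have "(\<lambda>m. (c / s) ^ (2 * m) * r) \<longlonglongrightarrow> 0"
  proof (rule tendsto_mult_left_zero)
    have "(\<lambda>m. ((c / s)\<^sup>2) ^ m) \<longlonglongrightarrow> 0"
    proof (rule LIMSEQ_power_zero)
      have "(c / s)\<^sup>2 < 1\<^sup>2" using s c(2) by (intro power_strict_mono) auto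
      then show "norm ((c / s)\<^sup>2) < 1" by simp
    qed
    then show "(\<lambda>m. (c / s) ^ (2 * m)) \<longlonglongrightarrow> 0" by (simp add: power_mult)
  qed
  ultimately have "quot_le 0 u" using uC by (rule quot_le_0I)
  then have u0: "u = \<zero>" using uC by (intro quot_le_0_imp_zero)
  \<comment> \<open>Without its part above \<open>s\<close>, \<open>a\<close> equals its truncation
    and has norm at most \<open>s < r\<close>.\<close>
  have "a = cfc r a (\<lambda>t. \<mu> t + \<kappa> t)" using cfc_id[OF ar] by (simp add: \<mu>_def)
  also have "\<dots> = u \<oplus> cfc r a \<kappa>" unfolding u_def by (rule cfc_add[OF ar \<mu>c \<kappa>c])
  finally have "a = cfc r a \<kappa>" using u0 cfc_closed[OF ar \<kappa>c] by simp
  moreover have "nrm A (cfc r a \<kappa>) \<le> s"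
    by (rule nrm_cfc_le[OF ar \<kappa>c]) (use s in \<open>auto simp: \<kappa>_def\<close>)
  ultimately show False using s by (simp add: r_def)
qed

end

text \<open>The output of \<open>Rokhlin_sequences\<close> except that \<open>e\<close> is not null;
  that statement is held back, since \<open>e_null\<close> contradicts it.\<close>

locale Rokhlin_sequence = proper_ideal A P E I for A :: "'a cstar" (structure) and P E I +
  fixes \<omega> :: "nat filter" and e f :: "nat \<Rightarrow> 'a" and \<delta> :: "nat \<Rightarrow> real"
  assumes e: "bseq e" and f: "bseq f" and e_star: "\<And>n. star A (e n) = e n"
    and e_central: "\<And>x. x \<in> carrier A \<Longrightarrow> approx \<omega> (\<lambda>n. e n \<otimes> x) (\<lambda>n. x \<otimes> e n)"
    and ff: "approx \<omega> (\<lambda>n. f n \<otimes> f n) e" and \<delta>: "(\<delta> \<longlongrightarrow> 0) \<omega>"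
    and cov: "\<And>n x. x \<in> carrier A \<Longrightarrow>
      nrm A (index_elt A E \<otimes> (f n \<otimes> E (f n \<otimes> x)) \<ominus> e n \<otimes> x) \<le> \<delta> n * nrm A x"
begin

abbreviation "z \<equiv> index_elt A E"

lemma eC [simp]: "e n \<in> carrier A" and fC [simp]: "f n \<in> carrier A"
  using e f by auto

lemmas bs = bseq_mult bseq_const bseq_E e f

text \<open>The error in \<open>cov\<close> is proportional to the norm of the argument, so it tends
  to 0 along any bounded sequence, in particular one containing \<open>e\<close> or
  \<open>f\<close>. The absolute value appears because \<delta> carries no sign.\<close>

lemma covariance:
  assumes x: "bseq x"
  shows "approx \<omega> (\<lambda>n. z \<otimes> (f n \<otimes> E (f n \<otimes> x n))) (\<lambda>n. e n \<otimes> x n)"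
proof -
  obtain K where K: "K > 0" "\<And>n. nrm A (x n) \<le> K" using x by (rule bseqE) blast
  have "nrm A (z \<otimes> (f n \<otimes> E (f n \<otimes> x n)) \<ominus> e n \<otimes> x n) \<le> \<bar>\<delta> n\<bar> * K" for n
  proof -
    have "nrm A (z \<otimes> (f n \<otimes> E (f n \<otimes> x n)) \<ominus> e n \<otimes> x n) \<le> \<delta> n * nrm A (x n)"
      using x by (intro cov) simp
    also have "\<dots> \<le> \<bar>\<delta> n\<bar> * K"
      using K x nrm_nonneg[of "x n"] by (intro mult_mono) auto
    finally show ?thesis .
  qed
  moreover have "((\<lambda>n. \<bar>\<delta> n\<bar> * K) \<longlongrightarrow> 0) \<omega>"
    using \<delta> by (intro tendsto_mult_left_zero tendsto_rabs_zero)
  ultimately show ?thesis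
    using x by (intro approxI_bound) (auto intro!: bs index_elt_closed)
qed

text \<open>\<open>f n\<close> commutes with its own square, which is asymptotically
  \<open>e n\<close>.\<close>

lemma fe_commute: "approx \<omega> (\<lambda>n. f n \<otimes> e n) (\<lambda>n. e n \<otimes> f n)"
proof -
  have "approx \<omega> (\<lambda>n. f n \<otimes> e n) (\<lambda>n. f n \<otimes> (f n \<otimes> f n))"
    by (intro approx_mult approx_refl f approx_sym[OF ff])
  also have "(\<lambda>n. f n \<otimes> (f n \<otimes> f n)) = (\<lambda>n. (f n \<otimes> f n) \<otimes> f n)"
    by (simp add: m_assoc)
  also have "approx \<omega> (\<lambda>n. (f n \<otimes> f n) \<otimes> f n) (\<lambda>n. e n \<otimes> f n)"
    by (intro approx_mult approx_refl f ff)
  finally show ?thesis .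
qed

lemma z_move: "x \<in> carrier A \<Longrightarrow> y \<in> carrier A \<Longrightarrow> x \<otimes> (z \<otimes> y) = z \<otimes> (x \<otimes> y)"
  using index_elt_central[of x] by (simp add: m_assoc[symmetric])

text \<open>Both occurrences of \<open>e\<close> are split as f f. Covariance applied to f b turns z
  f E(f (f b)) into e f b; the remaining outer f passes e and joins the inner one.\<close>

lemma e_E_e:
  assumes b: "b \<in> carrier A"
  shows "approx \<omega> (\<lambda>n. z \<otimes> (e n \<otimes> E (e n \<otimes> b))) (\<lambda>n. e n \<otimes> (e n \<otimes> b))"
proof -
  have "approx \<omega> (\<lambda>n. z \<otimes> (e n \<otimes> E (e n \<otimes> b))) (\<lambda>n. z \<otimes> ((f n \<otimes> f n) \<otimes> E ((f n \<otimes> f n) \<otimes> b)))"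
    using b by (intro approx_mult approx_E approx_refl bseq_const approx_sym[OF ff] index_elt_closed)
  also have "(\<lambda>n. z \<otimes> ((f n \<otimes> f n) \<otimes> E ((f n \<otimes> f n) \<otimes> b))) =
      (\<lambda>n. f n \<otimes> (z \<otimes> (f n \<otimes> E (f n \<otimes> (f n \<otimes> b)))))"
    using b by (simp add: m_assoc z_move)
  also have "approx \<omega> \<dots> (\<lambda>n. f n \<otimes> (e n \<otimes> (f n \<otimes> b)))"
    using b by (intro approx_mult approx_refl f covariance bs)
  also have "(\<lambda>n. f n \<otimes> (e n \<otimes> (f n \<otimes> b))) = (\<lambda>n. (f n \<otimes> e n) \<otimes> (f n \<otimes> b))"
    using b by (simp add: m_assoc)
  also have "approx \<omega> \<dots> (\<lambda>n. (e n \<otimes> f n) \<otimes> (f n \<otimes> b))"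
    using b by (intro approx_mult approx_refl fe_commute bs)
  also have "(\<lambda>n. (e n \<otimes> f n) \<otimes> (f n \<otimes> b)) = (\<lambda>n. e n \<otimes> ((f n \<otimes> f n) \<otimes> b))"
    using b by (simp add: m_assoc)
  also have "approx \<omega> \<dots> (\<lambda>n. e n \<otimes> (e n \<otimes> b))"
    using b by (intro approx_mult approx_refl ff bs)
  finally show ?thesis .
qed

text \<open>The distance to \<open>I\<close> tends to 0 along \<omega>. The nearby element is only
  asserted to exist at each n, so that no sequence in \<open>I\<close> has to be carried
  along.\<close>

definition near_I :: "(nat \<Rightarrow> 'a) \<Rightarrow> bool" where
  "near_I g \<longleftrightarrow> (\<forall>\<epsilon>>0. \<forall>\<^sub>F n in \<omega>. \<exists>i\<in>I. nrm A (g n \<ominus> i) < \<epsilon>)"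

lemma near_I_approx:
  assumes gg: "approx \<omega> g g'" and n: "near_I g" shows "near_I g'"
  unfolding near_I_def
proof (intro allI impI)
  fix \<epsilon> :: real assume \<epsilon>: "\<epsilon> > 0"
  have "\<forall>\<^sub>F n in \<omega>. nrm A (g n \<ominus> g' n) < \<epsilon> / 2"
    using approxD(3)[OF gg] \<epsilon> by (intro order_tendstoD) auto
  moreover have "\<forall>\<^sub>F n in \<omega>. \<exists>i\<in>I. nrm A (g n \<ominus> i) < \<epsilon> / 2"
    using n half_gt_zero[OF \<epsilon>] unfolding near_I_def by blast
  ultimately show "\<forall>\<^sub>F n in \<omega>. \<exists>i\<in>I. nrm A (g' n \<ominus> i) < \<epsilon>"
  proof eventually_elim
    case (elim n)
    then obtain i where i: "i \<in> I" "nrm A (g n \<ominus> i) < \<epsilon> / 2" by blast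
    have "g n \<in> carrier A" "g' n \<in> carrier A" using approxD(1,2)[OF gg] by auto
    then have "nrm A (g' n \<ominus> i) \<le> nrm A (g n \<ominus> g' n) + nrm A (g n \<ominus> i)"
      using nrm_diff_trans[of "g' n" "g n" i] nrm_diff_commute[of "g n" "g' n"] i by simp
    then show ?case using elim(1) i by (intro bexI[of _ i]) auto
  qed
qed

lemma near_I_add:
  assumes g: "near_I g" "near_I g'" "bseq g" "bseq g'" shows "near_I (\<lambda>n. g n \<oplus> g' n)"
  unfolding near_I_def
proof (intro allI impI)
  fix \<epsilon> :: real assume \<epsilon>: "\<epsilon> > 0"
  have "\<forall>\<^sub>F n in \<omega>. \<exists>i\<in>I. nrm A (g n \<ominus> i) < \<epsilon> / 2" "\<forall>\<^sub>F n in \<omega>. \<exists>i\<in>I. nrm A (g' n \<ominus> i) < \<epsilon> / 2"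
    using g(1,2) half_gt_zero[OF \<epsilon>] unfolding near_I_def by blast+
  then show "\<forall>\<^sub>F n in \<omega>. \<exists>i\<in>I. nrm A (g n \<oplus> g' n \<ominus> i) < \<epsilon>"
  proof eventually_elim
    case (elim n)
    then obtain i j where ij: "i \<in> I" "nrm A (g n \<ominus> i) < \<epsilon> / 2" "j \<in> I" "nrm A (g' n \<ominus> j) < \<epsilon> / 2" by blast
    have c: "g n \<in> carrier A" "g' n \<in> carrier A" "i \<in> carrier A" "j \<in> carrier A" using g ij by auto
    then have "g n \<oplus> g' n \<ominus> (i \<oplus> j) = (g n \<ominus> i) \<oplus> (g' n \<ominus> j)" by (simp add: to_smult a_ac)
    then have "nrm A (g n \<oplus> g' n \<ominus> (i \<oplus> j)) \<le> nrm A (g n \<ominus> i) + nrm A (g' n \<ominus> j)"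
      using nrm_triangle[of "g n \<ominus> i" "g' n \<ominus> j"] c by simp
    then show ?case using ij by (intro bexI[of _ "i \<oplus> j"] I_add) auto
  qed
qed

text \<open>The sequence \<open>g\<close> lies in \<open>I\<close> exactly, as \<open>p\<close> does
  and the outer factors are in \<open>P\<close>. Pulling everything under one \<open>E\<close> and
  moving \<open>e\<close> past the constant a z p brings it next to E(e b), where
  \<open>e_E_e\<close> applies; both factors \<open>e\<close> are then moved back to the
  left.\<close>

lemma E_ee_I:
  assumes p: "p \<in> I" and a: "a \<in> carrier A" and b: "b \<in> carrier A"
  shows "near_I (\<lambda>n. E (e n \<otimes> (e n \<otimes> (a \<otimes> p \<otimes> b))))"
proof (rule near_I_approx)
  define g where "g = (\<lambda>n. E (e n \<otimes> (a \<otimes> z)) \<otimes> p \<otimes> E (e n \<otimes> b))"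
  have pC: "p \<in> carrier A" using p by simp
  have gI: "g n \<in> I" for n
    unfolding g_def using p a b by (intro I_left I_right E_closed_P) auto
  have "nrm A (g n \<ominus> g n) = 0" for n using gI by simp
  then show "near_I g"
    unfolding near_I_def using gI by (intro allI impI always_eventually) metis
  have g_eq: "g = (\<lambda>n. E ((e n \<otimes> (a \<otimes> z \<otimes> p)) \<otimes> E (e n \<otimes> b)))"
    unfolding g_def using p pC a b by (simp add: E_right[symmetric] m_assoc)
  have "approx \<omega> g (\<lambda>n. E (((a \<otimes> z \<otimes> p) \<otimes> e n) \<otimes> E (e n \<otimes> b)))"
    unfolding g_eq using pC a b by (intro approx_E approx_mult e_central approx_refl bs m_closed index_elt_closed)
  also have "(\<lambda>n. E (((a \<otimes> z \<otimes> p) \<otimes> e n) \<otimes> E (e n \<otimes> b))) = (\<lambda>n. E ((a \<otimes> p) \<otimes> (z \<otimes> (e n \<otimes> E (e n \<otimes> b)))))"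
    using pC a b by (simp add: m_assoc z_move)
  also have "approx \<omega> \<dots> (\<lambda>n. E ((a \<otimes> p) \<otimes> (e n \<otimes> (e n \<otimes> b))))"
    using pC a b by (intro approx_E approx_mult e_E_e approx_refl bs m_closed)
  also have "(\<lambda>n. E ((a \<otimes> p) \<otimes> (e n \<otimes> (e n \<otimes> b)))) = (\<lambda>n. E (((a \<otimes> p) \<otimes> e n) \<otimes> (e n \<otimes> b)))"
    using pC a b by (simp add: m_assoc)
  also have "approx \<omega> \<dots> (\<lambda>n. E ((e n \<otimes> (a \<otimes> p)) \<otimes> (e n \<otimes> b)))"
    using pC a b by (intro approx_E approx_mult approx_sym[OF e_central] approx_refl bs m_closed)
  also have "(\<lambda>n. E ((e n \<otimes> (a \<otimes> p)) \<otimes> (e n \<otimes> b))) = (\<lambda>n. E (e n \<otimes> (((a \<otimes> p) \<otimes> e n) \<otimes> b)))"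
    using pC a b by (simp add: m_assoc)
  also have "approx \<omega> \<dots> (\<lambda>n. E (e n \<otimes> ((e n \<otimes> (a \<otimes> p)) \<otimes> b)))"
    using pC a b by (intro approx_E approx_mult approx_sym[OF e_central] approx_refl bs m_closed)
  also have "(\<lambda>n. E (e n \<otimes> ((e n \<otimes> (a \<otimes> p)) \<otimes> b))) = (\<lambda>n. E (e n \<otimes> (e n \<otimes> (a \<otimes> p \<otimes> b))))"
    using pC a b by (simp add: m_assoc)
  finally show "approx \<omega> g (\<lambda>n. E (e n \<otimes> (e n \<otimes> (a \<otimes> p \<otimes> b))))" .
qed

text \<open>Letting \<open>a\<close> and \<open>b\<close> range over all of \<open>A\<close> makes
  \<open>?M\<close> two-sided by mere regrouping of products. Closedness uses that \<open>e\<close>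
  is bounded.\<close>

lemma near_I_E_ee_z:
  assumes I0: "I \<noteq> {\<zero>}"
  shows "near_I (\<lambda>n. E (e n \<otimes> (e n \<otimes> z)))"
proof -
  let ?g = "\<lambda>a x b n. E (e n \<otimes> (e n \<otimes> (a \<otimes> x \<otimes> b)))"
  let ?M = "{x \<in> carrier A. \<forall>a\<in>carrier A. \<forall>b\<in>carrier A. near_I (?g a x b)}"
  have IM: "I \<subseteq> ?M" using E_ee_I by auto
  obtain R where R: "R > 0" "\<And>n. nrm A (e n) \<le> R" using e by (rule bseqE) blast
  have "?M = {\<zero>} \<or> ?M = carrier A"
  proof (rule ideal_of_closed)
    show "?M \<noteq> {}" using IM I_zero by blast
    have MC: "x \<in> carrier A" and MI: "a \<in> carrier A \<Longrightarrow> b \<in> carrier A \<Longrightarrow> near_I (?g a x b)"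
      if "x \<in> ?M" for x a b
      using that by blast+
    show "x \<oplus> y \<in> ?M" if x: "x \<in> ?M" and y: "y \<in> ?M" for x y
    proof (intro CollectI conjI ballI)
      have c: "x \<in> carrier A" "y \<in> carrier A" using x y by (simp_all only: MC)
      then show "x \<oplus> y \<in> carrier A" by simp
      fix a b assume ab: "a \<in> carrier A" "b \<in> carrier A"
      have "?g a (x \<oplus> y) b = (\<lambda>n. ?g a x b n \<oplus> ?g a y b n)"
        using ab c by (simp add: l_distr r_distr E_add)
      moreover have "near_I (\<lambda>n. ?g a x b n \<oplus> ?g a y b n)"
        using ab c by (intro near_I_add MI[OF x ab] MI[OF y ab] bs m_closed)
      ultimately show "near_I (?g a (x \<oplus> y) b)" by (simp only:)
    qed
    show "c \<otimes> x \<in> ?M" if x: "x \<in> ?M" and c: "c \<in> carrier A" for x c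
    proof (intro CollectI conjI ballI)
      show "c \<otimes> x \<in> carrier A" using MC[OF x] c by simp
      fix a b assume ab: "a \<in> carrier A" "b \<in> carrier A"
      have "?g a (c \<otimes> x) b = ?g (a \<otimes> c) x b" using ab c MC[OF x] by (simp add: m_assoc)
      then show "near_I (?g a (c \<otimes> x) b)" using MI[OF x m_closed[OF ab(1) c] ab(2)] by (simp only:)
    qed
    show "x \<otimes> c \<in> ?M" if x: "x \<in> ?M" and c: "c \<in> carrier A" for x c
    proof (intro CollectI conjI ballI)
      show "x \<otimes> c \<in> carrier A" using MC[OF x] c by simp
      fix a b assume ab: "a \<in> carrier A" "b \<in> carrier A"
      have "?g a (x \<otimes> c) b = ?g a x (c \<otimes> b)" using ab c MC[OF x] by (simp add: m_assoc)
      then show "near_I (?g a (x \<otimes> c) b)" using MI[OF x ab(1) m_closed[OF c ab(2)]] by (simp only:)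
    qed
    fix x l assume x: "\<And>n. x n \<in> ?M" and l: "l \<in> carrier A" "(\<lambda>n. nrm A (x n \<ominus> l)) \<longlonglongrightarrow> 0"
    have xC: "x k \<in> carrier A" for k by (rule MC[OF x])
    have "near_I (?g a l b)" if a: "a \<in> carrier A" and b: "b \<in> carrier A" for a b
      unfolding near_I_def
    proof (intro allI impI)
      fix \<epsilon> :: real assume \<epsilon>: "\<epsilon> > 0"
      \<comment> \<open>A Lipschitz constant of \<open>?g a x b n\<close> in x that does not depend
        on n; the 2 is that of \<open>nrm_E_le\<close>.\<close>
      let ?D = "2 * (R * (R * (nrm A a * nrm A b)))"
      have "(\<lambda>k. ?D * nrm A (x k \<ominus> l)) \<longlonglongrightarrow> 0" using l(2) by (rule tendsto_mult_right_zero)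
      then have "\<forall>\<^sub>F k in sequentially. ?D * nrm A (x k \<ominus> l) < \<epsilon> / 2" using \<epsilon> by (intro order_tendstoD) auto
      then obtain k where k: "?D * nrm A (x k \<ominus> l) < \<epsilon> / 2" by (auto simp: eventually_sequentially)
      have gC: "?g a v b n \<in> carrier A" if "v \<in> carrier A" for v n using that a b by simp
      have d: "nrm A (?g a (x k) b n \<ominus> ?g a l b n) < \<epsilon> / 2" for n
      proof -
        have "?g a (x k) b n \<ominus> ?g a l b n = ?g a (x k \<ominus> l) b n"
          using a b xC[of k] l by (simp add: to_smult l_distr r_distr E_add E_smult)
        moreover have "nrm A (e n \<otimes> (e n \<otimes> (a \<otimes> (x k \<ominus> l) \<otimes> b)))
            \<le> R * (R * (nrm A a * nrm A (x k \<ominus> l) * nrm A b))"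
          using a b xC[of k] l R(2) by (intro nrm_mult_le) auto
        ultimately have "nrm A (?g a (x k) b n \<ominus> ?g a l b n) \<le> ?D * nrm A (x k \<ominus> l)"
          using nrm_E_le[of "e n \<otimes> (e n \<otimes> (a \<otimes> (x k \<ominus> l) \<otimes> b))"] a b xC[of k] l
          by (simp add: mult_ac)
        then show ?thesis using k by linarith
      qed
      have "\<forall>\<^sub>F n in \<omega>. \<exists>i\<in>I. nrm A (?g a (x k) b n \<ominus> i) < \<epsilon> / 2"
        using MI[OF x[of k] a b] half_gt_zero[OF \<epsilon>] unfolding near_I_def by blast
      then show "\<forall>\<^sub>F n in \<omega>. \<exists>i\<in>I. nrm A (?g a l b n \<ominus> i) < \<epsilon>"
      proof eventually_elim
        case (elim n)
        then obtain i where i: "i \<in> I" "nrm A (?g a (x k) b n \<ominus> i) < \<epsilon> / 2" by blast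
        have "nrm A (?g a l b n \<ominus> i) \<le> nrm A (?g a l b n \<ominus> ?g a (x k) b n) + nrm A (?g a (x k) b n \<ominus> i)"
          using i by (intro nrm_diff_trans gC l(1) xC) auto
        also have "nrm A (?g a l b n \<ominus> ?g a (x k) b n) = nrm A (?g a (x k) b n \<ominus> ?g a l b n)"
          by (intro nrm_diff_commute gC l(1) xC)
        finally show ?case using i d[of n] by (intro bexI[of _ i]) auto
      qed
    qed
    then show "l \<in> ?M" using l(1) by blast
  qed auto
  moreover have "?M \<noteq> {\<zero>}" using IM I0 I_zero by blast
  \<comment> \<open>Now the middle factor may be \<open>\<one>\<close>, and the choice
    \<open>a = \<one>\<close>, \<open>b = z\<close> gives the claim.\<close>
  ultimately have "\<one> \<in> ?M" by auto
  then have "\<forall>a\<in>carrier A. \<forall>b\<in>carrier A. near_I (?g a \<one> b)"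
    unfolding mem_Collect_eq by (rule conjunct2)
  from bspec[OF bspec[OF this one_closed] index_elt_closed] have "near_I (?g \<one> \<one> z)" .
  then show ?thesis by simp
qed

text \<open>E(f y) is pulled into the first expectation and the second \<open>e\<close> there is
  split as f f. The inner f gives z f E(f y) = e y; the outer f passes \<open>e\<close>, and
  covariance for e e y produces the third factor \<open>e\<close>.\<close>

lemma e_cubed:
  assumes y: "bseq y"
  shows "approx \<omega> (\<lambda>n. z \<otimes> (f n \<otimes> (E (e n \<otimes> (e n \<otimes> z)) \<otimes> E (f n \<otimes> y n))))
    (\<lambda>n. e n \<otimes> (e n \<otimes> (e n \<otimes> y n)))"
proof -
  have yC [simp]: "y n \<in> carrier A" for n using y by simp
  have eq: "(\<lambda>n. z \<otimes> (f n \<otimes> (E (e n \<otimes> (e n \<otimes> z)) \<otimes> E (f n \<otimes> y n)))) =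
      (\<lambda>n. z \<otimes> (f n \<otimes> E (e n \<otimes> (e n \<otimes> (z \<otimes> E (f n \<otimes> y n))))))"
    by (simp add: E_right[symmetric] m_assoc)
  have "approx \<omega> (\<lambda>n. z \<otimes> (f n \<otimes> (E (e n \<otimes> (e n \<otimes> z)) \<otimes> E (f n \<otimes> y n))))
      (\<lambda>n. z \<otimes> (f n \<otimes> E (e n \<otimes> ((f n \<otimes> f n) \<otimes> (z \<otimes> E (f n \<otimes> y n))))))"
    unfolding eq using y by (intro approx_mult approx_E approx_refl bs approx_sym[OF ff] index_elt_closed)
  also have "(\<lambda>n. z \<otimes> (f n \<otimes> E (e n \<otimes> ((f n \<otimes> f n) \<otimes> (z \<otimes> E (f n \<otimes> y n)))))) =
      (\<lambda>n. z \<otimes> (f n \<otimes> E ((e n \<otimes> f n) \<otimes> (z \<otimes> (f n \<otimes> E (f n \<otimes> y n))))))"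
    by (simp add: m_assoc z_move)
  also have "approx \<omega> \<dots> (\<lambda>n. z \<otimes> (f n \<otimes> E ((f n \<otimes> e n) \<otimes> (e n \<otimes> y n))))"
    using y by (intro approx_mult approx_E approx_refl bs covariance approx_sym[OF fe_commute] index_elt_closed)
  also have "(\<lambda>n. z \<otimes> (f n \<otimes> E ((f n \<otimes> e n) \<otimes> (e n \<otimes> y n)))) =
      (\<lambda>n. z \<otimes> (f n \<otimes> E (f n \<otimes> (e n \<otimes> (e n \<otimes> y n)))))"
    by (simp add: m_assoc)
  also have "approx \<omega> \<dots> (\<lambda>n. e n \<otimes> (e n \<otimes> (e n \<otimes> y n)))"
    using y by (intro covariance bs)
  finally show ?thesis .
qed

text \<open>If the bound fails at n, a vector of the unit ball violating it is selected. The
  selected vectors form one bounded sequence, to which \<open>e_cubed\<close> applies, so along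
  \<omega> none can violate the bound.\<close>

lemma e_cubed_uniform:
  assumes c: "c > 0"
  shows "\<forall>\<^sub>F n in \<omega>. \<forall>y\<in>carrier A.
    nrm A (e n \<otimes> (e n \<otimes> (e n \<otimes> y)) \<ominus> z \<otimes> (f n \<otimes> (E (e n \<otimes> (e n \<otimes> z)) \<otimes> E (f n \<otimes> y)))) \<le> c * nrm A y"
proof -
  let ?S = "\<lambda>n y. e n \<otimes> (e n \<otimes> (e n \<otimes> y)) \<ominus> z \<otimes> (f n \<otimes> (E (e n \<otimes> (e n \<otimes> z)) \<otimes> E (f n \<otimes> y)))"
  define bad where "bad = (\<lambda>n y. y \<in> carrier A \<and> nrm A y \<le> 1 \<and> \<not> nrm A (?S n y) \<le> c)"
  \<comment> \<open>The value \<open>\<zero>\<close> at indices without a violating vector keeps the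
    sequence in the unit ball.\<close>
  define y where "y = (\<lambda>n. if \<exists>y. bad n y then SOME y. bad n y else \<zero>)"
  have bad: "bad n (y n)" if "\<exists>y. bad n y" for n
    using someI_ex[OF that] that by (simp add: y_def)
  have yb: "y n \<in> carrier A \<and> nrm A (y n) \<le> 1" for n
    using bad[of n] by (cases "\<exists>y. bad n y") (auto simp: bad_def y_def)
  then have "bseq y" by (intro bseqI[of _ 1]) auto
  from approxD(3)[OF approx_sym[OF e_cubed[OF this]]]
  have "\<forall>\<^sub>F n in \<omega>. nrm A (?S n (y n)) < c" using c by (intro order_tendstoD) auto
  then show ?thesis
  proof eventually_elim
    case (elim n)
    then have "\<not> bad n (y n)" by (simp add: bad_def)
    then have "\<not> bad n y'" for y' using bad by blast
    then have le: "nrm A (?S n y') \<le> c" if "y' \<in> carrier A" "nrm A y' \<le> 1" for y'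
      using that unfolding bad_def by blast
    show ?case
    proof
      fix x assume x: "x \<in> carrier A"
      show "nrm A (?S n x) \<le> c * nrm A x"
        by (rule nrm_le_of_homogeneous[OF _ _ le x])
           (simp_all add: to_smult E_smult mult.commute)
    qed
  qed
qed

text \<open>Replacing E(e^2 z) by a nearby element of \<open>I\<close> moves e^3 y into
  \<open>J\<close> up to a small multiple of the norm of y. Smallness on the quotient becomes
  smallness in \<open>A\<close>, as e^3 is selfadjoint.\<close>

lemma e_null:
  assumes I0: "I \<noteq> {\<zero>}"
  shows "approx \<omega> e (\<lambda>_. \<zero>)"
proof -
  obtain F where F: "F > 0" "\<And>n. nrm A (f n) \<le> F" using f by (rule bseqE) blast
  \<comment> \<open>The norms of \<open>z\<close>, of \<open>f n\<close> and of E(f y), the last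
    with its factor 2; adding 1 keeps \<open>D\<close> positive whatever the norm of
    \<open>z\<close>.\<close>
  define D where "D = (nrm A z + 1) * (F * (2 * F))"
  have D: "D > 0" using F nrm_nonneg[OF index_elt_closed] by (auto simp: D_def intro!: mult_pos_pos add_nonneg_pos)
  have ev: "\<forall>\<^sub>F n in \<omega>. quot_le c (e n \<otimes> (e n \<otimes> e n))" if c: "c > 0" for c
  proof -
    have "\<forall>\<^sub>F n in \<omega>. \<exists>i\<in>I. nrm A (E (e n \<otimes> (e n \<otimes> z)) \<ominus> i) < c / 2 / D"
      using near_I_E_ee_z[OF I0] c D unfolding near_I_def by simp
    then show ?thesis
      using e_cubed_uniform[OF half_gt_zero[OF c]]
    proof eventually_elim
      case (elim n)
      let ?G = "E (e n \<otimes> (e n \<otimes> z))"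
      obtain i where i: "i \<in> I" "nrm A (?G \<ominus> i) < c / 2 / D" using elim(1) by blast
      have iC: "i \<in> carrier A" and GC: "?G \<in> carrier A" using i by auto
      show ?case
        unfolding quot_le_def
      proof (intro ballI allI impI)
        fix y :: 'a and \<epsilon> :: real assume y: "y \<in> carrier A" and \<epsilon>: "\<epsilon> > 0"
        let ?w = "z \<otimes> (f n \<otimes> (i \<otimes> E (f n \<otimes> y)))" and ?v = "z \<otimes> (f n \<otimes> (?G \<otimes> E (f n \<otimes> y)))"
        let ?x = "e n \<otimes> (e n \<otimes> (e n \<otimes> y))"
        have c': "?w \<in> carrier A" "?v \<in> carrier A" "?x \<in> carrier A" using y iC GC by auto
        \<comment> \<open>Here the right ideal property counts: i E(f y) remains in
          \<open>I\<close>.\<close>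
        have "(z \<otimes> f n) \<otimes> (i \<otimes> E (f n \<otimes> y)) \<in> J"
          using y i by (intro J_mult_I I_right E_closed_P) auto
        then have wL: "?w \<in> J" using y iC by (simp add: m_assoc)
        have "?v \<ominus> ?w = z \<otimes> (f n \<otimes> ((?G \<ominus> i) \<otimes> E (f n \<otimes> y)))"
          using y iC GC by (simp add: to_smult l_distr r_distr)
        also have "nrm A \<dots> \<le> (nrm A z + 1) * (F * (c / 2 / D * (2 * (F * nrm A y))))"
        proof (intro nrm_mult_le)
          show "nrm A (E (f n \<otimes> y)) \<le> 2 * (F * nrm A y)"
            using nrm_E_le[of "f n \<otimes> y"] nrm_mult_le[of "f n" y F "nrm A y"] F(2)[of n] y by simp
        qed (use y iC i GC F in auto)
        also have "\<dots> = (D * (c / 2 / D)) * nrm A y" by (simp add: D_def mult_ac)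
        also have "D * (c / 2 / D) = c / 2" using D by simp
        finally have "nrm A (?v \<ominus> ?w) \<le> c / 2 * nrm A y" .
        moreover have "nrm A (?x \<ominus> ?v) \<le> c / 2 * nrm A y" using elim(2) y by blast
        moreover have "nrm A (?x \<ominus> ?w) \<le> nrm A (?x \<ominus> ?v) + nrm A (?v \<ominus> ?w)"
          using c' by (intro nrm_diff_trans)
        moreover have "0 \<le> \<epsilon> * nrm A y" using \<epsilon> y nrm_nonneg by simp
        ultimately have "nrm A (?x \<ominus> ?w) \<le> (c + \<epsilon>) * nrm A y"
          by (simp add: distrib_right)
        moreover have "e n \<otimes> (e n \<otimes> e n) \<otimes> y = ?x" using y by (simp add: m_assoc)
        ultimately show "\<exists>w\<in>J. nrm A (e n \<otimes> (e n \<otimes> e n) \<otimes> y \<ominus> w) \<le> (c + \<epsilon>) * nrm A y"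
          using wL by auto
      qed
    qed
  qed
  \<comment> \<open>The C*-identity gives the fourth power of the norm exactly, and e^4 = e^3 e; one
    factor is cancelled.\<close>
  have cube: "nrm A (e n) ^ 3 \<le> nrm A (e n \<otimes> (e n \<otimes> e n))" for n
  proof (cases "nrm A (e n) = 0")
    case False
    then have pos: "nrm A (e n) > 0" using nrm_nonneg[OF eC, of n] by simp
    have "nrm A (e n) ^ 3 * nrm A (e n) = nrm A ((e n \<otimes> e n) \<otimes> (e n \<otimes> e n))"
      using nrm_selfadjoint_square[of "e n"] nrm_selfadjoint_square[of "e n \<otimes> e n"] e_star
      by (simp add: star_mult eval_nat_numeral)
    also have "(e n \<otimes> e n) \<otimes> (e n \<otimes> e n) = (e n \<otimes> (e n \<otimes> e n)) \<otimes> e n" by (simp add: m_assoc)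
    also have "nrm A \<dots> \<le> nrm A (e n \<otimes> (e n \<otimes> e n)) * nrm A (e n)" by (intro nrm_mult) auto
    finally show ?thesis using pos by simp
  qed (simp add: nrm_nonneg)
  have "((\<lambda>n. nrm A (e n)) \<longlongrightarrow> 0) \<omega>"
  proof (rule tendstoI)
    fix \<epsilon> :: real assume \<epsilon>: "\<epsilon> > 0"
    then have "(\<epsilon> / 2) ^ 3 > 0" by simp
    from ev[OF this] show "\<forall>\<^sub>F n in \<omega>. dist (nrm A (e n)) 0 < \<epsilon>"
    proof eventually_elim
      case (elim n)
      have "nrm A (e n \<otimes> (e n \<otimes> e n)) \<le> (\<epsilon> / 2) ^ 3"
        using elim \<epsilon> e_star by (intro nrm_le_of_quot_le) (auto simp: star_mult m_assoc)
      then have "nrm A (e n) ^ 3 \<le> (\<epsilon> / 2) ^ 3" using cube[of n] by linarith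
      then have "nrm A (e n) \<le> \<epsilon> / 2" using \<epsilon> by (subst (asm) power_mono_iff) (auto simp: nrm_nonneg)
      then show ?case using \<epsilon> by (simp add: nrm_nonneg)
    qed
  qed
  then show ?thesis using e by (auto simp: approx_def a_minus_def)
qed

end

theorem proposition3p9:
  fixes \<omega> :: "nat filter"
    and A :: "'a cstar"
    and P :: "'a set"
    and E :: "'a \<Rightarrow> 'a"
  assumes "free_ultrafilter \<omega>"
    and "cstar_algebra A"
    and "separable_space (norm_topology A)"
    and "unital_cstar_subalgebra P A"
    and "separable_space (norm_topology (A\<lparr>carrier := P\<rparr>))"
    and "conditional_expectation A P E"
    and "index_finite A E"
    and "simple_cstar A"
    and "weak_tracial_Rokhlin \<omega> A P E"
  shows "simple_cstar (A\<lparr>carrier := P\<rparr>)"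
proof -
  interpret index_finite_expectation A P E
    by (rule index_finite_expectation.intro[OF assms(2)
          index_finite_expectation_axioms.intro[OF assms(4,6,7)]])
  have \<omega>: "\<omega> \<noteq> bot" using assms(1) by (simp add: free_ultrafilter_def)
  have one: "\<one>\<^bsub>A\<^esub> \<noteq> \<zero>\<^bsub>A\<^esub>"
    using conjunct1[OF assms(8)[unfolded simple_cstar_def]] one_zeroD by (rule contrapos_nn)
  have "I = {\<zero>\<^bsub>A\<^esub>} \<or> I = P" if I: "ideal I (A\<lparr>carrier := P\<rparr>)" for I
  proof (rule ccontr)
    assume "\<not> (I = {\<zero>\<^bsub>A\<^esub>} \<or> I = P)"
    then have c: "I \<noteq> {\<zero>\<^bsub>A\<^esub>}" "I \<noteq> P" by simp_all
    show False
    proof (rule Rokhlin_sequences[OF \<omega> one assms(9)])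
      fix e f \<delta>
      assume ef: "bseq e" "bseq f" "\<And>n. star A (e n) = e n"
        "\<And>x. x \<in> carrier A \<Longrightarrow> approx \<omega> (\<lambda>n. e n \<otimes>\<^bsub>A\<^esub> x) (\<lambda>n. x \<otimes>\<^bsub>A\<^esub> e n)"
        "\<not> approx \<omega> e (\<lambda>_. \<zero>\<^bsub>A\<^esub>)" "approx \<omega> (\<lambda>n. f n \<otimes>\<^bsub>A\<^esub> f n) e" "(\<delta> \<longlongrightarrow> 0) \<omega>"
        "\<And>n x. x \<in> carrier A \<Longrightarrow>
          nrm A (index_elt A E \<otimes>\<^bsub>A\<^esub> (f n \<otimes>\<^bsub>A\<^esub> E (f n \<otimes>\<^bsub>A\<^esub> x)) \<ominus>\<^bsub>A\<^esub> e n \<otimes>\<^bsub>A\<^esub> x) \<le> \<delta> n * nrm A x"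
      have "proper_ideal A P E I"
        by (rule proper_ideal.intro[OF index_finite_expectation_axioms
              proper_ideal_axioms.intro[OF I c(2) assms(8)]])
      then have "Rokhlin_sequence A P E I \<omega> e f \<delta>"
        by (rule Rokhlin_sequence.intro[OF _ Rokhlin_sequence_axioms.intro[OF ef(1-4,6-8)]])
      from Rokhlin_sequence.e_null[OF this c(1)] ef(5) show False by (rule notE[rotated])
    qed
  qed
  moreover have "P \<noteq> {\<zero>\<^bsub>A\<^esub>}" using one P_one by blast
  ultimately show ?thesis by (simp add: simple_cstar_def)
qed

end
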